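(* Let $G$ be a complex affine algebraic group with Lie algebra $\mathfrak g$, let $Z\in\mathfrak g$ be semisimple and let $f\in[Z,\mathfrak g]$. Let $r$ be an admissible ray. Then there is a unique holomorphic function $Y_r:\mathbb H_r\to G$ such that $$\frac{dY_r}{dt}=\left(\frac{Z}{t^2}+\frac ft\right)Y_r$$ and $$Y_r\cdot e^{Z/t}\to1\quad\text{as}\quad t\to0\ \text{in}\ \mathbb H_r.$$
   Context: Since $Z$ is semisimple, $\mathfrak g=\mathfrak g^Z\oplus[Z,\mathfrak g]$, where $\mathfrak g^Z$ is the centraliser of $Z$ and $[Z,\mathfrak g]$ is the span of the non-zero eigenspaces of $\mathrm{ad}(Z)$; the assumption on $f$ is that its projection to $\mathfrak g^Z$ is zero. A ray is a subset of $\mathbb C^*$ of the form $\mathbb R_{>0}e^{i\pi\phi}$. The Stokes rays of the connection $d-\left(\frac Z{t^2}+\frac ft\right)dt$ are the rays $\mathbb R_{>0}\zeta$, where $\zeta$ ranges over the non-zero eigenvalues of $\mathrm{ad}(Z)$ on $\mathfrak g$; a ray is admissible if it is not a Stokes ray. For a ray $r$, $\mathbb H_r=\{uv:u\in r,\ \mathrm{Re}(v)>0\}\subset\mathbb C$ is the open half-plane centred on $r$. The differential equation may be read in any faithful finite-dimensional representation of $G$. *)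

theory Defs
  imports "HOL-Complex_Analysis.Complex_Analysis"
begin

text \<open>
  Matrices of type \<^typ>\<open>complex^'n^'n\<close> are multiplied with \<open>**\<close>; the library's \<open>*\<close>, \<open>^\<close> on this
  type are componentwise and are not used.
\<close>

definition cscale :: "complex \<Rightarrow> complex^'n^'m \<Rightarrow> complex^'n^'m" (infixr "*\<^sub>C" 75)
  where "c *\<^sub>C A = (\<chi> i j. c * A $ i $ j)"

global_interpretation cmat: vector_space "cscale :: complex \<Rightarrow> complex^'n^'m \<Rightarrow> complex^'n^'m"
  by unfold_locales (simp_all add: cscale_def vec_eq_iff algebra_simps)

definition mexp :: "complex^'n^'n \<Rightarrow> complex^'n^'n"
  where "mexp A = (\<Sum>k. inverse (fact k) *\<^sub>R (((**) A ^^ k) (mat 1)))"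

definition commutator :: "complex^'n^'n \<Rightarrow> complex^'n^'n \<Rightarrow> complex^'n^'n"
  where "commutator A B = A ** B - B ** A"


subsection \<open>Affine algebraic groups and their Lie algebras\<close>

text \<open>
  A complex affine algebraic group is given together with a faithful finite-dimensional
  representation, that is, as a Zariski closed subgroup of \<open>GL\<^sub>n\<close> with \<open>n = CARD('n)\<close> arbitrary.
  The complex polynomials in the matrix entries are represented by the functions they induce
  (compare \<^const>\<open>real_polynomial_function\<close>).
\<close>

inductive matrix_polynomial :: "(complex^'n^'n \<Rightarrow> complex) \<Rightarrow> bool" where
  const: "matrix_polynomial (\<lambda>A. c)"
| entry: "matrix_polynomial (\<lambda>A. A $ i $ j)"
| add: "matrix_polynomial p \<Longrightarrow> matrix_polynomial q \<Longrightarrow> matrix_polynomial (\<lambda>A. p A + q A)"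
| mult: "matrix_polynomial p \<Longrightarrow> matrix_polynomial q \<Longrightarrow> matrix_polynomial (\<lambda>A. p A * q A)"

definition algebraic_group :: "(complex^'n^'n) set \<Rightarrow> bool" where
  "algebraic_group G \<longleftrightarrow>
     (\<exists>S. (\<forall>p\<in>S. matrix_polynomial p) \<and> G = {A. invertible A \<and> (\<forall>p\<in>S. p A = 0)}) \<and>
     mat 1 \<in> G \<and> (\<forall>A\<in>G. \<forall>B\<in>G. A ** B \<in> G) \<and> (\<forall>A\<in>G. matrix_inv A \<in> G)"

text \<open>
  The Lie algebra is the Zariski tangent space at the identity: the common kernel of the
  differentials at \<open>1\<close> of all polynomials vanishing on \<open>G\<close>. (Allowing powers of \<open>1/det\<close> in the
  polynomials would not change it.)
\<close>

definition lie_algebra :: "(complex^'n^'n) set \<Rightarrow> (complex^'n^'n) set" where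
  "lie_algebra G = {X. \<forall>p. matrix_polynomial p \<and> (\<forall>A\<in>G. p A = 0) \<longrightarrow>
     ((\<lambda>s::complex. p (mat 1 + s *\<^sub>C X)) has_field_derivative 0) (at 0)}"

text \<open>
  Semisimplicity of an element of the Lie algebra of an algebraic group refers to its Jordan
  decomposition, and so means diagonalisability in a faithful representation; semisimplicity
  of \<open>ad(Z)\<close> alone would be weaker.
\<close>

definition semisimple :: "complex^'n^'n \<Rightarrow> bool" where
  "semisimple Z \<longleftrightarrow>
     (\<exists>P D :: complex^'n^'n. invertible P \<and> (\<forall>i j. i \<noteq> j \<longrightarrow> D $ i $ j = 0) \<and> Z = P ** D ** matrix_inv P)"

definition ad_eigenspace :: "complex^'n^'n \<Rightarrow> (complex^'n^'n) set \<Rightarrow> complex \<Rightarrow> (complex^'n^'n) set"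
  where "ad_eigenspace Z \<gg> \<zeta> = {X \<in> \<gg>. commutator Z X = \<zeta> *\<^sub>C X}"

text \<open>
  The space \<open>[Z, \<gg>]\<close> for semisimple \<open>Z\<close>: the complex span of the eigenspaces of \<open>ad(Z)\<close> on \<open>\<gg>\<close>
  for non-zero eigenvalues. As \<open>ad(Z)\<close> is then diagonalisable on \<open>\<gg>\<close>, it is also the image of
  \<open>ad(Z)\<close>.
\<close>

definition bracket_space :: "complex^'n^'n \<Rightarrow> (complex^'n^'n) set \<Rightarrow> (complex^'n^'n) set"
  where "bracket_space Z \<gg> = cmat.span (\<Union>\<zeta>\<in>-{0}. ad_eigenspace Z \<gg> \<zeta>)"


subsection \<open>Rays and half-planes\<close>

definition ray_through :: "complex \<Rightarrow> complex set"
  where "ray_through z = {complex_of_real s * z | s. s > 0}"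

definition is_ray :: "complex set \<Rightarrow> bool"
  where "is_ray r \<longleftrightarrow> (\<exists>\<phi>::real. r = ray_through (exp (\<i> * of_real (pi * \<phi>))))"

definition stokes_ray :: "complex^'n^'n \<Rightarrow> (complex^'n^'n) set \<Rightarrow> complex set \<Rightarrow> bool"
  where "stokes_ray Z \<gg> r \<longleftrightarrow>
    (\<exists>\<zeta>. \<zeta> \<noteq> 0 \<and> (\<exists>X\<in>ad_eigenspace Z \<gg> \<zeta>. X \<noteq> 0) \<and> r = ray_through \<zeta>)"

definition admissible_ray :: "complex^'n^'n \<Rightarrow> (complex^'n^'n) set \<Rightarrow> complex set \<Rightarrow> bool"
  where "admissible_ray Z \<gg> r \<longleftrightarrow> is_ray r \<and> \<not> stokes_ray Z \<gg> r"

definition half_plane :: "complex set \<Rightarrow> complex set"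
  where "half_plane r = {u * v | u v. u \<in> r \<and> Re v > 0}"


subsection \<open>Matrix-valued holomorphic functions\<close>

text \<open>
  \<open>G\<close> is a closed complex submanifold of \<open>GL\<^sub>n\<close>, so a map into \<open>G\<close> is holomorphic iff its
  matrix entries are.
\<close>

definition matrix_holomorphic_on :: "(complex \<Rightarrow> complex^'n^'n) \<Rightarrow> complex set \<Rightarrow> bool"
  where "matrix_holomorphic_on Y U \<longleftrightarrow> (\<forall>i j. (\<lambda>t. Y t $ i $ j) holomorphic_on U)"

definition has_matrix_derivative ::
    "(complex \<Rightarrow> complex^'n^'n) \<Rightarrow> complex^'n^'n \<Rightarrow> complex \<Rightarrow> bool"
  where "has_matrix_derivative Y D t \<longleftrightarrow>
    (\<forall>i j. ((\<lambda>t. Y t $ i $ j) has_field_derivative D $ i $ j) (at t))"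

end

theory Submission
  imports Defs
begin

text \<open>
  In the coordinate \<open>x = u / t\<close>, where \<open>r\<close> is the ray through \<open>u\<close>, the half-plane becomes \<open>Re x > 0\<close>
  and, with \<open>Z / u\<close> in place of \<open>Z\<close>, the gauge transformation \<open>T = Y exp(Z x)\<close> satisfies
  \<open>T' + [Z, T] + f T / x = 0\<close>. Admissibility says that \<open>ad Z\<close> has no positive real eigenvalue on \<open>\<gg>\<close>.

  Existence: a Newton iteration \<open>T\<^sub>n\<^sub>+\<^sub>1 = T\<^sub>n exp k\<^sub>n\<close> that never leaves \<open>G\<close>. Its starting value is
  \<open>exp(\<phi> / x)\<close> with \<open>[Z, \<phi>] = - f\<close>, which leaves a defect of order \<open>1 / x\<^sup>2\<close>, and \<open>k\<^sub>n\<close> solves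
  \<open>k' + [Z, k] = - B\<close> for the \<open>\<gg>\<close>-valued defect \<open>B\<close>. Each eigencomponent of this equation is solved by
  integrating along a ray to infinity on which the exponential factor stays bounded; such a ray exists
  inside the half-plane because the eigenvalue is not a positive real. This works uniformly on the part
  of the half-plane near infinity, including the directions close to the imaginary axis, and the result
  is continued to the whole half-plane as a solution of a linear equation, with values in \<open>G\<close> by the
  identity theorem.

  Uniqueness: two solutions differ by a constant \<open>C \<in> G\<close> with \<open>exp(- Z x) C exp(Z x) \<longlonglongrightarrow> 1\<close>. Then \<open>C - 1\<close> has only
  components of positive real weight, and if it is not zero then its component of smallest weight
  is tangent to \<open>G\<close> at \<open>1\<close>, that is, an eigenvector of \<open>ad Z\<close> in \<open>\<gg>\<close> with positive eigenvalue.
\<close>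

text \<open>A linear fixed point argument on all matrices would not show that its limit lies in
  \<open>G\<close>. Moreover \<open>ad Z\<close> may have positive real weights on all matrices, and
  for such a weight no ray in the half-plane keeps the exponential factor bounded. Admissibility
  controls only the weights in \<gg>, so every error has to be \<gg>-valued; hence the corrections
  are multiplicative and the defect is translated back to the identity by the inverse of
  \<open>T\<close>. The starting value is separate because an error of order \<open>1 / x\<close>
  cannot be integrated along a ray to infinity; \<open>f\<close> in \<open>[Z, \<gg>]\<close> is
  what removes this term. One step turns the bound \<open>\<beta> / (norm x)\<^sup>2\<close> into a
  multiple of \<open>\<beta>\<^sup>2 / (norm x) ^ 3\<close>, which far out is at most half of the
  old bound. The derivative of \<open>k\<close> is read off from its equation, so all steps take
  place on one domain. \<open>G\<close> is known only through polynomial equations and \<gg> only as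
  a Zariski tangent space. Membership is therefore mostly tested by composing with a polynomial that
  vanishes on \<open>G\<close>, or with its differential at 1, and showing that a scalar function is
  zero.\<close>

no_notation fps_nth (infixl "$" 75)

section \<open>Matrix calculus\<close>

lemma matrix_mul_minus_left: "(- A) ** B = - (A ** B)" for A :: "'a::ring_1^'n^'m"
  by (simp add: matrix_matrix_mult_def vec_eq_iff sum_negf)

lemma matrix_mul_minus_right: "A ** (- B) = - (A ** B)" for A :: "'a::ring_1^'n^'m"
  by (simp add: matrix_matrix_mult_def vec_eq_iff sum_negf)

lemma matrix_add_rdistrib: "(A + B) ** C = A ** C + B ** C" for A :: "'a::semiring_1^'n^'m"
  by (simp add: matrix_matrix_mult_def vec_eq_iff distrib_right sum.distrib)

lemma matrix_diff_ldistrib: "A ** (B - C) = A ** B - A ** C" for A :: "'a::ring_1^'n^'m"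
  using matrix_add_ldistrib[of A B "- C"] by (simp add: matrix_mul_minus_right)

lemma matrix_diff_rdistrib: "(A - B) ** C = A ** C - B ** C" for A :: "'a::ring_1^'n^'m"
  using matrix_add_rdistrib[of A "- B" C] by (simp add: matrix_mul_minus_left)

lemma matrix_mul_zero_left [simp]: "0 ** A = (0 :: 'a::semiring_1^'n^'m)"
  by (simp add: matrix_matrix_mult_def vec_eq_iff)

lemma matrix_mul_zero_right [simp]: "A ** 0 = (0 :: 'a::semiring_1^'n^'m)"
  by (simp add: matrix_matrix_mult_def vec_eq_iff)

lemma cscale_nth [simp]: "(c *\<^sub>C A) $ i $ j = c * A $ i $ j"
  by (simp add: cscale_def)

lemma matrix_mul_cscale_left: "(c *\<^sub>C A) ** B = c *\<^sub>C (A ** B)"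
  by (simp add: vec_eq_iff matrix_matrix_mult_def sum_distrib_left mult.assoc)

lemma matrix_mul_cscale_right: "A ** (c *\<^sub>C B) = c *\<^sub>C (A ** B)"
  by (simp add: vec_eq_iff matrix_matrix_mult_def sum_distrib_left mult.left_commute)

lemma matrix_mul_sum_left: "sum f S ** B = (\<Sum>s\<in>S. f s ** B)" for B :: "'a::ring_1^'n^'m"
  by (induction S rule: infinite_finite_induct) (simp_all add: matrix_add_rdistrib)

lemma matrix_mul_sum_right: "B ** sum f S = (\<Sum>s\<in>S. B ** f s)" for B :: "'a::ring_1^'n^'m"
  by (induction S rule: infinite_finite_induct) (simp_all add: matrix_add_ldistrib)

lemmas matrix_ring_simps = matrix_mul_minus_left matrix_mul_minus_right matrix_diff_ldistrib
  matrix_diff_rdistrib matrix_add_ldistrib matrix_add_rdistrib matrix_mul_cscale_left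
  matrix_mul_cscale_right matrix_mul_assoc

lemma cscale_simps:
  "c *\<^sub>C (A + B) = c *\<^sub>C A + c *\<^sub>C B" "c *\<^sub>C (A - B) = c *\<^sub>C A - c *\<^sub>C B"
  "c *\<^sub>C (- A) = - (c *\<^sub>C A)" "(c + d) *\<^sub>C A = c *\<^sub>C A + d *\<^sub>C A"
  "(c - d) *\<^sub>C A = c *\<^sub>C A - d *\<^sub>C A" "(- c) *\<^sub>C A = - (c *\<^sub>C A)"
  "c *\<^sub>C d *\<^sub>C A = (c * d) *\<^sub>C A"
  "1 *\<^sub>C A = A" "0 *\<^sub>C A = 0" "c *\<^sub>C 0 = 0"
  by (simp_all add: vec_eq_iff algebra_simps)

lemma scaleR_eq_cscale: "x *\<^sub>R A = complex_of_real x *\<^sub>C A" for A :: "complex^'n^'m"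
  by (simp only: vec_eq_iff vector_scaleR_component cscale_nth) (simp only: scaleR_conv_of_real, simp)

lemma norm_cscale: "norm (c *\<^sub>C A) = norm c * norm A"
proof -
  have "norm ((c *\<^sub>C A) $ i) = norm c * norm (A $ i)" for i
    by (simp add: norm_vec_def norm_mult L2_set_right_distrib)
  then show ?thesis
    by (simp add: norm_vec_def[of "c *\<^sub>C A"] norm_vec_def[of A] L2_set_right_distrib)
qed

lemma norm_entry_le: "norm (A $ i $ j) \<le> norm A"
  for A :: "'a::real_normed_vector^'n^'m"
  by (meson Finite_Cartesian_Product.norm_nth_le order_trans)

lemma norm_le_sum_entries: "norm A \<le> (\<Sum>i\<in>UNIV. \<Sum>j\<in>UNIV. norm (A $ i $ j))"
  for A :: "'a::real_normed_vector^'n^'m"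
proof -
  have "norm A \<le> (\<Sum>i\<in>UNIV. norm (A $ i))"
    unfolding norm_vec_def by (rule L2_set_le_sum) auto
  also have "\<dots> \<le> (\<Sum>i\<in>UNIV. \<Sum>j\<in>UNIV. norm (A $ i $ j))"
    by (rule sum_mono) (unfold norm_vec_def, rule L2_set_le_sum, auto)
  finally show ?thesis .
qed

text \<open>The norm of nested vectors is the Frobenius norm: Cauchy-Schwarz bounds each entry by a
  row norm times a column norm, and the squares are then summed over columns and rows.\<close>

lemma norm_matrix_mul_le: "norm (A ** B) \<le> norm A * norm B"
  for A :: "complex^'n^'m" and B :: "complex^'k^'n"
proof -
  have entry: "norm ((A ** B) $ i $ j) \<le> norm (A $ i) * L2_set (\<lambda>k. norm (B $ k $ j)) UNIV" for i j
  proof -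
    have "norm ((A ** B) $ i $ j) \<le> (\<Sum>k\<in>UNIV. norm (A $ i $ k) * norm (B $ k $ j))"
      by (simp add: matrix_matrix_mult_def sum_norm_le norm_mult)
    also have "\<dots> \<le> L2_set (\<lambda>k. norm (A $ i $ k)) UNIV * L2_set (\<lambda>k. norm (B $ k $ j)) UNIV"
      by (rule order_trans[OF _ L2_set_mult_ineq]) simp
    finally show ?thesis by (simp add: norm_vec_def)
  qed
  have row: "norm ((A ** B) $ i) \<le> norm (A $ i) * norm B" for i
  proof -
    have "norm ((A ** B) $ i) \<le>
        L2_set (\<lambda>j. norm (A $ i) * L2_set (\<lambda>k. norm (B $ k $ j)) UNIV) UNIV"
      unfolding norm_vec_def[of "(A ** B) $ i"] by (rule L2_set_mono) (auto simp: entry)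
    also have "\<dots> = norm (A $ i) * L2_set (\<lambda>j. L2_set (\<lambda>k. norm (B $ k $ j)) UNIV) UNIV"
      by (simp add: L2_set_right_distrib)
    also have "L2_set (\<lambda>j. L2_set (\<lambda>k. norm (B $ k $ j)) UNIV) UNIV = norm B"
    proof -
      have "(\<Sum>j\<in>UNIV. \<Sum>k\<in>UNIV. (norm (B $ k $ j))\<^sup>2) = (\<Sum>k\<in>UNIV. \<Sum>j\<in>UNIV. (norm (B $ k $ j))\<^sup>2)"
        by (rule sum.swap)
      then show ?thesis
        by (simp add: norm_vec_def L2_set_def sum_nonneg)
    qed
    finally show ?thesis .
  qed
  have "norm (A ** B) \<le> L2_set (\<lambda>i. norm (A $ i) * norm B) UNIV"
    unfolding norm_vec_def[of "A ** B"] by (rule L2_set_mono) (auto simp: row)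
  also have "\<dots> = norm A * norm B"
    by (simp add: L2_set_left_distrib norm_vec_def[of A])
  finally show ?thesis .
qed

lemma bounded_bilinear_matrix_mul:
  "bounded_bilinear ((**) :: complex^'n^'m \<Rightarrow> complex^'k^'n \<Rightarrow> complex^'k^'m)"
proof
  show "\<exists>K. \<forall>A B. norm ((A :: complex^'n^'m) ** (B :: complex^'k^'n)) \<le> norm A * norm B * K"
    by (rule exI[of _ 1]) (simp add: norm_matrix_mul_le)
qed (simp_all add: scaleR_eq_cscale matrix_ring_simps)

lemmas tendsto_matrix_mul = bounded_bilinear.tendsto[OF bounded_bilinear_matrix_mul]

lemma tendsto_matrix_iff:
  "(F \<longlongrightarrow> L) net \<longleftrightarrow> (\<forall>i j. ((\<lambda>x. F x $ i $ j) \<longlongrightarrow> L $ i $ j) net)"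
  for L :: "complex^'n^'m"
proof (intro iffI allI)
  fix i j assume "(F \<longlongrightarrow> L) net"
  then show "((\<lambda>x. F x $ i $ j) \<longlongrightarrow> L $ i $ j) net"
    by (intro tendsto_vec_nth)
next
  assume "\<forall>i j. ((\<lambda>x. F x $ i $ j) \<longlongrightarrow> L $ i $ j) net"
  then show "(F \<longlongrightarrow> L) net"
    by (intro vec_tendstoI) simp
qed

lemma matrix_inv_simps:
  fixes A :: "complex^'n^'n"
  assumes "invertible A"
  shows "A ** matrix_inv A = mat 1" "matrix_inv A ** A = mat 1"
  using someI_ex[of "\<lambda>B. A ** B = mat 1 \<and> B ** A = mat 1"] assms
  by (auto simp: matrix_inv_def invertible_def)

lemma matrix_inverse_unique:
  fixes A :: "complex^'n^'n"
  assumes "A ** B = mat 1"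
  shows "B = matrix_inv A"
proof -
  have "invertible A" using assms invertible_right_inverse by blast
  then have "matrix_inv A ** (A ** B) = B"
    by (simp add: matrix_mul_assoc matrix_inv_simps)
  then show ?thesis by (simp add: assms)
qed

lemma invertibleI: "A ** B = mat 1 \<Longrightarrow> invertible A" for A :: "complex^'n^'n"
  using invertible_right_inverse by blast

lemma matrix_mul_cancel:
  fixes A :: "complex^'n^'n"
  assumes "A ** B = mat 1"
  shows "X ** A ** B = X" "X ** B ** A = X"
  using assms matrix_left_right_inverse[of A B] by (metis matrix_mul_assoc matrix_mul_rid)+


subsection \<open>Derivatives\<close>

lemma hmdI:
  "(\<And>i j. ((\<lambda>t. Y t $ i $ j) has_field_derivative D $ i $ j) (at t)) \<Longrightarrow> has_matrix_derivative Y D t"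
  by (simp add: has_matrix_derivative_def)

lemma hmdD:
  "has_matrix_derivative Y D t \<Longrightarrow> ((\<lambda>t. Y t $ i $ j) has_field_derivative D $ i $ j) (at t)"
  by (simp add: has_matrix_derivative_def)

lemma hmd_mul:
  assumes "has_matrix_derivative A A' t" "has_matrix_derivative B B' t"
  shows "has_matrix_derivative (\<lambda>t. A t ** B t) (A' ** B t + A t ** B') t"
proof (rule hmdI)
  fix i j
  have "((\<lambda>t. \<Sum>k\<in>UNIV. A t $ i $ k * B t $ k $ j) has_field_derivative
      (\<Sum>k\<in>UNIV. A' $ i $ k * B t $ k $ j + B' $ k $ j * A t $ i $ k)) (at t)"
    by (intro DERIV_sum DERIV_mult hmdD assms)
  then show "((\<lambda>t. (A t ** B t) $ i $ j) has_field_derivative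
      (A' ** B t + A t ** B') $ i $ j) (at t)"
    by (simp add: matrix_matrix_mult_def sum.distrib mult.commute)
qed

lemma hmd_const: "has_matrix_derivative (\<lambda>t. A) 0 t"
  by (simp add: has_matrix_derivative_def)

lemma hmd_add:
  "has_matrix_derivative A A' t \<Longrightarrow> has_matrix_derivative B B' t \<Longrightarrow>
    has_matrix_derivative (\<lambda>t. A t + B t) (A' + B') t"
  by (rule hmdI) (simp add: DERIV_add hmdD)

lemma hmd_cscale:
  assumes "(c has_field_derivative c') (at t)" "has_matrix_derivative A A' t"
  shows "has_matrix_derivative (\<lambda>t. c t *\<^sub>C A t) (c' *\<^sub>C A t + c t *\<^sub>C A') t"
proof (rule hmdI)
  fix i j
  show "((\<lambda>t. (c t *\<^sub>C A t) $ i $ j) has_field_derivative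
      (c' *\<^sub>C A t + c t *\<^sub>C A') $ i $ j) (at t)"
    using DERIV_mult[OF assms(1) hmdD[OF assms(2), of i j]] by (simp add: mult.commute)
qed

lemma hmd_lmul:
  "has_matrix_derivative B B' t \<Longrightarrow> has_matrix_derivative (\<lambda>t. A ** B t) (A ** B') t"
  using hmd_mul[OF hmd_const, of B B' t A] by simp

lemma hmd_rmul:
  "has_matrix_derivative A A' t \<Longrightarrow> has_matrix_derivative (\<lambda>t. A t ** B) (A' ** B) t"
  using hmd_mul[OF _ hmd_const, of A A' t B] by simp

lemma hmd_chain:
  assumes "has_matrix_derivative A A' (g t)" "(g has_field_derivative g') (at t)"
  shows "has_matrix_derivative (\<lambda>t. A (g t)) (g' *\<^sub>C A') t"
proof (rule hmdI)
  fix i j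
  show "((\<lambda>t. A (g t) $ i $ j) has_field_derivative (g' *\<^sub>C A') $ i $ j) (at t)"
    using DERIV_chain2[OF hmdD[OF assms(1), of i j] assms(2)] by (simp add: mult.commute)
qed

lemma hmd_unique:
  assumes "has_matrix_derivative A D t" "has_matrix_derivative A D' t"
  shows "D = D'"
  unfolding vec_eq_iff using DERIV_unique[OF assms[THEN hmdD]] by simp

lemma hmd_transform:
  assumes "has_matrix_derivative A D t" "open S" "t \<in> S" "\<And>x. x \<in> S \<Longrightarrow> A x = B x"
  shows "has_matrix_derivative B D t"
  by (rule hmdI, rule has_field_derivative_transform_within_open[OF hmdD[OF assms(1)] assms(2,3)])
    (simp add: assms(4))

lemma hmd_transpose:
  "has_matrix_derivative A D t \<Longrightarrow> has_matrix_derivative (\<lambda>t. transpose (A t)) (transpose D) t"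
  by (rule hmdI) (simp add: hmdD transpose_def)

lemma hmd_has_derivative:
  assumes "has_matrix_derivative Y D t"
  shows "(Y has_derivative (\<lambda>h. h *\<^sub>C D)) (at t)"
proof -
  have "((\<lambda>y. inverse (norm (y - t)) *\<^sub>R (Y y - (Y t + (y - t) *\<^sub>C D))) \<longlongrightarrow> 0) (at t)"
    unfolding tendsto_matrix_iff
  proof (intro allI)
    fix i j
    have "((\<lambda>y. Y y $ i $ j) has_derivative (*) (D $ i $ j)) (at t)"
      using assms unfolding has_matrix_derivative_def has_field_derivative_def by blast
    then show "((\<lambda>y. (inverse (norm (y - t)) *\<^sub>R (Y y - (Y t + (y - t) *\<^sub>C D))) $ i $ j)
        \<longlongrightarrow> (0::complex^'a^'a) $ i $ j) (at t)"
      by (simp add: has_derivative_at_within mult.commute diff_diff_eq[symmetric])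
  qed
  moreover have "bounded_linear (\<lambda>h. h *\<^sub>C D)"
    by (rule bounded_linear_intro[where K = "norm D"])
      (simp_all add: cscale_simps scaleR_eq_cscale norm_cscale scaleR_conv_of_real)
  ultimately show ?thesis
    by (simp add: has_derivative_at_within diff_diff_eq[symmetric])
qed

lemma hmd_along_line:
  assumes "has_matrix_derivative Y D (a + of_real s * v)"
  shows "((\<lambda>s. Y (a + of_real s * v)) has_vector_derivative v *\<^sub>C D) (at s within S)"
proof -
  have "((\<lambda>s. a + of_real s * v) has_derivative (\<lambda>h. of_real h * v)) (at s within S)"
    by (auto intro!: derivative_eq_intros)
  from has_derivative_compose[OF this hmd_has_derivative[OF assms]] show ?thesis
    by (simp add: has_vector_derivative_def scaleR_eq_cscale cscale_simps)
qed

lemma hmd_zero_const: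
  assumes "convex S" "open S" "\<And>x. x \<in> S \<Longrightarrow> has_matrix_derivative A 0 x" "x \<in> S" "y \<in> S"
  shows "A x = A y"
proof -
  have "A x $ i $ j = A y $ i $ j" for i j
  proof -
    have "\<exists>c. \<forall>x\<in>S. A x $ i $ j = c"
      using assms(1,3) unfolding has_matrix_derivative_def
      by (intro has_field_derivative_zero_constant) (auto intro: has_field_derivative_at_within)
    then show ?thesis using assms(4,5) by metis
  qed
  then show ?thesis by (simp add: vec_eq_iff)
qed

lemma hmd_imp_holomorphic:
  assumes "open S" "\<And>x. x \<in> S \<Longrightarrow> has_matrix_derivative A (D x) x"
  shows "matrix_holomorphic_on A S"
  unfolding matrix_holomorphic_on_def
proof (intro allI)
  fix i j
  have "\<exists>f'. ((\<lambda>t. A t $ i $ j) has_field_derivative f') (at x)" if "x \<in> S" for x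
    using assms(2)[OF that] by (intro exI[of _ "D x $ i $ j"]) (simp add: has_matrix_derivative_def)
  then show "(\<lambda>t. A t $ i $ j) holomorphic_on S"
    unfolding holomorphic_on_open[OF assms(1)] by simp
qed

definition mderiv :: "(complex \<Rightarrow> complex^'n^'n) \<Rightarrow> complex \<Rightarrow> complex^'n^'n"
  where "mderiv A x = (\<chi> i j. deriv (\<lambda>y. A y $ i $ j) x)"

lemma hmd_mderiv:
  "matrix_holomorphic_on A S \<Longrightarrow> open S \<Longrightarrow> x \<in> S \<Longrightarrow> has_matrix_derivative A (mderiv A x) x"
  unfolding matrix_holomorphic_on_def has_matrix_derivative_def mderiv_def
  by (intro allI, simp, rule holomorphic_derivI[where S = S]) simp_all

lemma matrix_holomorphic_mderiv:
  "matrix_holomorphic_on A S \<Longrightarrow> open S \<Longrightarrow> matrix_holomorphic_on (mderiv A) S"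
  by (simp add: matrix_holomorphic_on_def mderiv_def holomorphic_deriv)

lemma matrix_holomorphic_intros:
  "matrix_holomorphic_on (\<lambda>x. C) S"
  "c holomorphic_on S \<Longrightarrow> matrix_holomorphic_on A S \<Longrightarrow> matrix_holomorphic_on (\<lambda>x. c x *\<^sub>C A x) S"
  "matrix_holomorphic_on A S \<Longrightarrow> matrix_holomorphic_on B S \<Longrightarrow> matrix_holomorphic_on (\<lambda>x. A x + B x) S"
  "matrix_holomorphic_on A S \<Longrightarrow> matrix_holomorphic_on B S \<Longrightarrow> matrix_holomorphic_on (\<lambda>x. A x - B x) S"
  "matrix_holomorphic_on A S \<Longrightarrow> matrix_holomorphic_on (\<lambda>x. - A x) S"
  "matrix_holomorphic_on A S \<Longrightarrow> matrix_holomorphic_on B S \<Longrightarrow> matrix_holomorphic_on (\<lambda>x. A x ** B x) S"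
  by (simp_all add: matrix_holomorphic_on_def matrix_matrix_mult_def holomorphic_on_add
      holomorphic_on_diff holomorphic_on_mult holomorphic_on_minus holomorphic_on_sum)

lemma matrix_holomorphic_continuous:
  assumes "matrix_holomorphic_on A S"
  shows "continuous_on S A"
  unfolding continuous_on_def tendsto_matrix_iff
proof (intro ballI allI)
  fix x i j assume "x \<in> S"
  have "continuous_on S (\<lambda>t. A t $ i $ j)"
    using assms by (simp add: matrix_holomorphic_on_def holomorphic_on_imp_continuous_on)
  then show "((\<lambda>x. A x $ i $ j) \<longlongrightarrow> A x $ i $ j) (at x within S)"
    using \<open>x \<in> S\<close> by (simp add: continuous_on_def)
qed

section \<open>The matrix exponential\<close>

definition mpow :: "complex^'n^'n \<Rightarrow> nat \<Rightarrow> complex^'n^'n"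
  where "mpow A m = ((**) A ^^ m) (mat 1)"

lemma mpow_simps [simp]: "mpow A 0 = mat 1" "mpow A (Suc m) = A ** mpow A m"
  by (simp_all add: mpow_def)

text \<open>The differential of \<^term>\<open>\<lambda>K. mpow K m\<close> at \<open>K\<close> in the direction \<open>L\<close>.\<close>

primrec dpow :: "complex^'n^'n \<Rightarrow> complex^'n^'n \<Rightarrow> nat \<Rightarrow> complex^'n^'n" where
  "dpow K L 0 = 0"
| "dpow K L (Suc m) = L ** mpow K m + K ** dpow K L m"

definition dexp :: "complex^'n^'n \<Rightarrow> complex^'n^'n \<Rightarrow> complex^'n^'n"
  where "dexp K L = (\<Sum>m. inverse (fact m) *\<^sub>R dpow K L m)"

text \<open>In the Frobenius norm \<open>mat 1\<close> has norm sqrt n instead of 1. Keeping a left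
  factor \<open>A\<close> absorbs this, so the bounds on powers and on \<open>mexp\<close> carry no
  dimensional constant.\<close>

lemma norm_mul_mpow_le: "norm (A ** mpow K m) \<le> norm A * norm K ^ m"
proof (induction m arbitrary: A)
  case (Suc m)
  have "norm (A ** mpow K (Suc m)) \<le> norm (A ** K) * norm K ^ m"
    using Suc[of "A ** K"] by (simp add: matrix_mul_assoc)
  also have "\<dots> \<le> (norm A * norm K) * norm K ^ m"
    by (intro mult_right_mono norm_matrix_mul_le) simp
  finally show ?case by (simp add: mult_ac)
qed simp

lemma norm_dpow_Suc_le: "norm (dpow K L (Suc m)) \<le> Suc m * norm L * norm K ^ m"
proof (induction m)
  case (Suc m)
  have "norm (dpow K L (Suc (Suc m))) \<le> norm (L ** mpow K (Suc m)) + norm (K ** dpow K L (Suc m))"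
    using norm_triangle_ineq by (simp only: dpow.simps)
  also have "\<dots> \<le> norm L * norm K ^ Suc m + norm K * (Suc m * norm L * norm K ^ m)"
    by (intro add_mono norm_mul_mpow_le order_trans[OF norm_matrix_mul_le] mult_left_mono Suc) simp
  also have "\<dots> = Suc (Suc m) * norm L * norm K ^ Suc m"
    by (simp add: algebra_simps)
  finally show ?case .
qed simp

lemma hmd_mpow:
  "has_matrix_derivative k k' t \<Longrightarrow> has_matrix_derivative (\<lambda>t. mpow (k t) m) (dpow (k t) k' m) t"
  by (induction m) (auto intro: hmd_const hmd_mul)

lemma dpow_add: "dpow K (L + M) m = dpow K L m + dpow K M m"
  by (induction m) (simp_all add: matrix_ring_simps)

lemma dpow_commutator: "dpow K (Z ** K - K ** Z) m = Z ** mpow K m - mpow K m ** Z"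
proof (induction m)
  case (Suc m)
  show ?case
    unfolding dpow.simps Suc mpow_simps by (simp add: matrix_ring_simps)
qed simp

lemma mexp_summable_norm: "summable (\<lambda>m. norm (inverse (fact m) *\<^sub>R mpow A m))"
proof (rule summable_comparison_test')
  show "summable (\<lambda>m. norm (mat 1 :: complex^'a^'a) * (inverse (fact m) * norm A ^ m))"
    by (intro summable_mult summable_exp)
  show "norm (norm (inverse (fact m) *\<^sub>R mpow A m)) \<le> norm (mat 1 :: complex^'a^'a) * (inverse (fact m) * norm A ^ m)"
    for m
    using mult_left_mono[OF norm_mul_mpow_le[of "mat 1" A m], of "inverse (fact m)"]
    by (simp add: mult_ac)
qed

lemma mexp_sums: "(\<lambda>m. inverse (fact m) *\<^sub>R mpow A m) sums mexp A"
  unfolding mexp_def mpow_def[symmetric]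
  using summable_norm_cancel[OF mexp_summable_norm] by (rule summable_sums)

lemma sums_exp_shift: "(\<lambda>m. x ^ m / fact m) sums exp (x::real)"
  using exp_converges[of x] by (simp add: divide_inverse mult.commute)

text \<open>The factor \<open>Suc m\<close> from the product rule cancels against
  \<open>fact (Suc m)\<close>. The series of \<open>dexp\<close> shifted by one is thus dominated by
  the exponential series, and \<open>dexp K L\<close> costs at most
  \<open>norm L * exp (norm K)\<close>.\<close>

lemma dexp_term_le:
  "norm (inverse (fact (Suc m)) *\<^sub>R dpow K L (Suc m)) \<le> norm L * (norm K ^ m / fact m)"
proof -
  have "norm (inverse (fact (Suc m)) *\<^sub>R dpow K L (Suc m)) \<le>
      inverse (fact (Suc m)) * (Suc m * norm L * norm K ^ m)"
    using norm_dpow_Suc_le[of K L m] by (simp del: dpow.simps fact_Suc add: mult_left_mono)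
  also have "\<dots> = norm L * (norm K ^ m / fact m)"
    by (simp add: divide_simps del: of_nat_Suc)
  finally show ?thesis .
qed

lemma dexp_sums: "(\<lambda>m. inverse (fact m) *\<^sub>R dpow K L m) sums dexp K L"
proof -
  have "summable (\<lambda>m. inverse (fact (Suc m)) *\<^sub>R dpow K L (Suc m))"
    by (rule summable_comparison_test'[OF summable_mult[OF sums_summable[OF sums_exp_shift]] dexp_term_le])
  then show ?thesis
    unfolding dexp_def
    by (intro summable_sums iffD1[OF summable_Suc_iff[of "\<lambda>m. inverse (fact m) *\<^sub>R dpow K L m"]])
qed

lemma dexp_Suc_sums: "(\<lambda>m. inverse (fact (Suc m)) *\<^sub>R dpow K L (Suc m)) sums dexp K L"
  using dexp_sums[of K L] sums_Suc_iff[of "\<lambda>m. inverse (fact m) *\<^sub>R dpow K L m"] by simp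

lemma sums_matrix_mul_left: "f sums S \<Longrightarrow> (\<lambda>m. A ** f m) sums (A ** S)" for A :: "complex^'n^'m"
  by (rule bounded_linear.sums[OF bounded_bilinear.bounded_linear_right[OF bounded_bilinear_matrix_mul]])

lemma sums_matrix_mul_right: "f sums S \<Longrightarrow> (\<lambda>m. f m ** A) sums (S ** A)" for A :: "complex^'n^'m"
  by (rule bounded_linear.sums[OF bounded_bilinear.bounded_linear_left[OF bounded_bilinear_matrix_mul]])

lemma norm_sums_le:
  assumes "f sums (S :: 'a::banach)" "g sums (T::real)" "\<And>m. norm (f m) \<le> g m"
  shows "norm S \<le> T"
  using norm_suminf_le[of f g] assms by (simp add: sums_iff)

lemma norm_mexp_minus_one_le: "norm (mexp A - mat 1) \<le> exp (norm A) - 1"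
proof (rule norm_sums_le)
  show "(\<lambda>m. inverse (fact (Suc m)) *\<^sub>R mpow A (Suc m)) sums (mexp A - mat 1)"
    using mexp_sums[of A] sums_Suc_iff[of "\<lambda>m. inverse (fact m) *\<^sub>R mpow A m" "mexp A - mat 1"] by simp
  show "(\<lambda>m. norm A ^ Suc m / fact (Suc m)) sums (exp (norm A) - 1)"
    using sums_exp_shift[of "norm A"]
      sums_Suc_iff[of "\<lambda>m. norm A ^ m / fact m" "exp (norm A) - 1"] by simp
  show "norm (inverse (fact (Suc m)) *\<^sub>R mpow A (Suc m)) \<le> norm A ^ Suc m / fact (Suc m)" for m
    using mult_left_mono[OF norm_mul_mpow_le[of A A m], of "inverse (fact (Suc m))"]
    by (simp del: fact_Suc add: field_simps)
qed

lemma norm_mul_mexp_le: "norm (B ** mexp A) \<le> norm B * exp (norm A)"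
proof -
  have "norm (B ** mexp A) \<le> norm B + norm (B ** (mexp A - mat 1))"
    using norm_triangle_ineq[of B "B ** (mexp A - mat 1)"] by (simp add: matrix_ring_simps)
  also have "\<dots> \<le> norm B + norm B * (exp (norm A) - 1)"
    by (intro add_left_mono order_trans[OF norm_matrix_mul_le] mult_left_mono norm_mexp_minus_one_le) simp
  finally show ?thesis by (simp add: algebra_simps)
qed

lemma norm_mexp_mul_le: "norm (mexp A ** B) \<le> exp (norm A) * norm B"
proof -
  have "norm (mexp A ** B) \<le> norm B + norm ((mexp A - mat 1) ** B)"
    using norm_triangle_ineq[of B "(mexp A - mat 1) ** B"] by (simp add: matrix_ring_simps)
  also have "\<dots> \<le> norm B + (exp (norm A) - 1) * norm B"
    by (intro add_left_mono order_trans[OF norm_matrix_mul_le] mult_right_mono norm_mexp_minus_one_le) simp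
  finally show ?thesis by (simp add: algebra_simps)
qed

text \<open>Termwise differentiation. On a closed ball \<open>k\<close> and \<open>k'\<close> are
  bounded by compactness, and the differentiated series is dominated by an exponential series. As
  \<open>k x\<close> and \<open>k' x\<close> need not commute, the result is \<open>dexp\<close> and
  not a product.\<close>

lemma hmd_mexp:
  assumes S: "open S" "x \<in> S"
    and k: "\<And>y. y \<in> S \<Longrightarrow> has_matrix_derivative k (k' y) y" and k': "continuous_on S k'"
  shows "has_matrix_derivative (\<lambda>y. mexp (k y)) (dexp (k x) (k' x)) x"
proof (rule hmdI)
  fix i j
  obtain e where e: "e > 0" "cball x e \<subseteq> S" using S open_contains_cball by blast
  have ck: "continuous_on (cball x e) k"
    using e matrix_holomorphic_continuous[OF hmd_imp_holomorphic[OF S(1) k]] continuous_on_subset by blast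
  have ck': "continuous_on (cball x e) k'"
    using e k' continuous_on_subset by blast
  obtain R where R: "\<And>y. y \<in> cball x e \<Longrightarrow> norm (k y) \<le> R"
    using compact_imp_bounded[OF compact_continuous_image[OF ck compact_cball]]
    unfolding bounded_iff by blast
  obtain R' where R': "\<And>y. y \<in> cball x e \<Longrightarrow> norm (k' y) \<le> R'"
    using compact_imp_bounded[OF compact_continuous_image[OF ck' compact_cball]]
    unfolding bounded_iff by blast
  have R0: "0 \<le> R" "0 \<le> R'"
    using R[of x] R'[of x] e by (auto intro: order_trans[OF norm_ge_zero])
  let ?f = "\<lambda>m y. (inverse (fact m) *\<^sub>R mpow (k y) m) $ i $ j"
  let ?f' = "\<lambda>m y. (inverse (fact m) *\<^sub>R dpow (k y) (k' y) m) $ i $ j"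
  \<comment> \<open>The term of index 0 is constant in \<open>y\<close>, so its derivative gets the
    bound 0; the estimate by \<open>dexp_term_le\<close> starts at index 1.\<close>
  let ?M = "\<lambda>m. case m of 0 \<Rightarrow> 0 | Suc m \<Rightarrow> R' * (R ^ m / fact m)"
  have sums_entry: "(\<lambda>m. F m $ i $ j) sums (T $ i $ j)" if "F sums T" for F and T :: "complex^'a^'a"
    using that unfolding sums_def tendsto_matrix_iff by simp
  have der: "(?f m has_field_derivative ?f' m y) (at y within cball x e)" if "y \<in> cball x e" for m y
  proof -
    have "y \<in> S" using that e by blast
    from DERIV_cmult[OF hmdD[OF hmd_mpow[OF k[OF this], of m]], of "of_real (inverse (fact m))" i j]
    show ?thesis by (auto simp: scaleR_eq_cscale intro: has_field_derivative_at_within)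
  qed
  have bd: "norm (?f' m y) \<le> ?M m" if y: "y \<in> cball x e" for m y
  proof (cases m)
    case (Suc n)
    have "norm (?f' m y) \<le> norm (inverse (fact m) *\<^sub>R dpow (k y) (k' y) m)"
      by (rule norm_entry_le)
    also have "\<dots> \<le> norm (k' y) * (norm (k y) ^ n / fact n)"
      unfolding Suc by (rule dexp_term_le)
    also have "\<dots> \<le> R' * (R ^ n / fact n)"
      using R[OF y] R'[OF y] R0 by (intro mult_mono divide_right_mono power_mono) auto
    finally show ?thesis by (simp add: Suc)
  qed simp
  have "summable (\<lambda>m. R' * (R ^ m / fact m))"
    by (rule summable_mult[OF sums_summable[OF sums_exp_shift]])
  then have sM: "summable ?M"
    by (subst summable_Suc_iff[symmetric]) simp
  have ul: "uniform_limit (cball x e) (\<lambda>n y. \<Sum>m<n. ?f' m y) (\<lambda>y. \<Sum>m. ?f' m y) sequentially"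
    by (rule Weierstrass_m_test[OF bd sM])
  have "\<exists>g. \<forall>y\<in>cball x e. (\<lambda>m. ?f m y) sums g y \<and>
      (g has_field_derivative (\<Sum>m. ?f' m y)) (at y within cball x e)"
  proof (rule has_field_derivative_series[OF convex_cball der ul])
    show "x \<in> cball x e" using e by simp
    show "summable (\<lambda>m. ?f m x)" using sums_entry[OF mexp_sums] by (rule sums_summable)
  qed auto
  then obtain g where g: "\<And>y. y \<in> cball x e \<Longrightarrow> (\<lambda>m. ?f m y) sums g y"
      "\<And>y. y \<in> cball x e \<Longrightarrow> (g has_field_derivative (\<Sum>m. ?f' m y)) (at y within cball x e)"
    by blast
  have gE: "g y = mexp (k y) $ i $ j" if "y \<in> cball x e" for y
    by (rule sums_unique2[OF g(1)[OF that] sums_entry[OF mexp_sums]])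
  have "(\<Sum>m. ?f' m x) = dexp (k x) (k' x) $ i $ j"
    by (rule sums_unique[OF sums_entry[OF dexp_sums], symmetric])
  then have "(g has_field_derivative dexp (k x) (k' x) $ i $ j) (at x)"
    using g(2)[of x] at_within_interior[of x "cball x e"] e by (simp only: interior_cball centre_in_ball centre_in_cball)
  then show "((\<lambda>y. mexp (k y) $ i $ j) has_field_derivative dexp (k x) (k' x) $ i $ j) (at x)"
    by (rule has_field_derivative_transform_within_open[of _ _ _ "ball x e"]) (use e gE in auto)
qed

lemma matrix_holomorphic_mexp:
  assumes "open S" "matrix_holomorphic_on k S"
  shows "matrix_holomorphic_on (\<lambda>x. mexp (k x)) S"
proof (rule hmd_imp_holomorphic[OF assms(1)])
  fix x assume "x \<in> S"
  then show "has_matrix_derivative (\<lambda>x. mexp (k x)) (dexp (k x) (mderiv k x)) x"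
    using hmd_mexp[OF assms(1) _ hmd_mderiv[OF assms(2,1)]
        matrix_holomorphic_continuous[OF matrix_holomorphic_mderiv[OF assms(2,1)]]] by simp
qed

text \<open>For non-commuting \<open>K\<close> and \<open>L\<close> the derivative of \<open>mexp K\<close> differs from \<open>L ** mexp K\<close> only by a
  term that is quadratic in \<open>(K, L)\<close>, and the same is true with the derivation \<open>d/dx + ad Z\<close> in place
  of \<open>d/dx\<close>.\<close>

lemma dexp_estimate:
  fixes K L Z B :: "complex^'n^'n"
  defines "e \<equiv> L + Z ** K - K ** Z + B"
  shows "norm (dexp K L + Z ** mexp K - mexp K ** Z + B ** mexp K) \<le>
    norm e * exp (norm K) + 2 * norm B * (exp (norm K) - 1)"
proof -
  let ?c = "\<lambda>m. inverse (fact m) :: real"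
  let ?C = "Z ** K - K ** Z"
  \<comment> \<open>Since \<open>ad Z\<close> is a derivation, the differential of a power in the
    direction \<open>[Z, K]\<close> is the commutator of \<open>Z\<close> with that power; summation
    extends this to \<open>mexp\<close>.\<close>
  have C: "dexp K ?C = Z ** mexp K - mexp K ** Z"
  proof (rule sums_unique2[OF dexp_sums])
    have "(\<lambda>m. Z ** (?c m *\<^sub>R mpow K m) - (?c m *\<^sub>R mpow K m) ** Z) sums (Z ** mexp K - mexp K ** Z)"
      by (intro sums_diff sums_matrix_mul_left sums_matrix_mul_right mexp_sums)
    then show "(\<lambda>m. ?c m *\<^sub>R dpow K ?C m) sums (Z ** mexp K - mexp K ** Z)"
      by (simp add: dpow_commutator scaleR_eq_cscale matrix_ring_simps cscale_simps)
  qed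
  have add: "dexp K (L1 + L2) = dexp K L1 + dexp K L2" for L1 L2
    using sums_add[OF dexp_sums[of K L1] dexp_sums[of K L2]]
    by (intro sums_unique2[OF dexp_sums]) (simp add: dpow_add scaleR_add_right)
  \<comment> \<open>With the series of \<open>dexp\<close> shifted by one, the leading terms
    \<open>- B\<close> and \<open>B\<close> cancel. What remains starts at first order in
    \<open>K\<close>, which produces \<open>exp (norm K) - 1\<close>.\<close>
  have "norm (dexp K (- B) + B ** mexp K) \<le> 2 * norm B * (exp (norm K) - 1)"
  proof (rule norm_sums_le)
    let ?f = "\<lambda>m. ?c (Suc m) *\<^sub>R dpow K (- B) (Suc m) + B ** (?c m *\<^sub>R mpow K m)"
    let ?g = "\<lambda>m. 2 * norm B * (norm K ^ m / fact m)"
    have s: "?f sums (dexp K (- B) + B ** mexp K)"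
      by (intro sums_add dexp_Suc_sums sums_matrix_mul_left mexp_sums)
    have f0: "?f 0 = 0" by (simp add: matrix_ring_simps)
    show "(\<lambda>m. ?f (Suc m)) sums (dexp K (- B) + B ** mexp K)"
      by (rule iffD2[OF sums_Suc_iff]) (use s f0 in simp)
    show "(\<lambda>m. ?g (Suc m)) sums (2 * norm B * (exp (norm K) - 1))"
      by (rule iffD2[OF sums_Suc_iff]) (use sums_mult[OF sums_exp_shift[of "norm K"], of "2 * norm B"] in \<open>simp add: algebra_simps\<close>)
    show "norm (?f (Suc m)) \<le> ?g (Suc m)" for m
    proof -
      have "norm (?f (Suc m)) \<le> norm B * (norm K ^ Suc m / fact (Suc m)) +
          norm (B ** (?c (Suc m) *\<^sub>R mpow K (Suc m)))"
        using dexp_term_le[of "Suc m" K "- B"]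
        by (intro order_trans[OF norm_triangle_ineq] add_right_mono) (simp del: dpow.simps fact_Suc)
      also have "norm (B ** (?c (Suc m) *\<^sub>R mpow K (Suc m))) \<le> norm B * (norm K ^ Suc m / fact (Suc m))"
        using mult_left_mono[OF norm_mul_mpow_le[of B K "Suc m"], of "?c (Suc m)"]
        by (simp del: mpow_simps fact_Suc
            add: bounded_bilinear.scaleR_right[OF bounded_bilinear_matrix_mul] field_simps)
      finally show ?thesis by (simp only: mult_2 distrib_right)
    qed
  qed
  moreover have "norm (dexp K e) \<le> norm e * exp (norm K)"
    by (rule norm_sums_le[OF dexp_Suc_sums sums_mult[OF sums_exp_shift] dexp_term_le])
  \<comment> \<open>By the definition of \<open>e\<close>,
    \<open>L = e - (Z ** K - K ** Z) - B\<close>, and \<open>dexp K\<close> is additive.\<close>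
  moreover have "dexp K L + Z ** mexp K - mexp K ** Z + B ** mexp K =
      dexp K e + (dexp K (- B) + B ** mexp K)"
  proof -
    have "dexp K L + dexp K ?C = dexp K e + dexp K (- B)"
      unfolding add[symmetric] e_def by (simp add: algebra_simps)
    then show ?thesis unfolding C by (simp add: algebra_simps)
  qed
  ultimately show ?thesis
    by (simp only: norm_triangle_le add_mono)
qed

section \<open>Exponentials of the multiples of one matrix\<close>

lemma mexp_zero [simp]: "mexp (0 :: complex^'n^'n) = mat 1"
  using norm_mexp_minus_one_le[of "0 :: complex^'n^'n"] by simp

lemma mpow_commute: "A ** mpow A m = mpow A m ** A"
  by (induction m) (simp_all add: matrix_mul_assoc)

lemma mexp_commute: "A ** mexp A = mexp A ** A"
  using sums_matrix_mul_left[OF mexp_sums, of A A] sums_matrix_mul_right[OF mexp_sums, of A A]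
  by (simp add: scaleR_eq_cscale matrix_ring_simps mpow_commute) (rule sums_unique2)

text \<open>\<open>A\<close> commutes with \<open>s *\<^sub>C A\<close>, so the Leibniz sum in
  \<open>dpow\<close> collapses to \<open>Suc m\<close> equal terms.\<close>

lemma dpow_scaled: "dpow (s *\<^sub>C A) A (Suc m) = of_nat (Suc m) *\<^sub>C (A ** mpow (s *\<^sub>C A) m)"
proof (induction m)
  case (Suc m)
  show ?case
    unfolding dpow.simps(2)[of _ _ "Suc m"] Suc
    by (simp add: matrix_ring_simps del: of_nat_Suc) (simp add: vec_eq_iff algebra_simps)
qed (simp add: cscale_simps)

lemma dexp_scaled: "dexp (s *\<^sub>C A) A = A ** mexp (s *\<^sub>C A)"
proof -
  have "inverse (fact (Suc m)) *\<^sub>R dpow (s *\<^sub>C A) A (Suc m) =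
      A ** (inverse (fact m) *\<^sub>R mpow (s *\<^sub>C A) m)" for m
    unfolding dpow_scaled
    by (simp add: scaleR_eq_cscale matrix_ring_simps cscale_simps field_simps del: of_nat_Suc)
  then show ?thesis
    by (intro sums_unique2[OF dexp_Suc_sums]) (simp only: sums_matrix_mul_left[OF mexp_sums])
qed

lemma hmd_mexp_scaled: "has_matrix_derivative (\<lambda>s. mexp (s *\<^sub>C A)) (A ** mexp (s *\<^sub>C A)) s"
proof -
  have "has_matrix_derivative (\<lambda>s. s *\<^sub>C A) A y" for y
    using hmd_cscale[OF DERIV_ident hmd_const, of A y] by (simp add: cscale_simps)
  from hmd_mexp[OF open_UNIV UNIV_I this continuous_on_const] show ?thesis
    by (simp add: dexp_scaled)
qed

lemma mexp_mul_minus: "mexp A ** mexp (- A) = mat 1"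
proof -
  \<comment> \<open>The commutation of \<open>A\<close> with \<open>mexp (s *\<^sub>C A)\<close> is
    obtained from \<open>mexp_commute\<close> by cancelling \<open>s\<close>, so
    \<open>s = 0\<close> is a case of its own.\<close>
  have "has_matrix_derivative (\<lambda>s. mexp (s *\<^sub>C A) ** mexp (s *\<^sub>C (- A))) 0 s" for s
    using hmd_mul[OF hmd_mexp_scaled[of A s] hmd_mexp_scaled[of "- A" s]]
      mexp_commute[of "s *\<^sub>C A"]
    by (cases "s = 0") (simp_all add: matrix_ring_simps cmat.scale_cancel_left)
  then have "mexp (1 *\<^sub>C A) ** mexp (1 *\<^sub>C (- A)) = mexp (0 *\<^sub>C A) ** mexp (0 *\<^sub>C (- A))"
    by (intro hmd_zero_const[of UNIV "\<lambda>s. mexp (s *\<^sub>C A) ** mexp (s *\<^sub>C (- A))"]) auto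
  then show ?thesis by (simp add: cscale_simps)
qed

section \<open>Algebraic groups and their Lie algebras\<close>

lemma matrix_polynomial_cmult: "matrix_polynomial p \<Longrightarrow> matrix_polynomial (\<lambda>A. c * p A)"
  by (rule matrix_polynomial.mult[OF matrix_polynomial.const])

lemma matrix_polynomial_sum:
  "finite I \<Longrightarrow> (\<And>i. i \<in> I \<Longrightarrow> matrix_polynomial (f i)) \<Longrightarrow> matrix_polynomial (\<lambda>A. \<Sum>i\<in>I. f i A)"
  by (induction I rule: finite_induct) (auto intro: matrix_polynomial.intros)

lemma matrix_polynomial_entry_mul: "matrix_polynomial (\<lambda>A. (A ** X) $ i $ j)"
  unfolding matrix_matrix_mult_def
  by (simp, intro matrix_polynomial_sum) (auto intro: matrix_polynomial.intros)

lemma matrix_polynomial_compose_mul: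
  fixes B C :: "complex^'n^'n"
  shows "matrix_polynomial p \<Longrightarrow> matrix_polynomial (\<lambda>A. p (B ** A ** C))"
proof (induction rule: matrix_polynomial.induct)
  case (entry i j)
  show ?case
    unfolding matrix_mul_assoc[symmetric]
    unfolding matrix_matrix_mult_def[of B]
    by (simp, intro matrix_polynomial_sum matrix_polynomial_cmult matrix_polynomial_entry_mul) simp
qed (auto intro: matrix_polynomial.intros)

definition pdiff :: "(complex^'n^'n \<Rightarrow> complex) \<Rightarrow> complex^'n^'n \<Rightarrow> complex^'n^'n \<Rightarrow> complex"
  where "pdiff p A = frechet_derivative p (at A)"

lemma bounded_linear_entry: "bounded_linear (\<lambda>A :: complex^'n^'m. A $ i $ j)"
  by (rule bounded_linear_compose[OF bounded_linear_vec_nth bounded_linear_vec_nth])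

text \<open>\<open>has_derivative\<close> yields only a real-linear differential, so complex
  homogeneity is carried through the induction. The last clause says that differentiating along the
  left-invariant vector field \<open>A ** X\<close> gives a polynomial again; this allows repeated
  differentiation in \<open>mexp_in_group\<close>.\<close>

lemma matrix_polynomial_pdiff_ex:
  assumes "matrix_polynomial p"
  shows "\<exists>d. (\<forall>A. (p has_derivative d A) (at A)) \<and> (\<forall>A c X. d A (c *\<^sub>C X) = c * d A X) \<and>
    (\<forall>X. matrix_polynomial (\<lambda>A. d A (A ** X)))"
  using assms
proof (induction rule: matrix_polynomial.induct)
  case (const c)
  show ?case by (rule exI[of _ "\<lambda>A X. 0"]) (auto intro: matrix_polynomial.intros)
next
  case (entry i j)
  show ?case
    by (rule exI[of _ "\<lambda>A X. X $ i $ j"])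
      (auto intro: matrix_polynomial_entry_mul bounded_linear_imp_has_derivative bounded_linear_entry)
next
  case (add p q)
  then obtain d e where "\<forall>A. (p has_derivative d A) (at A)" "\<forall>A c X. d A (c *\<^sub>C X) = c * d A X"
    "\<forall>X. matrix_polynomial (\<lambda>A. d A (A ** X))"
    "\<forall>A. (q has_derivative e A) (at A)" "\<forall>A c X. e A (c *\<^sub>C X) = c * e A X"
    "\<forall>X. matrix_polynomial (\<lambda>A. e A (A ** X))" by blast
  then show ?case
    by (intro exI[of _ "\<lambda>A X. d A X + e A X"])
      (auto intro!: derivative_intros matrix_polynomial.intros simp: algebra_simps)
next
  case (mult p q)
  then obtain d e where *: "\<forall>A. (p has_derivative d A) (at A)" "\<forall>A c X. d A (c *\<^sub>C X) = c * d A X"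
    "\<forall>X. matrix_polynomial (\<lambda>A. d A (A ** X))"
    "\<forall>A. (q has_derivative e A) (at A)" "\<forall>A c X. e A (c *\<^sub>C X) = c * e A X"
    "\<forall>X. matrix_polynomial (\<lambda>A. e A (A ** X))" by blast
  show ?case
  proof (intro exI[of _ "\<lambda>A X. p A * e A X + d A X * q A"] conjI allI)
    show "((\<lambda>A. p A * q A) has_derivative (\<lambda>X. p A * e A X + d A X * q A)) (at A)" for A
      using * by (intro has_derivative_mult) auto
    show "matrix_polynomial (\<lambda>A. p A * e A (A ** X) + d A (A ** X) * q A)" for X
      using * by (intro matrix_polynomial.intros mult.hyps) auto
  qed (use * in \<open>simp add: algebra_simps\<close>)
qed

lemma hmd_line: "has_matrix_derivative (\<lambda>s. A + s *\<^sub>C X) X t"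
  using hmd_add[OF hmd_const hmd_cscale[OF DERIV_ident hmd_const]] by (simp add: cscale_simps)

context
  fixes p :: "complex^'n^'n \<Rightarrow> complex"
  assumes p: "matrix_polynomial p"
begin

lemma has_derivative_pdiff: "(p has_derivative pdiff p A) (at A)"
proof -
  have "p differentiable (at A)"
    using matrix_polynomial_pdiff_ex[OF p] unfolding differentiable_def by metis
  then show ?thesis
    unfolding pdiff_def using frechet_derivative_works by metis
qed

lemma pdiff_props:
  shows "pdiff p A (c *\<^sub>C X) = c * pdiff p A X" and "matrix_polynomial (\<lambda>A. pdiff p A (A ** Y))"
proof -
  obtain d where d: "\<And>A. (p has_derivative d A) (at A)" "\<And>A c X. d A (c *\<^sub>C X) = c * d A X"
    "\<And>X. matrix_polynomial (\<lambda>A. d A (A ** X))"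
    using matrix_polynomial_pdiff_ex[OF p] by blast
  have "pdiff p = d"
    using has_derivative_unique[OF has_derivative_pdiff d(1)] by blast
  with d show "pdiff p A (c *\<^sub>C X) = c * pdiff p A X" "matrix_polynomial (\<lambda>A. pdiff p A (A ** Y))"
    by auto
qed

lemma linear_pdiff: "linear (pdiff p A)"
  using has_derivative_pdiff has_derivative_linear by blast

lemma bounded_linear_pdiff: "bounded_linear (pdiff p A)"
  using has_derivative_pdiff has_derivative_bounded_linear by blast

lemma pdiff_chain:
  assumes "has_matrix_derivative \<gamma> \<gamma>' t"
  shows "((\<lambda>s. p (\<gamma> s)) has_field_derivative pdiff p (\<gamma> t) \<gamma>') (at t)"
  using has_derivative_compose[OF hmd_has_derivative[OF assms] has_derivative_pdiff]
  by (simp add: has_field_derivative_def pdiff_props(1) mult.commute[of _ "pdiff p (\<gamma> t) \<gamma>'"])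

lemma pdiff_line: "((\<lambda>s. p (A + s *\<^sub>C X)) has_field_derivative pdiff p A X) (at 0)"
  using pdiff_chain[OF hmd_line[of A X 0]] by (simp add: cscale_simps)

end

lemma pdiff_compose_mul:
  fixes A B C :: "complex^'n^'n"
  assumes "matrix_polynomial p"
  shows "pdiff (\<lambda>A. p (B ** A ** C)) A X = pdiff p (B ** A ** C) (B ** X ** C)"
proof -
  have "has_matrix_derivative (\<lambda>s. B ** (A + s *\<^sub>C X) ** C) (B ** X ** C) 0"
    by (intro hmd_rmul hmd_lmul hmd_line)
  from pdiff_chain[OF assms this]
  have "((\<lambda>s. p (B ** (A + s *\<^sub>C X) ** C)) has_field_derivative
      pdiff p (B ** A ** C) (B ** X ** C)) (at 0)"
    by (simp add: cscale_simps)
  then show ?thesis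
    by (rule DERIV_unique[OF pdiff_line[OF matrix_polynomial_compose_mul[OF assms]]])
qed

section \<open>Vanishing ideal, group membership and the tangent space at the identity\<close>

definition vanishing :: "(complex^'n^'n) set \<Rightarrow> (complex^'n^'n \<Rightarrow> complex) \<Rightarrow> bool"
  where "vanishing G p \<longleftrightarrow> matrix_polynomial p \<and> (\<forall>A\<in>G. p A = 0)"

lemma lie_algebra_iff: "X \<in> lie_algebra G \<longleftrightarrow> (\<forall>p. vanishing G p \<longrightarrow> pdiff p (mat 1) X = 0)"
proof -
  have "((\<lambda>s. p (mat 1 + s *\<^sub>C X)) has_field_derivative 0) (at 0) \<longleftrightarrow> pdiff p (mat 1) X = 0"
    if "matrix_polynomial p" for p
    using pdiff_line[OF that, of "mat 1" X] DERIV_unique by metis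
  then show ?thesis unfolding lie_algebra_def vanishing_def by blast
qed

lemma lie_algebra_zero: "0 \<in> lie_algebra G"
  by (simp add: lie_algebra_iff vanishing_def linear_0[OF linear_pdiff])

lemma lie_algebra_add: "X \<in> lie_algebra G \<Longrightarrow> Y \<in> lie_algebra G \<Longrightarrow> X + Y \<in> lie_algebra G"
  by (simp add: lie_algebra_iff vanishing_def linear_add[OF linear_pdiff])

lemma lie_algebra_cscale: "X \<in> lie_algebra G \<Longrightarrow> c *\<^sub>C X \<in> lie_algebra G"
  by (simp add: lie_algebra_iff vanishing_def pdiff_props)

lemma lie_algebra_minus: "X \<in> lie_algebra G \<Longrightarrow> - X \<in> lie_algebra G"
  using lie_algebra_cscale[of X G "-1"] by (simp add: cscale_simps)

lemma lie_algebra_diff: "X \<in> lie_algebra G \<Longrightarrow> Y \<in> lie_algebra G \<Longrightarrow> X - Y \<in> lie_algebra G"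
  using lie_algebra_add[of X G "- Y"] by (simp add: lie_algebra_minus)

lemma cmat_subspace_lie_algebra: "cmat.subspace (lie_algebra G)"
  by (simp add: cmat.subspace_def lie_algebra_zero lie_algebra_add lie_algebra_cscale)

context
  fixes G :: "(complex^'n^'n) set"
  assumes G: "algebraic_group G"
begin

lemma group_mem:
  "mat 1 \<in> G" "A \<in> G \<Longrightarrow> B \<in> G \<Longrightarrow> A ** B \<in> G" "A \<in> G \<Longrightarrow> invertible A"
  "A \<in> G \<Longrightarrow> A ** U = mat 1 \<Longrightarrow> U \<in> G"
  using G matrix_inverse_unique[of A U] unfolding algebraic_group_def by auto

text \<open>Replaces the unspecified set of equations in \<open>algebraic_group\<close> by the full
  vanishing ideal, so that membership can be checked one polynomial at a time in limits and under
  analytic continuation.\<close>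

lemma group_iff: "A \<in> G \<longleftrightarrow> invertible A \<and> (\<forall>p. vanishing G p \<longrightarrow> p A = 0)"
  using G unfolding algebraic_group_def vanishing_def by auto

lemma vanishing_translate:
  "vanishing G p \<Longrightarrow> A \<in> G \<Longrightarrow> B \<in> G \<Longrightarrow> vanishing G (\<lambda>X. p (A ** X ** B))"
  unfolding vanishing_def by (auto intro: matrix_polynomial_compose_mul group_mem)

text \<open>Left translation by \<open>A\<close> preserves the vanishing ideal, and the chain rule
  moves the differential at 1 to the differential at \<open>A\<close>.\<close>

lemma vanishing_pdiff:
  assumes "vanishing G p" "A \<in> G" "X \<in> lie_algebra G"
  shows "pdiff p A (A ** X) = 0"
proof -
  have "pdiff (\<lambda>X. p (A ** X ** mat 1)) (mat 1) X = 0"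
    using assms vanishing_translate[OF assms(1,2) group_mem(1)] lie_algebra_iff by blast
  moreover have "matrix_polynomial p" using assms(1) by (simp add: vanishing_def)
  ultimately show ?thesis
    using pdiff_compose_mul[of p A "mat 1" "mat 1" X] by simp
qed

text \<open>Multiplication by the inverse \<open>U\<close> of the value at \<open>x\<close> moves
  the curve so that it passes through 1 while staying in \<open>G\<close>; every vanishing
  polynomial is zero along it.\<close>

lemma lie_algebra_tangent:
  assumes "open S" "x \<in> S" "\<And>y. y \<in> S \<Longrightarrow> \<gamma> y \<in> G" "has_matrix_derivative \<gamma> \<gamma>' x" "\<gamma> x ** U = mat 1"
  shows "U ** \<gamma>' \<in> lie_algebra G"
  unfolding lie_algebra_iff
proof (intro allI impI)
  fix p assume p: "vanishing G p"
  have U: "U \<in> G" using assms group_mem(4) by blast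
  have "((\<lambda>s. p (U ** \<gamma> s)) has_field_derivative pdiff p (U ** \<gamma> x) (U ** \<gamma>')) (at x)"
    using p by (intro pdiff_chain hmd_lmul assms) (simp add: vanishing_def)
  moreover have "((\<lambda>s. p (U ** \<gamma> s)) has_field_derivative 0) (at x)"
    by (rule has_field_derivative_transform_within_open[OF DERIV_const assms(1,2)])
      (use p U assms(3) group_mem(2) in \<open>auto simp: vanishing_def\<close>)
  moreover have "U ** \<gamma> x = mat 1"
    using assms(5) matrix_left_right_inverse by blast
  ultimately show "pdiff p (mat 1) (U ** \<gamma>') = 0"
    by (simp add: DERIV_unique)
qed

lemma lie_algebra_conj:
  assumes "A \<in> G" "A ** U = mat 1" "X \<in> lie_algebra G"
  shows "A ** X ** U \<in> lie_algebra G"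
  unfolding lie_algebra_iff
proof (intro allI impI)
  fix p assume p: "vanishing G p"
  have "pdiff (\<lambda>X. p (A ** X ** U)) (mat 1) X = 0"
    using assms p group_mem(4) vanishing_translate lie_algebra_iff by blast
  then show "pdiff p (mat 1) (A ** X ** U) = 0"
    using p assms(2) by (simp add: pdiff_compose_mul vanishing_def)
qed

text \<open>For \<open>p\<close> vanishing on \<open>G\<close>, the derivative of \<open>p\<close>
  along \<open>mexp (s *\<^sub>C X)\<close> is the value there of \<open>pdiff p A (A ** X)\<close>,
  which by \<open>vanishing_pdiff\<close> vanishes on \<open>G\<close> again. So all Taylor
  coefficients at \<open>s = 0\<close> are zero, and the entire function
  \<open>p (mexp (s *\<^sub>C X))\<close> is zero also at \<open>s = 1\<close>.\<close>

lemma mexp_in_group: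
  assumes X: "X \<in> lie_algebra G"
  shows "mexp X \<in> G"
proof -
  let ?\<gamma> = "\<lambda>s. mexp (s *\<^sub>C X)"
  let ?h = "\<lambda>p s. p (?\<gamma> s) :: complex"
  have der: "(?h p has_field_derivative pdiff p (?\<gamma> s) (?\<gamma> s ** X)) (at s)"
    if "matrix_polynomial p" for p s
  proof (cases "s = 0")
    case True
    then show ?thesis using pdiff_chain[OF that hmd_mexp_scaled[of X s]] by (simp add: cscale_simps)
  next
    case False
    then have "X ** ?\<gamma> s = ?\<gamma> s ** X"
      using mexp_commute[of "s *\<^sub>C X"] by (simp add: matrix_ring_simps)
    then show ?thesis using pdiff_chain[OF that hmd_mexp_scaled[of X s]] by simp
  qed
  have zero: "(deriv ^^ n) (?h p) 0 = 0" if "vanishing G p" for n p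
    using that
  proof (induction n arbitrary: p)
    case 0
    then show ?case by (simp add: vanishing_def cscale_simps group_mem)
  next
    case (Suc n)
    let ?q = "\<lambda>A. pdiff p A (A ** X)"
    have p: "matrix_polynomial p" using Suc.prems by (simp add: vanishing_def)
    have "deriv (?h p) = ?h ?q" using DERIV_imp_deriv[OF der[OF p]] by blast
    moreover have "vanishing G ?q"
      using Suc.prems X vanishing_pdiff pdiff_props(2)[OF p] by (simp add: vanishing_def[of G ?q])
    ultimately show ?case using Suc.IH[of ?q] by (simp only: funpow_Suc_right comp_apply)
  qed
  have "?h p 1 = 0" if "vanishing G p" for p
  proof (rule holomorphic_fun_eq_0_on_connected[of "?h p" UNIV 0 1])
    have "?h p field_differentiable at s" for s
      using der[of p s] that unfolding vanishing_def field_differentiable_def by blast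
    then show "?h p holomorphic_on UNIV"
      by (simp add: holomorphic_on_def field_differentiable_at_within)
  qed (auto simp: zero that)
  then show ?thesis
    unfolding group_iff using invertibleI[OF mexp_mul_minus] by (simp add: cscale_simps)
qed

text \<open>The curve \<open>?F\<close> of conjugates of \<open>X\<close> by
  \<open>mexp (s *\<^sub>C Z)\<close> stays in the Lie algebra and has the commutator as its
  derivative at 0. The Lie algebra is a common kernel of linear functionals, so it contains that
  derivative.\<close>

lemma lie_algebra_commutator:
  assumes "Z \<in> lie_algebra G" "X \<in> lie_algebra G"
  shows "Z ** X - X ** Z \<in> lie_algebra G"
  unfolding lie_algebra_iff
proof (intro allI impI)
  fix p assume p: "vanishing G p"
  let ?F = "\<lambda>s. mexp (s *\<^sub>C Z) ** X ** mexp (s *\<^sub>C (- Z))"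
  have F: "?F s \<in> lie_algebra G" for s
    using assms mexp_mul_minus[of "s *\<^sub>C Z"]
    by (intro lie_algebra_conj mexp_in_group lie_algebra_cscale) (simp_all add: cscale_simps)
  have "has_matrix_derivative ?F (Z ** X - X ** Z) 0"
    using hmd_mul[OF hmd_rmul[OF hmd_mexp_scaled[of Z 0], of X] hmd_mexp_scaled[of "- Z" 0]]
    by (simp add: cscale_simps matrix_ring_simps)
  from has_derivative_compose[OF hmd_has_derivative[OF this]
      bounded_linear_imp_has_derivative[OF bounded_linear_pdiff, of p "mat 1"]]
  have "((\<lambda>s. pdiff p (mat 1) (?F s)) has_field_derivative pdiff p (mat 1) (Z ** X - X ** Z)) (at 0)"
    using p by (simp add: vanishing_def has_field_derivative_def pdiff_props(1)
        mult.commute[of _ "pdiff p (mat 1) (Z ** X - X ** Z)"])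
  moreover have "pdiff p (mat 1) (?F s) = 0" for s
    using F p lie_algebra_iff by blast
  ultimately have "((\<lambda>s::complex. 0) has_field_derivative pdiff p (mat 1) (Z ** X - X ** Z)) (at 0)"
    by simp
  then show "pdiff p (mat 1) (Z ** X - X ** Z) = 0"
    by (rule DERIV_unique) (rule DERIV_const)
qed

end

text \<open>Applying \<open>L - r\<close> for all \<open>r\<close> in a finite \<open>R\<close>
  stays in \<open>V\<close> and multiplies the component of eigenvalue \<open>s\<close> by the
  product of the \<open>s - r\<close>. For \<open>R = S - {s}\<close> only the component
  \<open>x s\<close> survives, with a non-zero factor.\<close>

lemma subspace_eigencomponents:
  fixes L :: "complex^'n^'n \<Rightarrow> complex^'n^'n"
  assumes V: "cmat.subspace V" "\<And>X. X \<in> V \<Longrightarrow> L X \<in> V"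
    and L: "\<And>X Y. L (X + Y) = L X + L Y" "\<And>c X. L (c *\<^sub>C X) = c *\<^sub>C L X"
    and S: "finite S" "\<And>s. s \<in> S \<Longrightarrow> L (x s) = s *\<^sub>C x s" "(\<Sum>s\<in>S. x s) \<in> V" "s \<in> S"
  shows "x s \<in> V"
proof -
  have L0: "L 0 = 0" using L(2)[of 0 0] by (simp add: cscale_simps)
  have L_sum: "L (\<Sum>s\<in>S. c s *\<^sub>C x s) = (\<Sum>s\<in>S. (c s * s) *\<^sub>C x s)" for c :: "complex \<Rightarrow> complex"
  proof -
    have "L (\<Sum>s\<in>T. c s *\<^sub>C x s) = (\<Sum>s\<in>T. (c s * s) *\<^sub>C x s)" if "T \<subseteq> S" for T
      using finite_subset[OF that S(1)] that
      by (induction T rule: finite_induct) (auto simp: L L0 S(2) cscale_simps)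
    then show ?thesis by simp
  qed
  have "(\<Sum>s\<in>S. (\<Prod>r\<in>R. s - r) *\<^sub>C x s) \<in> V" if "finite R" for R
    using that
  proof (induction R rule: finite_induct)
    case empty
    then show ?case using S(3) by (simp add: cscale_simps)
  next
    case (insert r R)
    let ?y = "\<Sum>s\<in>S. (\<Prod>r\<in>R. s - r) *\<^sub>C x s"
    have "(\<Sum>s\<in>S. (\<Prod>r\<in>insert r R. s - r) *\<^sub>C x s) = L ?y - r *\<^sub>C ?y"
      unfolding L_sum using insert.hyps
      by (simp add: cmat.scale_sum_right sum_subtractf[symmetric] cscale_simps algebra_simps)
    then show ?case
      using insert.IH V by (simp add: cmat.subspace_diff cmat.subspace_scale)
  qed
  from this[of "S - {s}"] S(1) have *: "(\<Sum>t\<in>S. (\<Prod>r\<in>S - {s}. t - r) *\<^sub>C x t) \<in> V" by simp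
  have "(\<Prod>r\<in>S - {s}. t - r) = 0" if "t \<in> S - {s}" for t
    using that S(1) by (intro prod_zero) auto
  then have "(\<Sum>t\<in>S - {s}. (\<Prod>r\<in>S - {s}. t - r) *\<^sub>C x t) = 0"
    by (intro sum.neutral ballI) (simp only: cscale_simps)
  then have "(\<Sum>t\<in>S. (\<Prod>r\<in>S - {s}. t - r) *\<^sub>C x t) = (\<Prod>r\<in>S - {s}. s - r) *\<^sub>C x s"
    using S(1,4) by (subst sum.remove[of S s]) simp_all
  moreover have "(\<Prod>r\<in>S - {s}. s - r) \<noteq> 0" using S(1) by auto
  ultimately show ?thesis
    using * cmat.subspace_scale[OF V(1), of _ "inverse (\<Prod>r\<in>S - {s}. s - r)"]
    by (metis (no_types, lifting) cscale_simps(7) cscale_simps(8) left_inverse)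
qed

section \<open>The scalar equation \<open>k' = -\<mu>k - b\<close> on a truncated half-plane\<close>

lemma uniform_limit_rate:
  fixes F :: "nat \<Rightarrow> 'a \<Rightarrow> 'b::banach"
  assumes "\<And>m n x. x \<in> S \<Longrightarrow> m \<le> n \<Longrightarrow> norm (F n x - F m x) \<le> c m" "c \<longlonglongrightarrow> 0"
  obtains L where "uniform_limit S F L sequentially"
proof -
  have "uniformly_Cauchy_on S F"
  proof (rule uniformly_Cauchy_onI')
    fix e :: real assume "e > 0"
    with assms(2) obtain N where N: "\<forall>m\<ge>N. norm (c m - 0) < e"
      using LIMSEQ_D by blast
    show "\<exists>M. \<forall>x\<in>S. \<forall>m\<ge>M. \<forall>n>m. dist (F m x) (F n x) < e"
    proof (intro exI[of _ N] ballI allI impI)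
      fix x m n assume "x \<in> S" "N \<le> m" "m < n"
      then have "norm (F n x - F m x) \<le> c m" "norm (c m - 0) < e"
        using assms(1)[of x m n] N by auto
      then show "dist (F m x) (F n x) < e"
        unfolding dist_norm norm_minus_commute[of "F m x"] by simp
    qed
  qed
  then have "uniformly_convergent_on S F" by (rule Cauchy_uniformly_convergent)
  then show ?thesis using that by (auto simp: uniformly_convergent_on_def)
qed

lemma openE_cball:
  assumes "open S" "x \<in> S"
  obtains d where "0 < d" "cball x d \<subseteq> S"
  using assms open_contains_cball[of S] by blast

text \<open>The two bounds have different purposes: \<open>K x\<close> hands its decay in
  \<open>x\<close> on to the limit, \<open>K0\<close> makes the convergence uniform. The subtracted
  term in \<open>rate\<close> is what makes the induction close.\<close>

lemma uniform_limit_geometric: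
  fixes F :: "nat \<Rightarrow> 'a \<Rightarrow> 'b::banach"
  assumes step: "\<And>n x. x \<in> S \<Longrightarrow> norm (F (Suc n) x - F n x) \<le> K x / 2 ^ n"
    and K_le: "\<And>x. x \<in> S \<Longrightarrow> K x \<le> K0"
  obtains L where "uniform_limit S F L sequentially"
    "\<And>x. x \<in> S \<Longrightarrow> (\<lambda>n. F n x) \<longlonglongrightarrow> L x" "\<And>x. x \<in> S \<Longrightarrow> norm (L x - F 0 x) \<le> 2 * K x"
proof -
  have rate: "norm (F (m + d) x - F m x) \<le> 2 * K x / 2 ^ m - 2 * K x / 2 ^ (m + d)" if "x \<in> S" for m d x
  proof (induction d)
    case (Suc d)
    have "norm (F (m + Suc d) x - F m x) \<le> norm (F (m + d) x - F m x) + norm (F (Suc (m + d)) x - F (m + d) x)"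
      using norm_triangle_ineq[of "F (m + d) x - F m x" "F (Suc (m + d)) x - F (m + d) x"] by simp
    also have "\<dots> \<le> (2 * K x / 2 ^ m - 2 * K x / 2 ^ (m + d)) + K x / 2 ^ (m + d)"
      by (intro add_mono Suc step that)
    also have "\<dots> = 2 * K x / 2 ^ m - 2 * K x / 2 ^ (m + Suc d)"
      by (simp add: field_simps)
    finally show ?case .
  qed simp
  have K: "0 \<le> K x" if "x \<in> S" for x
    using order_trans[OF norm_ge_zero step[OF that, of 0]] by simp
  have rate': "norm (F n x - F m x) \<le> 2 * K x / 2 ^ m" if x: "x \<in> S" and "m \<le> n" for m n x
  proof -
    have "norm (F n x - F m x) \<le> 2 * K x / 2 ^ m - 2 * K x / 2 ^ n"
      using rate[OF x, of m "n - m"] \<open>m \<le> n\<close> by simp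
    moreover have "0 \<le> 2 * K x / 2 ^ n" using K[OF x] by simp
    ultimately show ?thesis by linarith
  qed
  obtain L where L: "uniform_limit S F L sequentially"
  proof (rule uniform_limit_rate[of S F "\<lambda>m. 2 * K0 / 2 ^ m"])
    fix m n x assume x: "x \<in> S" and "m \<le> (n::nat)"
    then have "norm (F n x - F m x) \<le> 2 * K x / 2 ^ m" by (rule rate')
    also have "\<dots> \<le> 2 * K0 / 2 ^ m"
      using K_le[OF x] by (intro divide_right_mono) auto
    finally show "norm (F n x - F m x) \<le> 2 * K0 / 2 ^ m" .
  next
    show "(\<lambda>m. 2 * K0 / 2 ^ m) \<longlonglongrightarrow> 0"
      using LIMSEQ_divide_realpow_zero[of 2 "2 * K0"] by simp
  qed
  have lim: "(\<lambda>n. F n x) \<longlonglongrightarrow> L x" if "x \<in> S" for x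
    by (rule tendsto_uniform_limitI[OF L that])
  have "norm (L x - F 0 x) \<le> 2 * K x" if "x \<in> S" for x
  proof (rule LIMSEQ_le_const2)
    show "(\<lambda>n. norm (F n x - F 0 x)) \<longlonglongrightarrow> norm (L x - F 0 x)"
      by (intro tendsto_intros lim that)
    show "\<exists>N. \<forall>n\<ge>N. norm (F n x - F 0 x) \<le> 2 * K x"
      using rate'[OF that, of 0] by auto
  qed
  with L lim show ?thesis by (rule that)
qed

text \<open>By Weierstrass, uniform convergence of holomorphic functions carries the derivatives
  along, so a mere pointwise limit \<open>D\<close> of the derivatives identifies the derivative of
  \<open>L\<close>.\<close>

lemma hmd_uniform_limit:
  assumes "open S" "\<And>n x. x \<in> S \<Longrightarrow> has_matrix_derivative (T n) (T' n x) x"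
    and ul: "uniform_limit S T L sequentially"
    and lim: "\<And>x. x \<in> S \<Longrightarrow> (\<lambda>n. T' n x) \<longlonglongrightarrow> D x" and x: "x \<in> S"
  shows "has_matrix_derivative L (D x) x"
proof (rule hmdI)
  fix i j
  have ul': "uniform_limit S (\<lambda>n x. T n x $ i $ j) (\<lambda>x. L x $ i $ j) sequentially"
    unfolding uniform_limit_iff
  proof (intro allI impI)
    fix e :: real assume "e > 0"
    with ul have "\<forall>\<^sub>F n in sequentially. \<forall>x\<in>S. dist (T n x) (L x) < e"
      by (rule uniform_limitD)
    then show "\<forall>\<^sub>F n in sequentially. \<forall>x\<in>S. dist (T n x $ i $ j) (L x $ i $ j) < e"
    proof (rule eventually_mono, intro ballI)
      fix n x assume "\<forall>x\<in>S. dist (T n x) (L x) < e" "x \<in> S"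
      moreover have "dist (T n x $ i $ j) (L x $ i $ j) \<le> dist (T n x) (L x)"
        using norm_entry_le[of "T n x - L x" i j] by (simp add: dist_norm)
      ultimately show "dist (T n x $ i $ j) (L x $ i $ j) < e" by fastforce
    qed
  qed
  have *: "\<exists>d>0. cball x d \<subseteq> S \<and> uniform_limit (cball x d) (\<lambda>n x. T n x $ i $ j) (\<lambda>x. L x $ i $ j) sequentially"
    if "x \<in> S" for x
  proof -
    obtain d where "0 < d" "cball x d \<subseteq> S" using openE_cball[OF assms(1) \<open>x \<in> S\<close>] .
    then show ?thesis by (intro exI[of _ d] conjI uniform_limit_on_subset[OF ul'])
  qed
  have "\<exists>g'. \<forall>x\<in>S. ((\<lambda>x. L x $ i $ j) has_field_derivative g' x) (at x) \<and>
      (\<lambda>n. T' n x $ i $ j) \<longlonglongrightarrow> g' x"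
    by (rule has_complex_derivative_uniform_sequence[OF assms(1), of "\<lambda>n x. T n x $ i $ j"
          "\<lambda>n x. T' n x $ i $ j"]) (rule hmdD[OF assms(2)], assumption, rule *)
  then obtain h where h: "\<forall>x\<in>S. ((\<lambda>x. L x $ i $ j) has_field_derivative h x) (at x) \<and>
      (\<lambda>n. T' n x $ i $ j) \<longlonglongrightarrow> h x" ..
  note g' = bspec[OF h x, THEN conjunct1] bspec[OF h x, THEN conjunct2]
  have "(\<lambda>n. T' n x $ i $ j) \<longlonglongrightarrow> D x $ i $ j"
    using lim[OF x] by (intro tendsto_vec_nth)
  with g'(2) have "h x = D x $ i $ j" by (rule LIMSEQ_unique)
  with g'(1) show "((\<lambda>x. L x $ i $ j) has_field_derivative D x $ i $ j) (at x)" by simp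
qed

text \<open>For positive \<eta> and \<open>M\<close> this is the half-plane without a triangle at
  the origin. It contains all points of the half-plane far from 0, also those close to the imaginary
  axis, and, unlike the complement of a disc, it is mapped into itself by shifts in every direction
  \<open>Complex 1 y\<close> with \<open>\<eta> * \<bar>y\<bar> \<le> 1\<close>. It is not convex,
  but starlike about \<open>2 * M\<close>.\<close>

definition truncated_half_plane :: "real \<Rightarrow> real \<Rightarrow> complex set"
  where "truncated_half_plane \<eta> M = {x. 0 < Re x \<and> M < Re x + \<eta> * \<bar>Im x\<bar>}"

lemma open_truncated_half_plane: "open (truncated_half_plane \<eta> M)"
  unfolding truncated_half_plane_def
  by (intro open_Collect_conj open_Collect_less continuous_intros)

lemma starlike_truncated_half_plane:
  assumes "0 < \<eta>" "0 < M"
  shows "starlike (truncated_half_plane \<eta> M)"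
  unfolding starlike_def
proof (intro bexI ballI subsetI)
  let ?a = "complex_of_real (2 * M)"
  show "?a \<in> truncated_half_plane \<eta> M" using assms by (simp add: truncated_half_plane_def)
  fix x z assume x: "x \<in> truncated_half_plane \<eta> M" and "z \<in> closed_segment ?a x"
  then obtain u where u: "0 \<le> u" "u \<le> 1" "z = (1 - u) *\<^sub>R ?a + u *\<^sub>R x"
    by (auto simp: closed_segment_def)
  have z: "Re z = (1 - u) * (2 * M) + u * Re x" "\<bar>Im z\<bar> = u * \<bar>Im x\<bar>"
    using u by (auto simp: abs_mult)
  have pos: "0 < (1 - u) * p + u * q" if "0 < p" "0 < q" for p q :: real
  proof (cases "u = 0")
    case False
    then have "0 < u * q" using u that by simp
    moreover have "0 \<le> (1 - u) * p" using u that by simp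
    ultimately show ?thesis by linarith
  qed (use that in simp)
  have "0 < (1 - u) * M + u * (Re x + \<eta> * \<bar>Im x\<bar> - M)"
    using x assms by (intro pos) (auto simp: truncated_half_plane_def)
  also have "\<dots> = Re z + \<eta> * \<bar>Im z\<bar> - M"
    unfolding z by (simp add: algebra_simps)
  finally show "z \<in> truncated_half_plane \<eta> M"
    using pos[of "2 * M" "Re x"] x assms unfolding z(1)[symmetric] by (simp add: truncated_half_plane_def)
qed

lemma truncated_half_plane_norm_ge:
  assumes "0 < \<eta>" "x \<in> truncated_half_plane \<eta> M"
  shows "M / (1 + \<eta>) \<le> norm x"
proof -
  have "M < Re x + \<eta> * \<bar>Im x\<bar>" using assms by (simp add: truncated_half_plane_def)
  also have "\<dots> \<le> norm x + \<eta> * norm x"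
    using assms by (intro add_mono mult_left_mono complex_Re_le_cmod abs_Im_le_cmod) auto
  finally show ?thesis using assms by (simp add: field_simps)
qed

lemma truncated_half_plane_shift:
  assumes "x \<in> truncated_half_plane \<eta> M" "0 \<le> s" "0 \<le> \<eta>" "\<eta> * \<bar>y\<bar> \<le> 1"
  shows "x + of_real s * Complex 1 y \<in> truncated_half_plane \<eta> M"
proof -
  have "\<eta> * \<bar>Im x\<bar> \<le> \<eta> * (\<bar>Im x + s * y\<bar> + s * \<bar>y\<bar>)"
    using assms abs_triangle_ineq4[of "Im x + s * y" "s * y"] by (intro mult_left_mono) (auto simp: abs_mult)
  moreover have "s * (\<eta> * \<bar>y\<bar>) \<le> s" using assms mult_left_mono[of "\<eta> * \<bar>y\<bar>" 1 s] by simp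
  ultimately show ?thesis
    using assms by (auto simp: truncated_half_plane_def algebra_simps)
qed

text \<open>Makes a decay of order \<open>1 / (norm x)\<^sup>2\<close> integrable along the shifted
  ray, with an integral of order \<open>1 / norm x\<close>.\<close>

lemma norm_half_plane_shift:
  assumes "0 < Re x" "0 \<le> s"
  shows "norm x + s \<le> (\<bar>y\<bar> + 2) * norm (x + of_real s * Complex 1 y)"
proof -
  let ?z = "x + of_real s * Complex 1 y"
  have "Re x + s \<le> norm ?z" using complex_Re_le_cmod[of ?z] by simp
  then have "(\<bar>y\<bar> + 1) * (Re x + s) \<le> (\<bar>y\<bar> + 1) * norm ?z" by (intro mult_left_mono) auto
  moreover have "\<bar>Im x\<bar> - s * \<bar>y\<bar> \<le> norm ?z"
    using abs_Im_le_cmod[of ?z] abs_triangle_ineq4[of "Im x + s * y" "s * y"] assms by (simp add: abs_mult)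
  moreover have "norm x \<le> Re x + \<bar>Im x\<bar>" using cmod_le[of x] assms by simp
  moreover have "0 \<le> \<bar>y\<bar> * Re x" using assms by simp
  ultimately show ?thesis by (simp add: algebra_simps)
qed

text \<open>Variation of constants from infinity: with \<open>\<theta> = Complex 1 y\<close>,
  \<open>k x\<close> is the integral of \<open>exp (\<mu> * (s * \<theta>)) * b (x + s * \<theta>) *
  \<theta>\<close> over \<open>s \<ge> 0\<close>, where the exponential has modulus at most 1. Two
  of the factors \<open>\<bar>y\<bar> + 2\<close> come from \<open>norm_half_plane_shift\<close>,
  the third bounds \<open>norm \<theta>\<close>.\<close>

lemma scalar_equation:
  fixes \<mu> :: complex
  assumes \<eta>: "0 < \<eta>" "\<eta> * \<bar>y\<bar> \<le> 1" and M: "0 < M" and \<mu>: "Re (\<mu> * Complex 1 y) \<le> 0"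
    and b: "b holomorphic_on truncated_half_plane \<eta> M"
    and b_le: "\<And>x. x \<in> truncated_half_plane \<eta> M \<Longrightarrow> norm (b x) \<le> \<beta> / (norm x)\<^sup>2"
  obtains k where "\<And>x. x \<in> truncated_half_plane \<eta> M \<Longrightarrow>
      (k has_field_derivative (- \<mu> * k x - b x)) (at x)"
    "\<And>x. x \<in> truncated_half_plane \<eta> M \<Longrightarrow> norm (k x) \<le> (\<bar>y\<bar> + 2) ^ 3 * \<beta> / norm x"
proof -
  define D where "D = truncated_half_plane \<eta> M"
  define \<theta> where "\<theta> = Complex 1 y"
  define C where "C = (\<bar>y\<bar> + 2) ^ 3 * \<beta>"
  have oD: "open D" unfolding D_def by (rule open_truncated_half_plane)
  have shift: "x + of_real s * \<theta> \<in> D" if "x \<in> D" "0 \<le> s" for x s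
    using truncated_half_plane_shift that \<eta> unfolding D_def \<theta>_def by simp
  have pos: "0 < Re x" "0 < norm x" if "x \<in> D" for x
    using that unfolding D_def truncated_half_plane_def by auto
  have \<beta>: "0 \<le> \<beta>"
  proof -
    have "of_real (2 * M) \<in> D" using M \<eta> by (simp add: D_def truncated_half_plane_def)
    from order_trans[OF norm_ge_zero b_le[OF this[unfolded D_def]]] pos[OF this] show ?thesis
      by (simp add: zero_le_divide_iff)
  qed
  have "\<exists>P. \<forall>x\<in>D. (P has_field_derivative exp (\<mu> * x) * b x) (at x)"
  proof (rule holomorphic_starlike_primitive[of D _ "{}"])
    have *: "(\<lambda>x. exp (\<mu> * x) * b x) holomorphic_on D"
      using b unfolding D_def by (intro holomorphic_intros)
    then show "continuous_on D (\<lambda>x. exp (\<mu> * x) * b x)" by (rule holomorphic_on_imp_continuous_on)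
    show "(\<lambda>x. exp (\<mu> * x) * b x) field_differentiable at x" if "x \<in> D - {}" for x
      using that by (intro holomorphic_on_imp_differentiable_at[OF * oD]) simp
    show "starlike D" unfolding D_def using \<eta> M by (intro starlike_truncated_half_plane)
  qed (use oD in auto)
  then obtain P where P: "\<And>x. x \<in> D \<Longrightarrow> (P has_field_derivative exp (\<mu> * x) * b x) (at x)" by blast
  \<comment> \<open>The integral cut off at \<open>s = n\<close>, written with the primitive
    \<open>P\<close>, so that the improper integral becomes a limit of a sequence.\<close>
  define F where "F = (\<lambda>(n::nat) x. exp (- \<mu> * x) * (P (x + of_real n * \<theta>) - P x))"
  have norm_exp: "norm (exp (\<mu> * (of_real s * \<theta>))) \<le> 1" if "0 \<le> s" for s
  proof -
    have "Re (\<mu> * (of_real s * \<theta>)) = s * Re (\<mu> * \<theta>)" by (simp add: algebra_simps)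
    also have "\<dots> \<le> 0" using \<mu> that unfolding \<theta>_def by (simp add: mult_nonneg_nonpos)
    finally show ?thesis by (simp only: norm_exp_eq_Re exp_le_one_iff)
  qed
  have bound: "norm (b (x + of_real s * \<theta>) * \<theta>) \<le> C / (norm x + s)\<^sup>2" if x: "x \<in> D" and s: "0 \<le> s" for x s
  proof -
    let ?z = "x + of_real s * \<theta>"
    have 1: "norm \<theta> \<le> \<bar>y\<bar> + 2" using cmod_le[of \<theta>] unfolding \<theta>_def by simp
    have "(norm x + s)\<^sup>2 \<le> ((\<bar>y\<bar> + 2) * norm ?z)\<^sup>2"
      using norm_half_plane_shift[OF pos(1)[OF x] s, of y] s unfolding \<theta>_def by (intro power_mono) auto
    then have "\<beta> * (norm x + s)\<^sup>2 \<le> \<beta> * ((\<bar>y\<bar> + 2) * norm ?z)\<^sup>2"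
      using \<beta> by (rule mult_left_mono)
    moreover have "0 < norm ?z" by (rule pos(2)[OF shift[OF x s]])
    moreover have "0 < norm x + s" using pos(2)[OF x] s by (rule add_pos_nonneg)
    ultimately have 2: "\<beta> / (norm ?z)\<^sup>2 \<le> (\<bar>y\<bar> + 2)\<^sup>2 * \<beta> / (norm x + s)\<^sup>2"
      by (simp only: pos_divide_le_eq pos_le_divide_eq zero_less_power
          times_divide_eq_left times_divide_eq_right power_mult_distrib mult_ac)
    have "norm (b ?z * \<theta>) \<le> ((\<bar>y\<bar> + 2)\<^sup>2 * \<beta> / (norm x + s)\<^sup>2) * (\<bar>y\<bar> + 2)"
      unfolding norm_mult
      by (rule mult_mono[OF order_trans[OF b_le[OF shift[OF x s, unfolded D_def]] 2] 1]) (use \<beta> in auto)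
    also have "\<dots> = C / (norm x + s)\<^sup>2"
      by (simp add: C_def power3_eq_cube power2_eq_square mult_ac)
    finally show ?thesis .
  qed
  have rate: "norm (F n x - F m x) \<le> C / (norm x + m) - C / (norm x + n)" if x: "x \<in> D" and "m \<le> n" for x m n
  proof (cases "m = n")
    case False
    let ?f = "\<lambda>s. exp (- \<mu> * x) * P (x + of_real s * \<theta>)"
    let ?f' = "\<lambda>s. exp (\<mu> * (of_real s * \<theta>)) * (b (x + of_real s * \<theta>) * \<theta>)"
    have der: "(?f has_vector_derivative ?f' s) (at s within T)" if "0 \<le> s" for s T
    proof -
      have "((\<lambda>s. x + of_real s * \<theta>) has_vector_derivative \<theta>) (at s within T)"
        by (auto intro!: derivative_eq_intros)
      from field_vector_diff_chain_within[OF this has_field_derivative_at_within[OF P[OF shift[OF x that]]]]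
      have "((\<lambda>s. P (x + of_real s * \<theta>)) has_vector_derivative
          \<theta> * (exp (\<mu> * (x + of_real s * \<theta>)) * b (x + of_real s * \<theta>))) (at s within T)"
        by (simp only: o_def)
      then have v: "(?f has_vector_derivative exp (- \<mu> * x) *
          (\<theta> * (exp (\<mu> * (x + of_real s * \<theta>)) * b (x + of_real s * \<theta>)))) (at s within T)"
        by (rule has_vector_derivative_mult_right)
      have e: "exp (- \<mu> * x) * exp (\<mu> * (x + of_real s * \<theta>)) = exp (\<mu> * (of_real s * \<theta>))"
        by (simp only: mult_exp_exp distrib_left) simp
      have "exp (- \<mu> * x) * (\<theta> * (exp (\<mu> * (x + of_real s * \<theta>)) * b (x + of_real s * \<theta>))) =
          (exp (- \<mu> * x) * exp (\<mu> * (x + of_real s * \<theta>))) * (b (x + of_real s * \<theta>) * \<theta>)"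
        by (simp only: mult_ac)
      with v show ?thesis by (simp only: e)
    qed
    have der2: "((\<lambda>s. - C / (norm x + s)) has_vector_derivative C / (norm x + s)\<^sup>2) (at s within T)"
      if "0 \<le> s" for s T
      unfolding has_real_derivative_iff_has_vector_derivative[symmetric]
      using add_pos_nonneg[OF pos(2)[OF x] that] by (auto intro!: derivative_eq_intros simp: power2_eq_square)
    \<comment> \<open>Mean value inequality against \<open>- C / (norm x + s)\<close>, the primitive
      of the bound for the integrand.\<close>
    have "norm (?f (real n) - ?f (real m)) \<le> - C / (norm x + n) - (- C / (norm x + m))"
    proof (rule differentiable_bound_general[where f' = ?f' and \<phi>' = "\<lambda>s. C / (norm x + s)\<^sup>2"])
      show "continuous_on {real m..real n} ?f"
        by (rule continuous_on_vector_derivative) (rule der, simp)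
      show "continuous_on {real m..real n} (\<lambda>s. - C / (norm x + s))"
        by (rule continuous_on_vector_derivative) (rule der2, simp)
      fix s assume "real m < s" "s < real n"
      then have s: "0 \<le> s" by simp
      show "(?f has_vector_derivative ?f' s) (at s)"
        "((\<lambda>s. - C / (norm x + s)) has_vector_derivative C / (norm x + s)\<^sup>2) (at s)"
        using der[OF s] der2[OF s] by auto
      show "norm (?f' s) \<le> C / (norm x + s)\<^sup>2"
        using mult_mono[OF norm_exp[OF s] bound[OF x s]] by (simp add: norm_mult)
    qed (use False \<open>m \<le> n\<close> in simp)
    then show ?thesis by (simp add: F_def algebra_simps)
  qed simp
  have C0: "0 \<le> C" using \<beta> by (simp add: C_def)
  obtain k where k: "uniform_limit D F k sequentially"
  proof (rule uniform_limit_rate[of D F "\<lambda>m. C / (M / (1 + \<eta>) + real m)"])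
    \<comment> \<open>The rate becomes uniform in \<open>x\<close> because \<open>norm x\<close> is
      bounded below by \<open>M / (1 + \<eta>)\<close> on the domain.\<close>
    have *: "norm (F n x - F m x) \<le> C / (norm x + m)" if "x \<in> D" "m \<le> n" for x m n
    proof -
      have "0 \<le> C / (norm x + n)" using C0 by simp
      then show ?thesis using rate[OF that] by linarith
    qed
    fix m n x assume mn: "x \<in> D" "m \<le> (n::nat)"
    have "M / (1 + \<eta>) \<le> norm x" "0 < M / (1 + \<eta>)"
      using truncated_half_plane_norm_ge[OF \<eta>(1)] mn M \<eta> unfolding D_def by auto
    then have "C / (norm x + m) \<le> C / (M / (1 + \<eta>) + m)"
      using C0 by (intro divide_left_mono mult_pos_pos add_pos_nonneg) auto
    with *[OF mn] show "norm (F n x - F m x) \<le> C / (M / (1 + \<eta>) + real m)" by linarith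
  next
    show "(\<lambda>m. C / (M / (1 + \<eta>) + real m)) \<longlonglongrightarrow> 0"
      by (rule real_tendsto_divide_at_top[OF tendsto_const
            filterlim_tendsto_add_at_top[OF tendsto_const filterlim_real_sequentially]])
  qed
  have lim: "(\<lambda>n. F n x) \<longlonglongrightarrow> k x" if "x \<in> D" for x
    using k that by (rule tendsto_uniform_limitI)
  \<comment> \<open>Besides \<open>- \<mu> * F n x\<close> the derivative contains the integrand, up
    to the factor \<theta>, at both ends of the ray segment; the far end tends to 0, leaving
    \<open>- b x\<close>.\<close>
  have dF: "(F n has_field_derivative
      - \<mu> * F n x + (exp (\<mu> * (of_nat n * \<theta>)) * b (x + of_nat n * \<theta>) - b x)) (at x)"
    if x: "x \<in> D" for n x
  proof -
    have "((\<lambda>x. P (x + of_nat n * \<theta>)) has_field_derivative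
        exp (\<mu> * (x + of_nat n * \<theta>)) * b (x + of_nat n * \<theta>)) (at x)"
      using DERIV_shift[of P _ x "of_nat n * \<theta>"] P[OF shift[OF x, of "real n"]] by simp
    moreover have "((\<lambda>x. exp (- \<mu> * x)) has_field_derivative - \<mu> * exp (- \<mu> * x)) (at x)"
      by (auto intro!: derivative_eq_intros)
    ultimately have "(F n has_field_derivative - \<mu> * exp (- \<mu> * x) * (P (x + of_nat n * \<theta>) - P x) +
        (exp (\<mu> * (x + of_nat n * \<theta>)) * b (x + of_nat n * \<theta>) - exp (\<mu> * x) * b x) * exp (- \<mu> * x)) (at x)"
      unfolding F_def of_real_of_nat_eq by (intro DERIV_mult DERIV_diff P[OF x])
    moreover have "exp (\<mu> * (x + of_nat n * \<theta>)) = exp (\<mu> * x) * exp (\<mu> * (of_nat n * \<theta>))"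
      "exp (\<mu> * x) * exp (- \<mu> * x) = 1"
      by (simp_all add: distrib_left exp_add exp_minus_inverse)
    then have "- \<mu> * exp (- \<mu> * x) * (P (x + of_nat n * \<theta>) - P x) +
        (exp (\<mu> * (x + of_nat n * \<theta>)) * b (x + of_nat n * \<theta>) - exp (\<mu> * x) * b x) * exp (- \<mu> * x) =
        - \<mu> * F n x + (exp (\<mu> * (of_nat n * \<theta>)) * b (x + of_nat n * \<theta>) - b x)"
      unfolding F_def of_real_of_nat_eq by algebra
    ultimately show ?thesis by (simp only:)
  qed
  show ?thesis
  proof
    fix x assume "x \<in> truncated_half_plane \<eta> M"
    then have x: "x \<in> D" by (simp add: D_def)
    have "(\<lambda>n. F n x - F 0 x) \<longlonglongrightarrow> k x - F 0 x" by (intro tendsto_intros lim x)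
    moreover have "norm (F n x - F 0 x) \<le> C / norm x" for n
    proof -
      have "0 \<le> C / (norm x + n)" using C0 by simp
      then show ?thesis using rate[OF x, of 0 n] by simp
    qed
    ultimately have "norm (k x - F 0 x) \<le> C / norm x"
      by (intro LIMSEQ_le_const2[OF tendsto_norm]) auto
    then show "norm (k x) \<le> (\<bar>y\<bar> + 2) ^ 3 * \<beta> / norm x" by (simp add: F_def C_def)
    have *: "\<exists>d>0. cball x d \<subseteq> D \<and> uniform_limit (cball x d) F k sequentially" if "x \<in> D" for x
    proof -
      obtain d where "0 < d" "cball x d \<subseteq> D" using openE_cball[OF oD \<open>x \<in> D\<close>] .
      then show ?thesis by (intro exI[of _ d] conjI uniform_limit_on_subset[OF k])
    qed
    have "\<exists>g'. \<forall>x\<in>D. (k has_field_derivative g' x) (at x) \<and>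
        (\<lambda>n. - \<mu> * F n x + (exp (\<mu> * (of_nat n * \<theta>)) * b (x + of_nat n * \<theta>) - b x)) \<longlonglongrightarrow> g' x"
      by (rule has_complex_derivative_uniform_sequence[OF oD, of F
            "\<lambda>n x. - \<mu> * F n x + (exp (\<mu> * (of_nat n * \<theta>)) * b (x + of_nat n * \<theta>) - b x)"])
        (rule dF, assumption, rule *)
    then obtain h where h: "\<forall>x\<in>D. (k has_field_derivative h x) (at x) \<and>
        (\<lambda>n. - \<mu> * F n x + (exp (\<mu> * (of_nat n * \<theta>)) * b (x + of_nat n * \<theta>) - b x)) \<longlonglongrightarrow> h x" ..
    note g' = bspec[OF h x, THEN conjunct1] bspec[OF h x, THEN conjunct2]
    have "(\<lambda>n. exp (\<mu> * (of_nat n * \<theta>)) * b (x + of_nat n * \<theta>)) \<longlonglongrightarrow> 0"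
    proof (rule Lim_null_comparison)
      show "\<forall>\<^sub>F n in sequentially. norm (exp (\<mu> * (of_nat n * \<theta>)) * b (x + of_nat n * \<theta>)) \<le> C / (norm x + real n)\<^sup>2"
      proof (intro always_eventually allI)
        fix n
        have "1 \<le> norm \<theta>" using complex_Re_le_cmod[of \<theta>] by (simp add: \<theta>_def)
        then have "norm (b (x + of_real (real n) * \<theta>)) \<le> norm (b (x + of_real (real n) * \<theta>) * \<theta>)"
          by (simp add: norm_mult mult_left_le_one_le mult_le_cancel_left1)
        also have "\<dots> \<le> C / (norm x + real n)\<^sup>2" by (rule bound[OF x]) simp
        finally show "norm (exp (\<mu> * (of_nat n * \<theta>)) * b (x + of_nat n * \<theta>)) \<le> C / (norm x + real n)\<^sup>2"
          using mult_mono[OF norm_exp[of n], of "norm (b (x + of_nat n * \<theta>))" "C / (norm x + real n)\<^sup>2"]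
          by (simp add: norm_mult)
      qed
      show "(\<lambda>n. C / (norm x + real n)\<^sup>2) \<longlonglongrightarrow> 0"
        by (rule real_tendsto_divide_at_top[OF tendsto_const filterlim_pow_at_top[OF _
              filterlim_tendsto_add_at_top[OF tendsto_const filterlim_real_sequentially]]]) simp
    qed
    then have "(\<lambda>n. - \<mu> * F n x + (exp (\<mu> * (of_nat n * \<theta>)) * b (x + of_nat n * \<theta>) - b x))
        \<longlonglongrightarrow> - \<mu> * k x + (0 - b x)"
      by (intro tendsto_intros lim x)
    with g'(2) have "h x = - \<mu> * k x + (0 - b x)" by (rule LIMSEQ_unique)
    with g'(1) show "(k has_field_derivative - \<mu> * k x - b x) (at x)" by simp
  qed
qed

text \<open>\<open>exp (\<mu> * x) * k x\<close> is constant. Along the direction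
  \<open>Complex 1 y\<close> the exponential does not grow while \<open>k\<close> tends to 0, so the
  constant is 0. This is the tool for showing that solutions stay in \<gg>.\<close>

lemma scalar_equation_decay_zero:
  assumes \<eta>: "0 < \<eta>" "\<eta> * \<bar>y\<bar> \<le> 1" and M: "0 < M" and \<mu>: "Re (\<mu> * Complex 1 y) \<le> 0"
    and k: "\<And>x. x \<in> truncated_half_plane \<eta> M \<Longrightarrow> (k has_field_derivative (- \<mu> * k x)) (at x)"
    and k_le: "\<And>x. x \<in> truncated_half_plane \<eta> M \<Longrightarrow> norm (k x) \<le> K / norm x"
    and x: "x \<in> truncated_half_plane \<eta> M"
  shows "k x = 0"
proof -
  let ?D = "truncated_half_plane \<eta> M"
  have der: "((\<lambda>x. exp (\<mu> * x) * k x) has_field_derivative 0) (at x)" if "x \<in> ?D" for x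
    using k[OF that] by (auto intro!: derivative_eq_intros)
  obtain c where c: "\<And>x. x \<in> ?D \<Longrightarrow> exp (\<mu> * x) * k x = c"
  proof (rule DERIV_zero_connected_constant[of ?D "{}" "\<lambda>x. exp (\<mu> * x) * k x"])
    show "connected ?D" using starlike_truncated_half_plane[OF \<eta>(1) M] by (rule starlike_imp_connected)
    show "continuous_on ?D (\<lambda>x. exp (\<mu> * x) * k x)"
      by (rule DERIV_continuous_on, rule has_field_derivative_at_within, rule der)
  qed (use open_truncated_half_plane der in auto)
  have "norm c \<le> norm (exp (\<mu> * x)) * (K * (\<bar>y\<bar> + 2) / real n)" if "n > 0" for n :: nat
  proof -
    let ?z = "x + of_real n * Complex 1 y"
    have z: "?z \<in> ?D" using truncated_half_plane_shift[OF x _ _ \<eta>(2), of "real n"] \<eta> by simp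
    have "Re (\<mu> * ?z) = Re (\<mu> * x) + real n * Re (\<mu> * Complex 1 y)" by (simp add: algebra_simps)
    also have "\<dots> \<le> Re (\<mu> * x)" using \<mu> by (simp add: mult_nonneg_nonpos)
    finally have 1: "norm (exp (\<mu> * ?z)) \<le> norm (exp (\<mu> * x))" by simp
    have "0 < Re x" using x by (simp add: truncated_half_plane_def)
    from norm_half_plane_shift[OF this, of n y] have 2: "real n \<le> (\<bar>y\<bar> + 2) * norm ?z"
      using norm_ge_zero[of x] unfolding of_real_of_nat_eq by linarith
    then have nz: "0 < norm ?z" using that by (cases "?z = 0") auto
    have "0 \<le> K / norm ?z" using k_le[OF z] norm_ge_zero order_trans by blast
    then have "0 \<le> K" using nz by (simp add: zero_le_divide_iff)
    then have "K * real n \<le> K * ((\<bar>y\<bar> + 2) * norm ?z)" using 2 by (rule mult_left_mono[rotated])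
    then have 3: "K / norm ?z \<le> K * (\<bar>y\<bar> + 2) / real n"
      using that nz by (simp add: divide_simps mult_ac)
    have "norm c = norm (exp (\<mu> * ?z)) * norm (k ?z)" using c[OF z] norm_mult by metis
    also have "\<dots> \<le> norm (exp (\<mu> * x)) * (K * (\<bar>y\<bar> + 2) / real n)"
      by (intro mult_mono 1 order_trans[OF k_le[OF z] 3]) auto
    finally show ?thesis .
  qed
  moreover have "(\<lambda>n. norm (exp (\<mu> * x)) * (K * (\<bar>y\<bar> + 2) / real n)) \<longlonglongrightarrow> norm (exp (\<mu> * x)) * 0"
    by (intro tendsto_intros lim_const_over_n)
  ultimately have "norm c \<le> norm (exp (\<mu> * x)) * 0"
    by (intro LIMSEQ_le_const) (auto intro!: exI[of _ 1])
  then show ?thesis using c[OF x] by simp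
qed

section \<open>The derivation \<open>d/dx + ad Z\<close> on \<open>\<gg>\<close>-valued functions\<close>

lemma hmd_linear_functional:
  fixes \<phi> :: "complex^'n^'n \<Rightarrow> complex"
  assumes "linear \<phi>" "\<And>c X. \<phi> (c *\<^sub>C X) = c * \<phi> X" "has_matrix_derivative k k' x"
  shows "((\<lambda>x. \<phi> (k x)) has_field_derivative \<phi> k') (at x)"
  using has_derivative_compose[OF hmd_has_derivative[OF assms(3)]
      bounded_linear_imp_has_derivative[OF assms(1)[unfolded linear_conv_bounded_linear]]]
  by (simp add: has_field_derivative_def assms(2) mult.commute[of _ "\<phi> k'"])

definition positive_real :: "complex \<Rightarrow> bool"
  where "positive_real \<mu> \<longleftrightarrow> Im \<mu> = 0 \<and> 0 < Re \<mu>"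

text \<open>For \<open>\<mu>\<close> real and not positive the junk value \<open>Re \<mu> / 0 = 0\<close> is a valid choice.\<close>

lemma slope_direction:
  assumes "\<not> positive_real \<mu>"
  shows "Re (\<mu> * Complex 1 (Re \<mu> / Im \<mu>)) \<le> 0"
  using assms by (cases "Im \<mu> = 0") (auto simp: positive_real_def)

text \<open>Will be instantiated with \<open>Z / u\<close> for a point \<open>u\<close> of the ray,
  which turns the ray into the positive reals. Positive real eigenvalues of \<open>ad Z\<close> are
  excluded on the Lie algebra only, not on all matrices.\<close>

locale diagonalized_element =
  fixes G :: "(complex^'n^'n) set" and Z P Q :: "complex^'n^'n" and z :: "'n \<Rightarrow> complex"
  assumes G: "algebraic_group G" and Z: "Z \<in> lie_algebra G"
    and PQ: "P ** Q = mat 1" and Z_diag: "Z = P ** (\<chi> i j. if i = j then z i else 0) ** Q"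
    and admissible: "\<And>X \<mu>. X \<in> lie_algebra G \<Longrightarrow> Z ** X - X ** Z = \<mu> *\<^sub>C X \<Longrightarrow>
      positive_real \<mu> \<Longrightarrow> X = 0"
begin

section \<open>Diagonal coordinates and weight components\<close>

lemma QP: "Q ** P = mat 1"
  using PQ matrix_left_right_inverse by blast

lemma PQ_cancel [simp]: "X ** P ** Q = X" "X ** Q ** P = X" "P ** (Q ** X) = X" "Q ** (P ** X) = X"
  by (metis PQ QP matrix_mul_assoc matrix_mul_rid matrix_mul_lid)+

definition coord :: "complex^'n^'n \<Rightarrow> complex^'n^'n"
  where "coord X = Q ** X ** P"

definition uncoord :: "complex^'n^'n \<Rightarrow> complex^'n^'n"
  where "uncoord X = P ** X ** Q"

text \<open>The eigenvalues of \<open>ad Z\<close> on all matrices; some of them may not occur in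
  \<open>lie_algebra G\<close>.\<close>

definition weights :: "complex set"
  where "weights = range (\<lambda>(i, j). z i - z j)"

definition proj :: "complex \<Rightarrow> complex^'n^'n \<Rightarrow> complex^'n^'n"
  where "proj \<mu> X = uncoord (\<chi> i j. if z i - z j = \<mu> then coord X $ i $ j else 0)"

lemma finite_weights: "finite weights" by (simp add: weights_def)

lemma weight_mem: "z i - z j \<in> weights" by (auto simp: weights_def)

lemma coord_uncoord [simp]: "coord (uncoord X) = X" "uncoord (coord X) = X"
  by (simp_all add: coord_def uncoord_def matrix_mul_assoc QP PQ)

lemma coord_eqI:
  assumes "\<And>i j. coord X $ i $ j = coord Y $ i $ j"
  shows "X = Y"
proof -
  have "uncoord (coord X) = uncoord (coord Y)"
    using assms by (intro arg_cong[of _ _ uncoord]) (simp add: vec_eq_iff)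
  then show ?thesis by simp
qed

lemma coord_simps: "coord (X + Y) = coord X + coord Y" "coord (X - Y) = coord X - coord Y"
  "coord (- X) = - coord X" "coord (c *\<^sub>C X) = c *\<^sub>C coord X" "coord 0 = 0"
  by (simp_all add: coord_def matrix_ring_simps)

lemma uncoord_simps: "uncoord (X + Y) = uncoord X + uncoord Y" "uncoord (X - Y) = uncoord X - uncoord Y"
  "uncoord (- X) = - uncoord X" "uncoord (c *\<^sub>C X) = c *\<^sub>C uncoord X" "uncoord 0 = 0"
  by (simp_all add: uncoord_def matrix_ring_simps)

lemma uncoord_sum: "uncoord (sum f S) = (\<Sum>s\<in>S. uncoord (f s))"
  by (simp add: uncoord_def matrix_mul_sum_left matrix_mul_sum_right)

lemma coord_commutator: "coord (Z ** X - X ** Z) $ i $ j = (z i - z j) * coord X $ i $ j"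
proof -
  let ?D = "\<chi> i j. if i = j then z i else 0 :: complex^'n^'n"
  have "coord (Z ** X - X ** Z) = ?D ** coord X - coord X ** ?D"
    by (simp add: coord_def Z_diag matrix_ring_simps QP)
  moreover have "(?D ** Y) $ i $ j = z i * Y $ i $ j" "(Y ** ?D) $ i $ j = z j * Y $ i $ j" for Y
    by (simp_all add: matrix_matrix_mult_def if_distrib[of "\<lambda>x. x * _"] if_distrib[of "\<lambda>x. _ * x"]
        cong: if_cong)
  ultimately show ?thesis by (simp only: vector_minus_component left_diff_distrib)
qed

lemma proj_simps: "proj \<mu> (X + Y) = proj \<mu> X + proj \<mu> Y" "proj \<mu> (c *\<^sub>C X) = c *\<^sub>C proj \<mu> X"
  "proj \<mu> (- X) = - proj \<mu> X" "proj \<mu> (X - Y) = proj \<mu> X - proj \<mu> Y"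
  unfolding proj_def uncoord_simps[symmetric] coord_simps
  by (rule arg_cong[of _ _ uncoord]; simp add: vec_eq_iff)+

lemma coord_proj: "coord (proj \<mu> X) $ i $ j = (if z i - z j = \<mu> then coord X $ i $ j else 0)"
  by (simp add: proj_def)

lemma proj_commutator: "proj \<mu> (Z ** X - X ** Z) = \<mu> *\<^sub>C proj \<mu> X"
  by (rule coord_eqI) (auto simp: coord_proj coord_simps(4) coord_commutator)

lemma commutator_proj: "Z ** proj \<mu> X - proj \<mu> X ** Z = \<mu> *\<^sub>C proj \<mu> X"
  by (rule coord_eqI) (auto simp: coord_proj coord_simps(4) coord_commutator)

lemma sum_proj: "(\<Sum>\<mu>\<in>weights. proj \<mu> X) = X"
proof -
  have "(\<Sum>\<mu>\<in>weights. \<chi> i j. if z i - z j = \<mu> then coord X $ i $ j else 0) = coord X"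
    by (simp add: vec_eq_iff sum.delta' finite_weights weight_mem)
  then show ?thesis
    unfolding proj_def by (simp add: uncoord_sum[symmetric])
qed

text \<open>As \<open>Z\<close> lies in the Lie algebra, \<open>ad Z\<close> preserves it, and an
  invariant subspace contains the eigencomponents of its elements.\<close>

lemma proj_in_lie_algebra:
  assumes "X \<in> lie_algebra G"
  shows "proj \<mu> X \<in> lie_algebra G"
proof (cases "\<mu> \<in> weights")
  case True
  show ?thesis
  proof (rule subspace_eigencomponents[of "lie_algebra G" "\<lambda>X. Z ** X - X ** Z" weights "\<lambda>\<mu>. proj \<mu> X"])
    show "Z ** Y - Y ** Z \<in> lie_algebra G" if "Y \<in> lie_algebra G" for Y
      using lie_algebra_commutator[OF G Z that] .
  qed (use assms True in \<open>simp_all add: cmat_subspace_lie_algebra matrix_ring_simps cscale_simps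
        finite_weights commutator_proj sum_proj\<close>)
next
  case False
  then have "proj \<mu> X = 0"
    using weight_mem by (intro coord_eqI) (auto simp: coord_proj coord_simps)
  then show ?thesis by (simp add: lie_algebra_zero)
qed

lemma proj_positive_real:
  "X \<in> lie_algebra G \<Longrightarrow> positive_real \<mu> \<Longrightarrow> proj \<mu> X = 0"
  using admissible[OF proj_in_lie_algebra commutator_proj] .

text \<open>For a weight \<mu> that is not real, \<open>\<mu> * Complex 1 (slope i j)\<close> is
  purely imaginary, so \<open>exp (\<mu> * x)\<close> has constant modulus in this
  direction.\<close>

definition slope :: "'n \<Rightarrow> 'n \<Rightarrow> real"
  where "slope i j = Re (z i - z j) / Im (z i - z j)"

text \<open>One value small enough for the slopes of all weights, so that a single domain admits all
  the integration directions.\<close>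

definition aperture :: real
  where "aperture = 1 / (1 + (\<Sum>i\<in>UNIV. \<Sum>j\<in>UNIV. \<bar>slope i j\<bar>))"

abbreviation domain :: "real \<Rightarrow> complex set"
  where "domain M \<equiv> truncated_half_plane aperture M"

lemma aperture: "0 < aperture" "aperture * \<bar>slope i j\<bar> \<le> 1"
proof -
  have "0 \<le> (\<Sum>i\<in>UNIV. \<Sum>j\<in>UNIV. \<bar>slope i j\<bar>)" by (intro sum_nonneg) auto
  moreover have "\<bar>slope i j\<bar> \<le> (\<Sum>i\<in>UNIV. \<Sum>j\<in>UNIV. \<bar>slope i j\<bar>)"
    by (rule order_trans[OF member_le_sum[of j UNIV "\<lambda>j. \<bar>slope i j\<bar>"]
          member_le_sum[of i UNIV "\<lambda>i. \<Sum>j\<in>UNIV. \<bar>slope i j\<bar>"]]) (auto intro!: sum_nonneg)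
  ultimately show "0 < aperture" "aperture * \<bar>slope i j\<bar> \<le> 1"
    by (simp_all add: aperture_def)
qed

text \<open>The constants of \<open>scalar_equation\<close> summed over all entries, together with
  the cost \<open>norm P * norm Q\<close> of passing to diagonal coordinates and again of
  returning.\<close>

definition solution_bound :: real
  where "solution_bound = norm P * norm Q *
    (\<Sum>i\<in>UNIV. \<Sum>j\<in>UNIV. (\<bar>slope i j\<bar> + 2) ^ 3 * (norm Q * norm P))"

lemma solution_bound_nonneg: "0 \<le> solution_bound"
  unfolding solution_bound_def by (intro mult_nonneg_nonneg sum_nonneg) auto

text \<open>In diagonal coordinates the equation splits into scalar ones. An entry whose weight is a
  positive real has no usable direction, but there \<open>B\<close> vanishes because it is
  \<gg>-valued, and 0 is taken as the solution.\<close>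

lemma homological_equation:
  assumes M: "0 < M" and B: "matrix_holomorphic_on B (domain M)"
    and B_lie: "\<And>x. x \<in> domain M \<Longrightarrow> B x \<in> lie_algebra G"
    and B_le: "\<And>x. x \<in> domain M \<Longrightarrow> norm (B x) \<le> \<beta> / (norm x)\<^sup>2"
  obtains k where
    "\<And>x. x \<in> domain M \<Longrightarrow> has_matrix_derivative k (- B x - (Z ** k x - k x ** Z)) x"
    "\<And>x. x \<in> domain M \<Longrightarrow> k x \<in> lie_algebra G"
    "\<And>x. x \<in> domain M \<Longrightarrow> norm (k x) \<le> solution_bound * \<beta> / norm x"
proof -
  define \<beta>' where "\<beta>' = norm Q * norm P * \<beta>"
  let ?b = "\<lambda>i j x. coord (B x) $ i $ j"
  let ?\<mu> = "\<lambda>i j. z i - z j"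
  have pos: "0 < norm x" if "x \<in> domain M" for x
    using that unfolding truncated_half_plane_def by auto
  have \<beta>: "0 \<le> \<beta>" if "x \<in> domain M" for x
    using order_trans[OF norm_ge_zero B_le[OF that]] pos[OF that] by (simp add: zero_le_divide_iff)
  have b_le: "norm (?b i j x) \<le> \<beta>' / (norm x)\<^sup>2" if "x \<in> domain M" for i j x
  proof -
    have "norm (?b i j x) \<le> norm Q * norm (B x) * norm P"
      unfolding coord_def
      by (intro order_trans[OF norm_entry_le] order_trans[OF norm_matrix_mul_le] mult_right_mono norm_matrix_mul_le) simp
    also have "\<dots> \<le> norm Q * (\<beta> / (norm x)\<^sup>2) * norm P"
      by (intro mult_right_mono mult_left_mono B_le that) auto
    finally show ?thesis by (simp add: \<beta>'_def mult_ac)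
  qed
  have b_hol: "?b i j holomorphic_on domain M" for i j
  proof -
    have "matrix_holomorphic_on (\<lambda>x. coord (B x)) (domain M)"
      unfolding coord_def by (intro matrix_holomorphic_intros B)
    then show ?thesis by (simp add: matrix_holomorphic_on_def)
  qed
  have "\<exists>k. (\<forall>x\<in>domain M. (k has_field_derivative (- ?\<mu> i j * k x - ?b i j x)) (at x) \<and>
      norm (k x) \<le> (\<bar>slope i j\<bar> + 2) ^ 3 * \<beta>' / norm x \<and> (positive_real (?\<mu> i j) \<longrightarrow> k x = 0))" for i j
  proof (cases "positive_real (?\<mu> i j)")
    case True
    have "?b i j x = 0" if "x \<in> domain M" for x
    proof -
      have "coord (proj (?\<mu> i j) (B x)) $ i $ j = 0"
        using proj_positive_real[OF B_lie[OF that] True] by (simp add: coord_simps)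
      then show ?thesis by (simp add: coord_proj)
    qed
    moreover have "0 \<le> (\<bar>slope i j\<bar> + 2) ^ 3 * \<beta>' / norm x" if "x \<in> domain M" for x
      using \<beta>[OF that] by (simp add: \<beta>'_def)
    ultimately show ?thesis by (intro exI[of _ "\<lambda>x. 0"]) auto
  next
    case False
    obtain k where "\<And>x. x \<in> domain M \<Longrightarrow> (k has_field_derivative (- ?\<mu> i j * k x - ?b i j x)) (at x)"
      "\<And>x. x \<in> domain M \<Longrightarrow> norm (k x) \<le> (\<bar>slope i j\<bar> + 2) ^ 3 * \<beta>' / norm x"
      using scalar_equation[OF aperture(1) aperture(2)[of i j] M
          slope_direction[OF False, folded slope_def] b_hol b_le] by blast
    then show ?thesis using False by (intro exI[of _ k]) simp
  qed
  then obtain \<kappa> where \<kappa>: "\<And>i j x. x \<in> domain M \<Longrightarrow>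
      (\<kappa> i j has_field_derivative (- ?\<mu> i j * \<kappa> i j x - ?b i j x)) (at x)"
    "\<And>i j x. x \<in> domain M \<Longrightarrow> norm (\<kappa> i j x) \<le> (\<bar>slope i j\<bar> + 2) ^ 3 * \<beta>' / norm x"
    "\<And>i j x. x \<in> domain M \<Longrightarrow> positive_real (?\<mu> i j) \<Longrightarrow> \<kappa> i j x = 0"
    by metis
  define k where "k x = uncoord (\<chi> i j. \<kappa> i j x)" for x
  let ?k' = "\<lambda>x. - B x - (Z ** k x - k x ** Z)"
  have coord_k: "coord (k x) $ i $ j = \<kappa> i j x" for i j x by (simp add: k_def)
  have der: "has_matrix_derivative k (?k' x) x" if x: "x \<in> domain M" for x
  proof -
    have "has_matrix_derivative (\<lambda>x. \<chi> i j. \<kappa> i j x) (\<chi> i j. - ?\<mu> i j * \<kappa> i j x - ?b i j x) x"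
      by (rule hmdI) (simp add: \<kappa>(1)[OF x, simplified])
    then have "has_matrix_derivative k (uncoord (\<chi> i j. - ?\<mu> i j * \<kappa> i j x - ?b i j x)) x"
      unfolding k_def uncoord_def by (intro hmd_rmul hmd_lmul)
    moreover have "uncoord (\<chi> i j. - ?\<mu> i j * \<kappa> i j x - ?b i j x) = ?k' x"
    proof (rule coord_eqI)
      fix i j
      define c where "c = Z ** k x - k x ** Z"
      have "coord c $ i $ j = ?\<mu> i j * \<kappa> i j x"
        by (simp only: c_def coord_commutator coord_k)
      then show "coord (uncoord (\<chi> i j. - ?\<mu> i j * \<kappa> i j x - ?b i j x)) $ i $ j = coord (?k' x) $ i $ j"
        unfolding c_def[symmetric] by (simp add: coord_simps algebra_simps)
    qed
    ultimately show ?thesis by simp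
  qed
  have norm_k: "norm (k x) \<le> solution_bound * \<beta> / norm x" if x: "x \<in> domain M" for x
  proof -
    have "norm (k x) \<le> norm P * norm (\<chi> i j. \<kappa> i j x) * norm Q"
      unfolding k_def uncoord_def
      by (intro order_trans[OF norm_matrix_mul_le] mult_right_mono norm_matrix_mul_le) simp
    also have "norm (\<chi> i j. \<kappa> i j x) \<le> (\<Sum>i\<in>UNIV. \<Sum>j\<in>UNIV. (\<bar>slope i j\<bar> + 2) ^ 3 * \<beta>' / norm x)"
      by (rule order_trans[OF norm_le_sum_entries], intro sum_mono) (simp add: \<kappa>(2)[OF x])
    finally show ?thesis
      by (simp add: solution_bound_def \<beta>'_def sum_distrib_left sum_distrib_right sum_divide_distrib
          mult_ac mult_left_mono mult_right_mono)
  qed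
  \<comment> \<open>Solving entry by entry forgets \<gg>. A functional
    \<open>pdiff p (mat 1)\<close> that kills \<gg> also kills the components of \<open>B\<close>;
    applied to a component of \<open>k\<close> it gives a decaying solution of the homogeneous
    scalar equation, which is zero.\<close>
  have "k x \<in> lie_algebra G" if x: "x \<in> domain M" for x
    unfolding lie_algebra_iff
  proof (intro allI impI)
    fix p assume p: "vanishing G p"
    then have pol: "matrix_polynomial p" by (simp add: vanishing_def)
    have "pdiff p (mat 1) (proj \<mu> (k x)) = 0" if \<mu>: "\<mu> \<in> weights" for \<mu>
    proof (cases "positive_real \<mu>")
      case True
      then have "proj \<mu> (k x) = 0"
        by (intro coord_eqI) (auto simp: coord_proj coord_simps coord_k \<kappa>(3)[OF x])
      then show ?thesis by (simp add: linear_0[OF linear_pdiff[OF pol]])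
    next
      case False
      let ?\<phi> = "\<lambda>X. pdiff p (mat 1) (proj \<mu> X)"
      have lin: "linear ?\<phi>"
        by (rule linearI) (simp_all add: scaleR_eq_cscale proj_simps linear_add[OF linear_pdiff[OF pol]]
            pdiff_props(1)[OF pol] scaleR_conv_of_real)
      obtain K where K: "\<And>X. norm (?\<phi> X) \<le> K * norm X"
        using linear_bounded[OF lin] by blast
      obtain i j where ij: "\<mu> = z i - z j" using \<mu> by (auto simp: weights_def)
      show ?thesis
      proof (rule scalar_equation_decay_zero[OF aperture(1) aperture(2)[of i j] M _ _ _ x])
        show "Re (\<mu> * Complex 1 (slope i j)) \<le> 0"
          using slope_direction[OF False] by (simp add: slope_def ij)
        fix y assume y: "y \<in> domain M"
        define c where "c = Z ** k y - k y ** Z"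
        have "?\<phi> c = \<mu> * ?\<phi> (k y)"
          by (simp only: c_def proj_commutator pdiff_props(1)[OF pol])
        then have "?\<phi> (?k' y) = - \<mu> * ?\<phi> (k y) - ?\<phi> (B y)"
          unfolding c_def[symmetric] by (simp add: linear_diff[OF lin] linear_neg[OF lin])
        moreover have "?\<phi> (B y) = 0"
          using proj_in_lie_algebra[OF B_lie[OF y]] p unfolding lie_algebra_iff by blast
        moreover have "((\<lambda>y. ?\<phi> (k y)) has_field_derivative ?\<phi> (?k' y)) (at y)"
          by (rule hmd_linear_functional[OF lin _ der[OF y]]) (simp add: proj_simps pdiff_props(1)[OF pol])
        ultimately show "((\<lambda>y. ?\<phi> (k y)) has_field_derivative - \<mu> * ?\<phi> (k y)) (at y)" by simp
        have "norm (?\<phi> (k y)) \<le> \<bar>K\<bar> * norm (k y)"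
          by (rule order_trans[OF K]) (simp add: mult_right_mono)
        also have "\<dots> \<le> \<bar>K\<bar> * (solution_bound * \<beta> / norm y)"
          by (intro mult_left_mono norm_k y) simp
        finally show "norm (?\<phi> (k y)) \<le> (\<bar>K\<bar> * (solution_bound * \<beta>)) / norm y" by simp
      qed
    qed
    then have "(\<Sum>\<mu>\<in>weights. pdiff p (mat 1) (proj \<mu> (k x))) = 0" by simp
    then show "pdiff p (mat 1) (k x) = 0"
      by (simp add: linear_sum[OF linear_pdiff[OF pol], symmetric] sum_proj)
  qed
  then show ?thesis using that der norm_k by blast
qed

end

section \<open>The normal form near infinity\<close>

lemma exp_le_bounds:
  fixes x :: real
  assumes "0 \<le> x" "x \<le> 1"
  shows "exp x \<le> 3" "exp x - 1 \<le> 2 * x"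
proof -
  have "x\<^sup>2 \<le> x" using assms by (simp add: power2_eq_square mult_left_le)
  then show "exp x - 1 \<le> 2 * x" using exp_bound[OF assms] by simp
  then show "exp x \<le> 3" using assms by simp
qed

lemma norm_mexp_diff_le:
  assumes "norm A \<le> 1"
  shows "norm (B ** mexp A - B) \<le> 2 * norm B * norm A" "norm (mexp A ** B - B) \<le> 2 * norm B * norm A"
proof -
  have 1: "norm (mexp A - mat 1) \<le> 2 * norm A"
    using norm_mexp_minus_one_le[of A] exp_le_bounds(2)[of "norm A"] assms by simp
  have "B ** mexp A - B = B ** (mexp A - mat 1)" "mexp A ** B - B = (mexp A - mat 1) ** B"
    by (simp_all add: matrix_ring_simps)
  moreover have "norm (B ** (mexp A - mat 1)) \<le> norm B * (2 * norm A)"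
    by (intro order_trans[OF norm_matrix_mul_le] mult_left_mono 1) simp
  moreover have "norm ((mexp A - mat 1) ** B) \<le> (2 * norm A) * norm B"
    by (intro order_trans[OF norm_matrix_mul_le] mult_right_mono 1) simp
  ultimately show "norm (B ** mexp A - B) \<le> 2 * norm B * norm A" "norm (mexp A ** B - B) \<le> 2 * norm B * norm A"
    by (simp_all add: mult_ac)
qed

context diagonalized_element
begin

text \<open>A Newton iteration inside \<open>G\<close>: the logarithmic defect \<open>B\<close> of an approximate gauge
  transformation \<open>T\<close> with inverse \<open>S\<close> lies in \<open>\<gg>\<close>, and replacing \<open>T\<close> by \<open>T ** mexp k\<close>, where
  \<open>k' + [Z, k] = - B\<close>, makes it quadratically small.\<close>

definition defect :: "complex^'n^'n \<Rightarrow> (complex \<Rightarrow> complex^'n^'n) \<Rightarrow> (complex \<Rightarrow> complex^'n^'n) \<Rightarrow>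
    complex \<Rightarrow> complex^'n^'n"
  where "defect f T S x = S x ** (mderiv T x + Z ** T x - T x ** Z + (1 / x) *\<^sub>C f ** T x)"

definition approximate_gauge ::
    "complex^'n^'n \<Rightarrow> real \<Rightarrow> real \<Rightarrow> real \<Rightarrow> (complex \<Rightarrow> complex^'n^'n) \<Rightarrow> (complex \<Rightarrow> complex^'n^'n) \<Rightarrow> bool"
  where "approximate_gauge f M \<beta> a T S \<longleftrightarrow>
    matrix_holomorphic_on T (domain M) \<and> matrix_holomorphic_on S (domain M) \<and>
    (\<forall>x\<in>domain M. T x \<in> G \<and> T x ** S x = mat 1 \<and> norm (defect f T S x) \<le> \<beta> / (norm x)\<^sup>2 \<and>
      norm (T x) \<le> a \<and> norm (S x) \<le> a)"

lemma domain_nonzero: "x \<in> domain M \<Longrightarrow> x \<noteq> 0"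
  by (auto simp: truncated_half_plane_def)

lemma defect_holomorphic:
  assumes "matrix_holomorphic_on T (domain M)" "matrix_holomorphic_on S (domain M)"
  shows "matrix_holomorphic_on (defect f T S) (domain M)"
  unfolding defect_def
  by (intro matrix_holomorphic_intros assms matrix_holomorphic_mderiv open_truncated_half_plane
      holomorphic_intros) (auto dest: domain_nonzero)

text \<open>The summand with \<open>mderiv T x\<close> is a tangent vector translated to 1, those
  with \<open>Z ** T x\<close> and \<open>f ** T x\<close> are conjugates of elements of the Lie
  algebra, and \<open>S x ** T x ** Z\<close> is just \<open>Z\<close>.\<close>

lemma defect_in_lie_algebra:
  assumes f: "f \<in> lie_algebra G" and T: "matrix_holomorphic_on T (domain M)"
    and TS: "\<And>y. y \<in> domain M \<Longrightarrow> T y \<in> G" "T x ** S x = mat 1" and x: "x \<in> domain M"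
  shows "defect f T S x \<in> lie_algebra G"
proof -
  have ST: "S x ** T x = mat 1" using TS(2) matrix_left_right_inverse by blast
  have S: "S x \<in> G" using TS x group_mem(4)[OF G] by blast
  have "S x ** mderiv T x \<in> lie_algebra G"
    by (rule lie_algebra_tangent[OF G open_truncated_half_plane x TS(1) hmd_mderiv[OF T open_truncated_half_plane x] TS(2)])
  moreover have "S x ** Z ** T x \<in> lie_algebra G" "S x ** f ** T x \<in> lie_algebra G"
    using lie_algebra_conj[OF G S ST] f Z by blast+
  ultimately have "S x ** mderiv T x + S x ** Z ** T x - Z + (1 / x) *\<^sub>C (S x ** f ** T x) \<in> lie_algebra G"
    by (intro lie_algebra_add lie_algebra_diff lie_algebra_cscale Z)
  also have "S x ** mderiv T x + S x ** Z ** T x - Z + (1 / x) *\<^sub>C (S x ** f ** T x) = defect f T S x"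
    by (simp add: defect_def matrix_ring_simps ST)
  finally show ?thesis .
qed

text \<open>The transformation law of the defect under a further gauge factor. The bracket has
  exactly the form estimated in \<open>dexp_estimate\<close>, with the old defect as
  \<open>B\<close>.\<close>

lemma defect_mul_mexp:
  assumes T: "matrix_holomorphic_on T (domain M)" and TS: "T x ** S x = mat 1"
    and k: "\<And>y. y \<in> domain M \<Longrightarrow> has_matrix_derivative k (k' y) y" "continuous_on (domain M) k'"
    and x: "x \<in> domain M"
  shows "defect f (\<lambda>y. T y ** mexp (k y)) (\<lambda>y. mexp (- k y) ** S y) x =
    mexp (- k x) ** (dexp (k x) (k' x) + Z ** mexp (k x) - mexp (k x) ** Z + defect f T S x ** mexp (k x))"
proof -
  have ST: "S x ** T x = mat 1" using TS matrix_left_right_inverse by blast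
  let ?E = "mexp (k x)"
  have hE: "has_matrix_derivative (\<lambda>y. mexp (k y)) (dexp (k x) (k' x)) x"
    by (rule hmd_mexp[OF open_truncated_half_plane x k])
  have hT: "has_matrix_derivative T (mderiv T x) x"
    by (rule hmd_mderiv[OF T open_truncated_half_plane x])
  have "matrix_holomorphic_on (\<lambda>y. T y ** mexp (k y)) (domain M)"
    by (intro matrix_holomorphic_intros T matrix_holomorphic_mexp open_truncated_half_plane
        hmd_imp_holomorphic[OF open_truncated_half_plane k(1)])
  from hmd_unique[OF hmd_mderiv[OF this open_truncated_half_plane x] hmd_mul[OF hT hE]]
  have "mderiv (\<lambda>y. T y ** mexp (k y)) x = mderiv T x ** ?E + T x ** dexp (k x) (k' x)" .
  then show ?thesis
    by (simp add: defect_def matrix_ring_simps matrix_mul_cancel[OF ST] ST algebra_simps)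
qed

text \<open>On the domain \<open>m \<le> norm x\<close>, so the correction \<open>k\<close> has norm
  at most \<open>solution_bound * \<beta> / m \<le> 1\<close>. This gives the growth factor for
  \<open>a\<close>, and \<open>mexp k\<close> differs from 1 by at most twice
  \<open>norm k\<close>.\<close>

lemma gauge_step:
  assumes f: "f \<in> lie_algebra G" and M: "0 < M" and m: "m = M / (1 + aperture)"
    and TS: "approximate_gauge f M \<beta> a T S"
    and \<beta>: "0 \<le> \<beta>" "24 * solution_bound * \<beta> \<le> m"
  obtains T1 S1 where
    "approximate_gauge f M (\<beta> / 2) (a * exp (solution_bound * \<beta> / m)) T1 S1"
    "\<And>x. x \<in> domain M \<Longrightarrow> norm (T1 x - T x) \<le> 2 * a * solution_bound * \<beta> / norm x"
    "\<And>x. x \<in> domain M \<Longrightarrow> norm (S1 x - S x) \<le> 2 * a * solution_bound * \<beta> / norm x"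
proof -
  let ?C = solution_bound
  note C = solution_bound_nonneg
  let ?B = "defect f T S"
  have T: "matrix_holomorphic_on T (domain M)" and S: "matrix_holomorphic_on S (domain M)"
    and TG: "\<And>x. x \<in> domain M \<Longrightarrow> T x \<in> G" and inv: "\<And>x. x \<in> domain M \<Longrightarrow> T x ** S x = mat 1"
    and B_le: "\<And>x. x \<in> domain M \<Longrightarrow> norm (?B x) \<le> \<beta> / (norm x)\<^sup>2"
    and T_le: "\<And>x. x \<in> domain M \<Longrightarrow> norm (T x) \<le> a" and S_le: "\<And>x. x \<in> domain M \<Longrightarrow> norm (S x) \<le> a"
    using TS unfolding approximate_gauge_def by blast+
  have B_hol: "matrix_holomorphic_on ?B (domain M)" by (rule defect_holomorphic[OF T S])
  obtain k where k: "\<And>x. x \<in> domain M \<Longrightarrow> has_matrix_derivative k (- ?B x - (Z ** k x - k x ** Z)) x"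
    "\<And>x. x \<in> domain M \<Longrightarrow> k x \<in> lie_algebra G"
    "\<And>x. x \<in> domain M \<Longrightarrow> norm (k x) \<le> ?C * \<beta> / norm x"
    using homological_equation[OF M B_hol defect_in_lie_algebra[OF f T TG inv] B_le] by blast
  let ?k' = "\<lambda>x. - ?B x - (Z ** k x - k x ** Z)"
  let ?T1 = "\<lambda>x. T x ** mexp (k x)"
  let ?S1 = "\<lambda>x. mexp (- k x) ** S x"
  have k_hol: "matrix_holomorphic_on k (domain M)"
    using k(1) by (rule hmd_imp_holomorphic[OF open_truncated_half_plane])
  have k'_cont: "continuous_on (domain M) ?k'"
    by (intro matrix_holomorphic_continuous matrix_holomorphic_intros B_hol k_hol)
  have m_pos: "0 < m" using M aperture(1) m by simp
  have m_le: "m \<le> norm x" if "x \<in> domain M" for x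
    using truncated_half_plane_norm_ge[OF aperture(1) that] m by simp
  have k_le_m: "norm (k x) \<le> ?C * \<beta> / m" if "x \<in> domain M" for x
    using k(3)[OF that] divide_left_mono[OF m_le[OF that], of "?C * \<beta>"] C \<beta> m_pos m_le[OF that]
    by (smt (verit) mult_nonneg_nonneg mult_pos_pos)
  have k_le_1: "norm (k x) \<le> 1" if "x \<in> domain M" for x
  proof -
    have "?C * \<beta> / m \<le> 1" using \<beta>(2) m_pos C \<beta>(1) mult_nonneg_nonneg[OF C \<beta>(1)] by simp
    with k_le_m[OF that] show ?thesis by linarith
  qed
  have a0: "0 \<le> a" if "x \<in> domain M" for x using T_le[OF that] norm_ge_zero order_trans by blast
  have diff_bound: "2 * b * norm (k x) \<le> 2 * a * ?C * \<beta> / norm x" if "0 \<le> b" "b \<le> a" "x \<in> domain M" for b x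
  proof -
    have "2 * b * norm (k x) \<le> 2 * a * (?C * \<beta> / norm x)"
      using that by (intro mult_mono k(3)) auto
    then show ?thesis by (simp add: mult.assoc)
  qed
  have exp_k: "exp (norm (k x)) \<le> exp (?C * \<beta> / m)" if "x \<in> domain M" for x
    using k_le_m[OF that] by simp
  show ?thesis
  proof
    show "norm (?T1 x - T x) \<le> 2 * a * ?C * \<beta> / norm x" if "x \<in> domain M" for x
      by (rule order_trans[OF norm_mexp_diff_le(1)[OF k_le_1] diff_bound]) (use that T_le in auto)
    show "norm (?S1 x - S x) \<le> 2 * a * ?C * \<beta> / norm x" if "x \<in> domain M" for x
      using norm_mexp_diff_le(2)[of "- k x" "S x"] k_le_1[OF that] diff_bound[OF norm_ge_zero S_le[OF that] that] by simp
    have "norm (defect f ?T1 ?S1 x) \<le> (\<beta> / 2) / (norm x)\<^sup>2" if x: "x \<in> domain M" for x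
    proof -
      let ?X = "dexp (k x) (?k' x) + Z ** mexp (k x) - mexp (k x) ** Z + ?B x ** mexp (k x)"
      have nx: "0 < norm x" using domain_nonzero[OF x] by simp
      \<comment> \<open>By the choice of \<open>k\<close> the linear part \<open>e\<close> in
        \<open>dexp_estimate\<close> is 0; only the quadratic remainder is left.\<close>
      have "norm ?X \<le> 2 * norm (?B x) * (exp (norm (k x)) - 1)"
        using dexp_estimate[of "k x" "?k' x" Z "?B x"] by (simp add: algebra_simps)
      also have "\<dots> \<le> 2 * norm (?B x) * (2 * norm (k x))"
        by (intro mult_left_mono exp_le_bounds k_le_1 x) auto
      finally have X: "norm ?X \<le> 4 * norm (?B x) * norm (k x)" by simp
      have "norm (defect f ?T1 ?S1 x) \<le> exp (norm (k x)) * norm ?X"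
      proof -
        have "defect f ?T1 ?S1 x = mexp (- k x) ** ?X"
          by (rule defect_mul_mexp[where T = T and S = S and k = k and k' = ?k', OF T inv[OF x] _ k'_cont x]) (rule k(1))
        then show ?thesis using norm_mexp_mul_le[of "- k x" ?X] by simp
      qed
      also have "\<dots> \<le> 3 * (4 * norm (?B x) * norm (k x))"
        by (intro mult_mono exp_le_bounds k_le_1 x X) auto
      also have "\<dots> = 12 * (norm (?B x) * norm (k x))" by simp
      also have "\<dots> \<le> 12 * (\<beta> / (norm x)\<^sup>2 * (?C * \<beta> / norm x))"
        by (intro mult_left_mono mult_mono B_le k x) (use \<beta> in auto)
      also have "\<dots> = (12 * ?C * \<beta> / norm x) * (\<beta> / (norm x)\<^sup>2)" by (simp add: mult_ac)
      \<comment> \<open>Origin of the constant 24: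
        \<open>24 * solution_bound * \<beta> \<le> m \<le> norm x\<close> converts the quadratic
        gain into a factor 1/2.\<close>
      also have "\<dots> \<le> (1 / 2) * (\<beta> / (norm x)\<^sup>2)"
      proof (rule mult_right_mono)
        show "12 * ?C * \<beta> / norm x \<le> 1 / 2"
          using \<beta>(2) m_le[OF x] nx by (simp add: divide_le_eq)
      qed (use \<beta> in simp)
      finally show ?thesis by simp
    qed
    moreover have "?T1 x \<in> G" if "x \<in> domain M" for x
      by (intro group_mem(2)[OF G] mexp_in_group[OF G] TG k(2) that)
    moreover have "?T1 x ** ?S1 x = mat 1" if "x \<in> domain M" for x
      using matrix_mul_cancel(1)[OF mexp_mul_minus[of "k x"], of "T x"] inv[OF that] by (simp add: matrix_mul_assoc)
    moreover have "norm (?T1 x) \<le> a * exp (?C * \<beta> / m)" if "x \<in> domain M" for x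
      by (rule order_trans[OF norm_mul_mexp_le]) (intro mult_mono T_le exp_k a0[OF that] that, auto)
    moreover have "norm (?S1 x) \<le> a * exp (?C * \<beta> / m)" if "x \<in> domain M" for x
    proof -
      have "norm (?S1 x) \<le> norm (S x) * exp (norm (k x))"
        using norm_mexp_mul_le[of "- k x" "S x"] by (simp add: mult.commute)
      also have "\<dots> \<le> a * exp (?C * \<beta> / m)" by (intro mult_mono S_le exp_k a0[OF that] that) auto
      finally show ?thesis .
    qed
    ultimately show "approximate_gauge f M (\<beta> / 2) (a * exp (?C * \<beta> / m)) ?T1 ?S1"
      unfolding approximate_gauge_def
      by (intro conjI ballI matrix_holomorphic_intros T S matrix_holomorphic_mexp open_truncated_half_plane k_hol)
        simp_all
  qed
qed

section \<open>Starting value and limit of the iteration\<close>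

lemma bracket_space_preimage:
  assumes "f \<in> bracket_space Z (lie_algebra G)"
  obtains \<phi> where "\<phi> \<in> lie_algebra G" "Z ** \<phi> - \<phi> ** Z = - f"
proof -
  let ?S = "(\<lambda>\<phi>. - (Z ** \<phi> - \<phi> ** Z)) ` lie_algebra G"
  have "cmat.subspace ?S"
    unfolding cmat.subspace_def
  proof (intro conjI ballI allI)
    show "0 \<in> ?S" by (rule image_eqI[of _ _ 0]) (simp_all add: lie_algebra_zero)
    fix X assume "X \<in> ?S"
    then obtain A where A: "A \<in> lie_algebra G" "X = - (Z ** A - A ** Z)" by blast
    show "c *\<^sub>C X \<in> ?S" for c
      by (rule image_eqI[of _ _ "c *\<^sub>C A"]) (simp_all add: A matrix_ring_simps cscale_simps lie_algebra_cscale)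
    fix Y assume "Y \<in> ?S"
    then obtain B where B: "B \<in> lie_algebra G" "Y = - (Z ** B - B ** Z)" by blast
    show "X + Y \<in> ?S"
      by (rule image_eqI[of _ _ "A + B"]) (simp_all add: A B matrix_ring_simps lie_algebra_add)
  qed
  moreover have "ad_eigenspace Z (lie_algebra G) \<zeta> \<subseteq> ?S" if "\<zeta> \<noteq> 0" for \<zeta>
  proof
    fix X assume "X \<in> ad_eigenspace Z (lie_algebra G) \<zeta>"
    then have X: "X \<in> lie_algebra G" "Z ** X - X ** Z = \<zeta> *\<^sub>C X"
      by (auto simp: ad_eigenspace_def commutator_def)
    have "Z ** ((- 1 / \<zeta>) *\<^sub>C X) - ((- 1 / \<zeta>) *\<^sub>C X) ** Z = (- 1 / \<zeta>) *\<^sub>C (Z ** X - X ** Z)"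
      by (simp add: matrix_ring_simps cscale_simps)
    also have "\<dots> = - X" using that unfolding X(2) by (simp add: cscale_simps vec_eq_iff)
    finally show "X \<in> ?S"
      by (intro image_eqI[of _ _ "(- 1 / \<zeta>) *\<^sub>C X"] lie_algebra_cscale X) simp
  qed
  ultimately have "bracket_space Z (lie_algebra G) \<subseteq> ?S"
    unfolding bracket_space_def by (intro cmat.span_minimal) auto
  with assms obtain \<phi> where "\<phi> \<in> lie_algebra G" "f = - (Z ** \<phi> - \<phi> ** Z)" by blast
  then show ?thesis by (intro that[of \<phi>]) simp_all
qed

text \<open>The constant gauge \<open>mat 1\<close> has defect \<open>f / x\<close>, and the choice
  \<open>k = \<phi> / x\<close> makes \<open>[Z, k]\<close> cancel it. What survives in
  \<open>dexp_estimate\<close> is \<open>k'\<close>, of order \<open>1 / x\<^sup>2\<close>, and a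
  product of norms of \<open>f / x\<close> and \<open>\<phi> / x\<close>. The numbers come from
  \<open>exp t \<le> 3\<close> and \<open>exp t - 1 \<le> 2 * t\<close> for t between 0 and
  1.\<close>

lemma initial_gauge:
  assumes \<phi>: "\<phi> \<in> lie_algebra G" "Z ** \<phi> - \<phi> ** Z = - f" and m: "norm \<phi> \<le> m" "0 < m"
    and M: "M = m * (1 + aperture)"
  defines "T \<equiv> \<lambda>x. mexp ((1 / x) *\<^sub>C \<phi>)" and "S \<equiv> \<lambda>x. mexp (- ((1 / x) *\<^sub>C \<phi>))"
  shows "approximate_gauge f M (9 * norm \<phi> + 12 * norm f * norm \<phi>) (norm (mat 1 :: complex^'n^'n) + 2) T S"
    and "\<And>x. x \<in> domain M \<Longrightarrow> norm (T x - mat 1) \<le> 2 * norm \<phi> / norm x"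
proof -
  let ?k = "\<lambda>x. (1 / x) *\<^sub>C \<phi>"
  let ?k' = "\<lambda>x. (- 1 / x\<^sup>2) *\<^sub>C \<phi>"
  have m_le: "m \<le> norm x" if "x \<in> domain M" for x
    using truncated_half_plane_norm_ge[OF aperture(1) that] aperture(1) by (simp add: M)
  have norm_k: "norm (?k x) = norm \<phi> / norm x" for x
    by (simp add: norm_cscale norm_divide)
  have k_le_1: "norm (?k x) \<le> 1" if "x \<in> domain M" for x
    using m_le[OF that] m unfolding norm_k by (simp add: divide_le_eq)
  have k: "has_matrix_derivative ?k (?k' x) x" if "x \<in> domain M" for x
  proof -
    have "((\<lambda>x. 1 / x) has_field_derivative - 1 / x\<^sup>2) (at x)"
      using domain_nonzero[OF that] by (auto intro!: derivative_eq_intros simp: power2_eq_square)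
    from hmd_cscale[OF this hmd_const, of \<phi>] show ?thesis by (simp add: cscale_simps)
  qed
  have k_hol: "matrix_holomorphic_on ?k (domain M)"
    by (intro matrix_holomorphic_intros holomorphic_intros) (auto dest: domain_nonzero)
  have k'_cont: "continuous_on (domain M) ?k'"
    by (intro matrix_holomorphic_continuous matrix_holomorphic_intros holomorphic_intros) (auto dest: domain_nonzero)
  show T1: "norm (T x - mat 1) \<le> 2 * norm \<phi> / norm x" if "x \<in> domain M" for x
    using order_trans[OF norm_mexp_minus_one_le exp_le_bounds(2)[OF norm_ge_zero k_le_1[OF that]]]
    unfolding T_def by (simp add: norm_k)
  have bound: "norm (mexp A) \<le> norm (mat 1 :: complex^'n^'n) + 2" if "norm A \<le> 1" for A :: "complex^'n^'n"
    using norm_triangle_ineq[of "mat 1" "mexp A - mat 1"] norm_mexp_minus_one_le[of A]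
      exp_le_bounds(1)[of "norm A"] that by simp
  have "norm (defect f T S x) \<le> (9 * norm \<phi> + 12 * norm f * norm \<phi>) / (norm x)\<^sup>2" if x: "x \<in> domain M" for x
  proof -
    let ?B = "(1 / x) *\<^sub>C f"
    let ?X = "dexp (?k x) (?k' x) + Z ** mexp (?k x) - mexp (?k x) ** Z + ?B ** mexp (?k x)"
    have nx: "norm x > 0" using domain_nonzero[OF x] by simp
    have "mderiv (\<lambda>x. mat 1 :: complex^'n^'n) x = 0"
      by (simp add: mderiv_def vec_eq_iff)
    then have B: "defect f (\<lambda>x. mat 1) (\<lambda>x. mat 1) x = ?B"
      by (simp add: defect_def)
    have "defect f (\<lambda>x. mat 1 ** mexp (?k x)) (\<lambda>x. mexp (- ?k x) ** mat 1) x =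
        mexp (- ?k x) ** (dexp (?k x) (?k' x) + Z ** mexp (?k x) - mexp (?k x) ** Z +
          defect f (\<lambda>x. mat 1) (\<lambda>x. mat 1) x ** mexp (?k x))"
      by (rule defect_mul_mexp[where k' = ?k', OF matrix_holomorphic_intros(1) _ _ k'_cont x])
        (simp, rule k)
    then have d: "defect f T S x = mexp (- ?k x) ** ?X"
      unfolding B by (simp add: T_def S_def)
    have "?k' x + Z ** ?k x - ?k x ** Z + ?B = ?k' x + (1 / x) *\<^sub>C (Z ** \<phi> - \<phi> ** Z) + ?B"
      by (simp add: matrix_ring_simps cscale_simps)
    also have "\<dots> = ?k' x" unfolding \<phi>(2) by (simp add: cscale_simps)
    finally have e: "?k' x + Z ** ?k x - ?k x ** Z + ?B = ?k' x" .
    have "norm ?X \<le> norm (?k' x) * exp (norm (?k x)) + 2 * norm ?B * (exp (norm (?k x)) - 1)"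
      using dexp_estimate[of "?k x" "?k' x" Z ?B] unfolding e .
    also have "\<dots> \<le> norm (?k' x) * 3 + 2 * norm ?B * (2 * norm (?k x))"
      by (intro add_mono mult_left_mono exp_le_bounds k_le_1 x) auto
    also have "\<dots> = (3 * norm \<phi> + 4 * norm f * norm \<phi>) / (norm x)\<^sup>2"
      using nx by (simp add: norm_cscale norm_divide norm_power norm_mult power2_eq_square add_divide_distrib mult_ac)
    finally have X: "norm ?X \<le> (3 * norm \<phi> + 4 * norm f * norm \<phi>) / (norm x)\<^sup>2" .
    have "norm (defect f T S x) \<le> exp (norm (?k x)) * norm ?X"
      unfolding d using norm_mexp_mul_le[of "- ?k x" ?X] by simp
    also have "\<dots> \<le> 3 * ((3 * norm \<phi> + 4 * norm f * norm \<phi>) / (norm x)\<^sup>2)"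
      by (intro mult_mono exp_le_bounds k_le_1 x X) auto
    also have "\<dots> = (9 * norm \<phi> + 12 * norm f * norm \<phi>) / (norm x)\<^sup>2"
      by (simp add: algebra_simps)
    finally show ?thesis .
  qed
  moreover have "T x \<in> G" for x
    unfolding T_def by (intro mexp_in_group[OF G] lie_algebra_cscale \<phi>)
  moreover have "norm (S x) \<le> norm (mat 1 :: complex^'n^'n) + 2" if "x \<in> domain M" for x
    unfolding S_def by (rule bound) (use k_le_1[OF that] in simp)
  ultimately show "approximate_gauge f M (9 * norm \<phi> + 12 * norm f * norm \<phi>)
      (norm (mat 1 :: complex^'n^'n) + 2) T S"
    unfolding approximate_gauge_def
  proof (intro conjI ballI)
    show "matrix_holomorphic_on T (domain M)" "matrix_holomorphic_on S (domain M)"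
      unfolding T_def S_def
      by (intro matrix_holomorphic_mexp open_truncated_half_plane matrix_holomorphic_intros(5) k_hol)+
    fix x assume x: "x \<in> domain M"
    show "T x ** S x = mat 1" unfolding T_def S_def by (rule mexp_mul_minus)
    show "norm (T x) \<le> norm (mat 1 :: complex^'n^'n) + 2" unfolding T_def by (rule bound[OF k_le_1[OF x]])
  qed
qed

theorem gauge_exists:
  assumes f: "f \<in> bracket_space Z (lie_algebra G)"
  obtains M T K where "0 < M" "\<And>x. x \<in> domain M \<Longrightarrow> T x \<in> G"
    "\<And>x. x \<in> domain M \<Longrightarrow>
      has_matrix_derivative T (T x ** Z - Z ** T x - (1 / x) *\<^sub>C f ** T x) x"
    "\<And>x. x \<in> domain M \<Longrightarrow> norm (T x - mat 1) \<le> K / norm x"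
proof -
  obtain \<phi> where \<phi>: "\<phi> \<in> lie_algebra G" "Z ** \<phi> - \<phi> ** Z = - f"
    using bracket_space_preimage[OF f] .
  have f_lie: "f \<in> lie_algebra G"
    using lie_algebra_minus[OF lie_algebra_commutator[OF G Z \<phi>(1)]] \<phi>(2) by simp
  let ?C = solution_bound
  define \<beta> where "\<beta> = 9 * norm \<phi> + 12 * norm f * norm \<phi>"
  define a where "a = norm (mat 1 :: complex^'n^'n) + 2"
  \<comment> \<open>A common lower bound for \<open>norm x\<close> on \<open>domain M\<close>: the
    summand 1 makes it positive, \<open>norm \<phi>\<close> gives
    \<open>norm (\<phi> / x) \<le> 1\<close>, and the last summand is the smallness condition of
    \<open>gauge_step\<close>.\<close>
  define m where "m = 1 + norm \<phi> + 24 * ?C * \<beta>"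
  define M where "M = m * (1 + aperture)"
  define c where "c = ?C * \<beta> / m"
  have \<beta>0: "0 \<le> \<beta>" by (simp add: \<beta>_def)
  have C\<beta>: "0 \<le> ?C * \<beta>" by (rule mult_nonneg_nonneg[OF solution_bound_nonneg \<beta>0])
  have "0 \<le> 24 * ?C * \<beta>" using C\<beta> by (simp add: mult.assoc)
  then have m: "norm \<phi> \<le> m" "0 < m" "24 * ?C * \<beta> \<le> m"
    unfolding m_def using norm_ge_zero[of \<phi>] by linarith+
  have M: "0 < M" "m = M / (1 + aperture)" using m aperture(1) by (auto simp: M_def)
  have a: "0 \<le> a" by (simp add: a_def)
  have c: "0 \<le> c" "2 * c \<le> 1" using C\<beta> m by (auto simp: c_def divide_le_eq)
  \<comment> \<open>The product of the first \<open>n\<close> growth factors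
    \<open>exp (c / 2 ^ i)\<close>; it stays below \<open>3 * a\<close> because
    \<open>2 * c \<le> 1\<close>.\<close>
  define b where "b n = a * exp (2 * c * (1 - 1 / 2 ^ n))" for n :: nat
  have b: "0 \<le> b n" "b n \<le> 3 * a" "b n * exp (?C * (\<beta> / 2 ^ n) / m) = b (Suc n)" for n
  proof -
    have "2 * c * (1 - 1 / 2 ^ n) \<le> 2 * c" using c by (simp add: mult_left_le)
    then have "exp (2 * c * (1 - 1 / 2 ^ n)) \<le> exp (2 * c)" by simp
    also have "\<dots> \<le> 3" using c by (intro exp_le_bounds) auto
    finally have "a * exp (2 * c * (1 - 1 / 2 ^ n)) \<le> a * 3" using a by (rule mult_left_mono)
    then show "b n \<le> 3 * a" by (simp only: b_def mult.commute)
    show "0 \<le> b n" using a by (simp add: b_def)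
    have "?C * (\<beta> / 2 ^ n) / m = c / 2 ^ n" by (simp add: c_def)
    then have "2 * c * (1 - 1 / 2 ^ n) + ?C * (\<beta> / 2 ^ n) / m = 2 * c * (1 - 1 / 2 ^ Suc n)"
      by (simp add: right_diff_distrib)
    then show "b n * exp (?C * (\<beta> / 2 ^ n) / m) = b (Suc n)"
      unfolding b_def by (simp only: mult.assoc exp_add[symmetric])
  qed
  define T0 where "T0 = (\<lambda>x. mexp ((1 / x) *\<^sub>C \<phi>))"
  define S0 where "S0 = (\<lambda>x. mexp (- ((1 / x) *\<^sub>C \<phi>)))"
  have init: "approximate_gauge f M \<beta> a T0 S0"
    "\<And>x. x \<in> domain M \<Longrightarrow> norm (T0 x - mat 1) \<le> 2 * norm \<phi> / norm x"
    using initial_gauge[OF \<phi> m(1,2) M_def] unfolding T0_def S0_def \<beta>_def a_def by blast+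
  let ?K = "6 * a * ?C * \<beta>"
  let ?step = "\<lambda>n T T' :: complex \<Rightarrow> complex^'n^'n. \<forall>x\<in>domain M. norm (T' x - T x) \<le> (?K / norm x) / 2 ^ n"
  \<comment> \<open>The clause for \<open>n = 0\<close> pins the sequence to the explicit starting
    value, which is later used to compare the limit with \<open>mat 1\<close>.\<close>
  let ?P = "\<lambda>n (T, S). approximate_gauge f M (\<beta> / 2 ^ n) (b n) T S \<and> (n = 0 \<longrightarrow> T = T0)"
  let ?R = "\<lambda>n (T, S) (T', S'). ?step n T T' \<and> ?step n S S'"
  have "\<exists>F. \<forall>n. ?P n (F n) \<and> ?R n (F n) (F (Suc n))"
  proof (rule dependent_nat_choice)
    show "\<exists>X. ?P 0 X" using init(1) by (intro exI[of _ "(T0, S0)"]) (simp add: b_def)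
    fix X n assume "?P n X"
    then obtain T S where X: "X = (T, S)" and TS: "approximate_gauge f M (\<beta> / 2 ^ n) (b n) T S"
      by (cases X) auto
    have "24 * ?C * (\<beta> / 2 ^ n) \<le> 24 * ?C * \<beta>"
      using mult_left_mono[OF one_le_power[of "2::real" n] \<beta>0] solution_bound_nonneg
      by (intro mult_left_mono) (simp_all add: divide_le_eq)
    then have le: "24 * ?C * (\<beta> / 2 ^ n) \<le> m" using m(3) by linarith
    obtain T1 S1 where 1: "approximate_gauge f M (\<beta> / 2 ^ n / 2) (b n * exp (?C * (\<beta> / 2 ^ n) / m)) T1 S1"
      "\<And>x. x \<in> domain M \<Longrightarrow> norm (T1 x - T x) \<le> 2 * b n * ?C * (\<beta> / 2 ^ n) / norm x"
      "\<And>x. x \<in> domain M \<Longrightarrow> norm (S1 x - S x) \<le> 2 * b n * ?C * (\<beta> / 2 ^ n) / norm x"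
      using gauge_step[OF f_lie M TS _ le] \<beta>0 by (metis divide_nonneg_nonneg zero_le_numeral zero_le_power)
    have le': "2 * b n * ?C * (\<beta> / 2 ^ n) / norm x \<le> (?K / norm x) / 2 ^ n" for x :: complex
    proof -
      have "2 * b n * (?C * \<beta>) \<le> 6 * a * (?C * \<beta>)"
        using b(2)[of n] by (intro mult_right_mono C\<beta>) simp
      then have "(2 * b n * (?C * \<beta>)) / (2 ^ n * norm x) \<le> (6 * a * (?C * \<beta>)) / (2 ^ n * norm x)"
        by (intro divide_right_mono) auto
      then show ?thesis by (simp add: mult_ac)
    qed
    show "\<exists>Y. ?P (Suc n) Y \<and> ?R n X Y"
      using 1(1) order_trans[OF 1(2) le'] order_trans[OF 1(3) le'] unfolding b(3) X
      by (intro exI[of _ "(T1, S1)"]) (simp add: mult.commute)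
  qed
  then obtain F where F: "\<forall>n. ?P n (F n) \<and> ?R n (F n) (F (Suc n))" ..
  define T where "T n = fst (F n)" for n
  define S where "S n = snd (F n)" for n
  have TS: "approximate_gauge f M (\<beta> / 2 ^ n) (b n) (T n) (S n)" "?step n (T n) (T (Suc n))" "?step n (S n) (S (Suc n))" for n
    using spec[OF F, of n] unfolding T_def S_def by (auto simp: case_prod_unfold)
  have T_0: "T 0 = T0" using spec[OF F, of 0] unfolding T_def by (auto simp: case_prod_unfold)
  have hol: "matrix_holomorphic_on (T n) (domain M)" and TG: "\<And>x. x \<in> domain M \<Longrightarrow> T n x \<in> G"
    and inv: "\<And>x. x \<in> domain M \<Longrightarrow> T n x ** S n x = mat 1"
    and d_le: "\<And>x. x \<in> domain M \<Longrightarrow> norm (defect f (T n) (S n) x) \<le> \<beta> / 2 ^ n / (norm x)\<^sup>2"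
    and T_le: "\<And>x. x \<in> domain M \<Longrightarrow> norm (T n x) \<le> 3 * a" for n
    using TS(1)[of n] b(2)[of n] unfolding approximate_gauge_def by (blast intro: order_trans)+
  have m_le: "m \<le> norm x" if "x \<in> domain M" for x
    using truncated_half_plane_norm_ge[OF aperture(1) that] M by simp
  have K0: "0 \<le> ?K" using mult_nonneg_nonneg[OF a C\<beta>] by (simp add: mult.assoc)
  have K_le: "?K / norm x \<le> ?K / m" if "x \<in> domain M" for x
    using m_le[OF that] m(2) K0 domain_nonzero[OF that] by (intro divide_left_mono) auto
  obtain L where L: "uniform_limit (domain M) T L sequentially"
    "\<And>x. x \<in> domain M \<Longrightarrow> (\<lambda>n. T n x) \<longlonglongrightarrow> L x"
    "\<And>x. x \<in> domain M \<Longrightarrow> norm (L x - T 0 x) \<le> 2 * (?K / norm x)"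
    by (rule uniform_limit_geometric[of "domain M" T "\<lambda>x. ?K / norm x" "?K / m"]) (use TS(2) K_le in auto)
  \<comment> \<open>Vanishing polynomials pass to the limit, but invertibility does not by itself;
    the limit of the inverses provides it.\<close>
  obtain L' where L': "\<And>x. x \<in> domain M \<Longrightarrow> (\<lambda>n. S n x) \<longlonglongrightarrow> L' x"
    by (rule uniform_limit_geometric[of "domain M" S "\<lambda>x. ?K / norm x" "?K / m"]) (use TS(3) K_le in auto)
  show ?thesis
  proof
    show "0 < M" by (rule M)
    fix x assume x: "x \<in> domain M"
    have "(\<lambda>n. T n x ** S n x) \<longlonglongrightarrow> L x ** L' x" by (rule tendsto_matrix_mul[OF L(2) L'[OF x]]) (rule x)
    then have "(\<lambda>n. mat 1) \<longlonglongrightarrow> L x ** L' x" by (simp add: inv[OF x])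
    then have "L x ** L' x = mat 1" using LIMSEQ_unique tendsto_const by blast
    moreover have "p (L x) = 0" if p: "vanishing G p" for p
    proof -
      have "isCont p (L x)"
        using has_derivative_continuous[OF has_derivative_pdiff] p by (auto simp: vanishing_def)
      then have "(\<lambda>n. p (T n x)) \<longlonglongrightarrow> p (L x)" by (rule isCont_tendsto_compose) (rule L(2)[OF x])
      moreover have "p (T n x) = 0" for n using p TG[OF x] by (simp add: vanishing_def)
      ultimately show ?thesis by (simp add: LIMSEQ_const_iff)
    qed
    ultimately show "L x \<in> G" using group_iff[OF G] invertibleI by blast
    have "norm (L x - mat 1) \<le> norm (L x - T 0 x) + norm (T 0 x - mat 1)"
      using norm_triangle_ineq[of "L x - T 0 x" "T 0 x - mat 1"] by simp
    also have "\<dots> \<le> 2 * (?K / norm x) + 2 * norm \<phi> / norm x"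
      using L(3)[OF x] init(2)[OF x] unfolding T_0 by (rule add_mono)
    also have "\<dots> = (2 * ?K + 2 * norm \<phi>) / norm x" by (simp add: add_divide_distrib)
    finally show "norm (L x - mat 1) \<le> (2 * ?K + 2 * norm \<phi>) / norm x" .
    show "has_matrix_derivative L (L x ** Z - Z ** L x - (1 / x) *\<^sub>C f ** L x) x"
    proof (rule hmd_uniform_limit[where T' = "\<lambda>n. mderiv (T n)", OF open_truncated_half_plane _ L(1) _ x])
      show "has_matrix_derivative (T n) (mderiv (T n) y) y" if "y \<in> domain M" for n y
        using hmd_mderiv[OF hol open_truncated_half_plane that] .
      fix y assume y: "y \<in> domain M"
      let ?d = "\<lambda>n. defect f (T n) (S n) y"
      \<comment> \<open>The definition of the defect solved for the derivative: the equation holds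
        up to \<open>T n y ** ?d n\<close>, which tends to 0.\<close>
      have eq: "mderiv (T n) y = T n y ** ?d n + (T n y ** Z - Z ** T n y - (1 / y) *\<^sub>C f ** T n y)" for n
        by (simp add: defect_def matrix_ring_simps inv[OF y] algebra_simps)
      have "(\<lambda>n. T n y ** ?d n) \<longlonglongrightarrow> 0"
      proof (rule Lim_null_comparison)
        show "\<forall>\<^sub>F n in sequentially. norm (T n y ** ?d n) \<le> 3 * a * (\<beta> / 2 ^ n / (norm y)\<^sup>2)"
          using a by (intro always_eventually allI order_trans[OF norm_matrix_mul_le] mult_mono T_le d_le y) auto
        have "(\<lambda>n. 3 * a * (\<beta> / 2 ^ n / (norm y)\<^sup>2)) \<longlonglongrightarrow> 3 * a * (0 / (norm y)\<^sup>2)"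
          using LIMSEQ_divide_realpow_zero[of 2 \<beta>] domain_nonzero[OF y] by (intro tendsto_intros) auto
        then show "(\<lambda>n. 3 * a * (\<beta> / 2 ^ n / (norm y)\<^sup>2)) \<longlonglongrightarrow> 0" by simp
      qed
      then have "(\<lambda>n. T n y ** ?d n + (T n y ** Z - Z ** T n y - (1 / y) *\<^sub>C f ** T n y)) \<longlonglongrightarrow>
          0 + (L y ** Z - Z ** L y - (1 / y) *\<^sub>C f ** L y)"
        by (intro tendsto_add tendsto_diff tendsto_matrix_mul tendsto_const L(2) y)
      then show "(\<lambda>n. mderiv (T n) y) \<longlonglongrightarrow> L y ** Z - Z ** L y - (1 / y) *\<^sub>C f ** L y"
        by (simp only: eq add_0_left)
    qed
  qed
qed

end

section \<open>Linear equations on convex domains\<close>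

lemma hmd_zero_const_connected:
  assumes "connected S" "open S" "\<And>x. x \<in> S \<Longrightarrow> has_matrix_derivative A 0 x"
  obtains c where "\<And>x. x \<in> S \<Longrightarrow> A x = c"
proof -
  have "\<exists>c. \<forall>x\<in>S. A x $ i $ j = c" for i j
  proof -
    have der: "((\<lambda>x. A x $ i $ j) has_field_derivative 0) (at x)" if "x \<in> S" for x
      using hmdD[OF assms(3)[OF that], of i j] by simp
    obtain c where "\<And>x. x \<in> S \<Longrightarrow> A x $ i $ j = c"
    proof (rule DERIV_zero_connected_constant[of S "{}" "\<lambda>x. A x $ i $ j"])
      show "continuous_on S (\<lambda>x. A x $ i $ j)"
        by (rule DERIV_continuous_on, rule has_field_derivative_at_within, rule der)
    qed (use assms der in auto)
    then show ?thesis by blast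
  qed
  then obtain c where c: "\<And>i j x. x \<in> S \<Longrightarrow> A x $ i $ j = c i j" by metis
  show ?thesis by (rule that[of "\<chi> i j. c i j"]) (simp add: vec_eq_iff c)
qed

lemma matrix_primitive:
  assumes "convex W" "open W" "matrix_holomorphic_on F W"
  obtains U where "\<And>x. x \<in> W \<Longrightarrow> has_matrix_derivative U (F x) x" "U x0 = 0"
proof -
  have "\<exists>g. \<forall>x\<in>W. (g has_field_derivative F x $ i $ j) (at x)" for i j
  proof -
    have hol: "(\<lambda>x. F x $ i $ j) holomorphic_on W"
      using assms(3) by (simp add: matrix_holomorphic_on_def)
    obtain g where g: "\<And>x. x \<in> W \<Longrightarrow> (g has_field_derivative F x $ i $ j) (at x within W)"
      using holomorphic_convex_primitive'[OF assms(1,2) hol] by blast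
    have "(g has_field_derivative F x $ i $ j) (at x)" if "x \<in> W" for x
      using g[OF that] at_within_open[OF that assms(2)] by simp
    then show ?thesis by blast
  qed
  then have "\<forall>i j. \<exists>g. \<forall>x\<in>W. (g has_field_derivative F x $ i $ j) (at x)" by simp
  then obtain g where g: "\<forall>i j. \<forall>x\<in>W. (g i j has_field_derivative F x $ i $ j) (at x)"
    unfolding choice_iff by (elim exE)
  let ?U = "\<lambda>x. \<chi> i j. g i j x - g i j x0"
  show ?thesis
  proof (rule that[of ?U])
    show "?U x0 = 0" by (simp add: vec_eq_iff)
    fix x assume "x \<in> W"
    show "has_matrix_derivative ?U (F x) x"
    proof (rule hmdI)
      fix i j
      have "(g i j has_field_derivative F x $ i $ j) (at x)" using g \<open>x \<in> W\<close> by simp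
      from DERIV_diff[OF this DERIV_const[of "g i j x0"]]
      show "((\<lambda>x. ?U x $ i $ j) has_field_derivative F x $ i $ j) (at x)" by simp
    qed
  qed
qed

text \<open>Picard iteration as a series: \<open>U (Suc n)\<close> is the primitive of
  \<open>A ** U n\<close> that vanishes at \<open>x0\<close>, and \<open>Y\<close> is the sum of the
  \<open>U n\<close>. Induction along segments from \<open>x0\<close> gives the factorial bound that
  makes the series converge locally uniformly.\<close>

lemma linear_ode_exists:
  fixes A :: "complex \<Rightarrow> complex^'n^'n"
  assumes W: "convex W" "open W" "x0 \<in> W" and A: "matrix_holomorphic_on A W"
  obtains Y where "\<And>x. x \<in> W \<Longrightarrow> has_matrix_derivative Y (A x ** Y x) x" "Y x0 = C"
proof -
  define prim where "prim F = (SOME U. (\<forall>x\<in>W. has_matrix_derivative U (F x) x) \<and> U x0 = 0)"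
    for F :: "complex \<Rightarrow> complex^'n^'n"
  have prim: "(\<forall>x\<in>W. has_matrix_derivative (prim F) (F x) x) \<and> prim F x0 = 0"
    if F: "matrix_holomorphic_on F W" for F
  proof -
    obtain U where U: "\<And>x. x \<in> W \<Longrightarrow> has_matrix_derivative U (F x) x" "U x0 = 0"
      using matrix_primitive[OF W(1,2) F, of x0] by blast
    show ?thesis unfolding prim_def by (rule someI[of _ U]) (simp add: U)
  qed
  define U where "U = rec_nat (\<lambda>x. C) (\<lambda>n V. prim (\<lambda>x. A x ** V x))"
  have U_simps: "U 0 = (\<lambda>x. C)" "U (Suc n) = prim (\<lambda>x. A x ** U n x)" for n
    by (simp_all add: U_def)
  have hol: "matrix_holomorphic_on (U n) W" for n
  proof (induction n)
    case (Suc n)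
    have "matrix_holomorphic_on (\<lambda>x. A x ** U n x) W" by (intro matrix_holomorphic_intros A Suc)
    from prim[OF this] show ?case
      unfolding U_simps by (intro hmd_imp_holomorphic[OF W(2)]) blast
  qed (simp add: U_simps matrix_holomorphic_intros)
  have der: "has_matrix_derivative (U (Suc n)) (A x ** U n x) x" if "x \<in> W" for n x
    using prim[of "\<lambda>x. A x ** U n x"] that unfolding U_simps by (simp add: matrix_holomorphic_intros A hol)
  have U_x0: "U (Suc n) x0 = 0" for n
    using prim[of "\<lambda>x. A x ** U n x"] unfolding U_simps by (simp add: matrix_holomorphic_intros A hol)
  have bound: "norm (U n x) \<le> norm C * ((a * norm (x - x0)) ^ n / fact n)"
    if K: "convex K" "x0 \<in> K" "K \<subseteq> W" "\<And>y. y \<in> K \<Longrightarrow> norm (A y) \<le> a" and x: "x \<in> K" for K a n x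
    using x
  proof (induction n arbitrary: x)
    case (Suc n)
    let ?v = "x - x0"
    let ?y = "\<lambda>s. x0 + of_real s * ?v"
    let ?\<phi> = "\<lambda>s. norm C * ((a * norm ?v * s) ^ Suc n / fact (Suc n))"
    let ?\<phi>' = "\<lambda>s. norm C * (a * norm ?v) * ((a * norm ?v * s) ^ n / fact n)"
    have a: "0 \<le> a" using K(4)[OF K(2)] norm_ge_zero order_trans by blast
    have y: "?y s \<in> K" if "0 \<le> s" "s \<le> 1" for s
      using convexD_alt[OF K(1,2) Suc.prems that] by (simp add: scaleR_conv_of_real algebra_simps)
    have d: "((\<lambda>s. U (Suc n) (?y s)) has_vector_derivative ?v *\<^sub>C (A (?y s) ** U n (?y s))) (at s within S)"
      if "0 \<le> s" "s \<le> 1" for s S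
      by (rule hmd_along_line[OF der]) (use y[OF that] K(3) in blast)
    have d\<phi>: "(?\<phi> has_vector_derivative ?\<phi>' s) (at s within S)" for s S
    proof -
      have "((\<lambda>s. (a * norm ?v * s) ^ Suc n) has_real_derivative
          (real (Suc n) * (a * norm ?v * s) ^ n * (a * norm ?v))) (at s within S)"
        by (auto intro!: derivative_eq_intros simp del: power_Suc)
      from DERIV_cmult[OF DERIV_cdivide[OF this, of "fact (Suc n)"], of "norm C"]
      show ?thesis
        unfolding has_real_derivative_iff_has_vector_derivative[symmetric]
        by (rule DERIV_cong) (simp add: divide_simps del: of_nat_Suc)
    qed
    have "norm (U (Suc n) (?y 1) - U (Suc n) (?y 0)) \<le> ?\<phi> 1 - ?\<phi> 0"
    proof (rule differentiable_bound_general[where f' = "\<lambda>s. ?v *\<^sub>C (A (?y s) ** U n (?y s))" and \<phi>' = ?\<phi>'])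
      show "continuous_on {0..1} (\<lambda>s. U (Suc n) (?y s))"
        by (rule continuous_on_vector_derivative) (rule d, auto)
      show "continuous_on {0..1} ?\<phi>"
        by (rule continuous_on_vector_derivative) (rule d\<phi>)
      fix s :: real assume s: "0 < s" "s < 1"
      show "((\<lambda>s. U (Suc n) (?y s)) has_vector_derivative ?v *\<^sub>C (A (?y s) ** U n (?y s))) (at s)"
        by (rule d) (use s in auto)
      show "(?\<phi> has_vector_derivative ?\<phi>' s) (at s)" by (rule d\<phi>)
      have yK: "?y s \<in> K" using y s by simp
      have "norm (?y s - x0) = norm ?v * s" using s by (simp add: norm_mult mult.commute)
      then have "norm (A (?y s) ** U n (?y s)) \<le> a * (norm C * ((a * norm ?v * s) ^ n / fact n))"
        using mult_mono[OF K(4)[OF yK] Suc.IH[OF yK] a norm_ge_zero] norm_matrix_mul_le[of "A (?y s)" "U n (?y s)"]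
        by (simp add: mult.assoc)
      then have "norm ?v * norm (A (?y s) ** U n (?y s)) \<le> norm ?v * (a * (norm C * ((a * norm ?v * s) ^ n / fact n)))"
        by (rule mult_left_mono) simp
      then show "norm (?v *\<^sub>C (A (?y s) ** U n (?y s))) \<le> ?\<phi>' s"
        by (simp add: norm_cscale mult_ac)
    qed simp
    then show ?case by (simp add: U_x0)
  qed (simp add: U_simps)
  define Y where "Y x = (\<Sum>n. U n x)" for x
  have "has_matrix_derivative Y (A x1 ** Y x1) x1" if x1: "x1 \<in> W" for x1
  proof -
    obtain e where e: "0 < e" "cball x1 e \<subseteq> W" using openE_cball[OF W(2) x1] .
    \<comment> \<open>A compact convex subset of \<open>W\<close> that contains \<open>x0\<close>
      and a neighbourhood of \<open>x1\<close>, so one bound \<open>a\<close> for \<open>A\<close>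
      serves all segments from \<open>x0\<close> into the ball.\<close>
    let ?K = "convex hull (insert x0 (cball x1 e))"
    have K: "?K \<subseteq> W" using e W by (intro hull_minimal) auto
    have cK: "compact ?K" by (intro compact_convex_hull compact_insert compact_cball)
    have "continuous_on ?K A" using matrix_holomorphic_continuous[OF A] K continuous_on_subset by blast
    then have "bounded (A ` ?K)" by (intro compact_imp_bounded compact_continuous_image cK)
    then obtain a where a: "\<And>y. y \<in> ?K \<Longrightarrow> norm (A y) \<le> a"
      unfolding bounded_iff by blast
    have x0K: "x0 \<in> ?K" by (simp add: hull_inc)
    have a0: "0 \<le> a" using a[OF x0K] norm_ge_zero order_trans by blast
    obtain R where R: "\<And>y. y \<in> ?K \<Longrightarrow> norm (y - x0) \<le> R"
      using compact_imp_bounded[OF compact_translation[OF cK, of "- x0"]] unfolding bounded_iff by auto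
    have ball_K: "y \<in> ?K" if "y \<in> ball x1 e" for y using that by (intro hull_inc) auto
    have U_le: "norm (U n y) \<le> norm C * ((a * R) ^ n / fact n)" if "y \<in> ball x1 e" for n y
    proof -
      have "norm (U n y) \<le> norm C * ((a * norm (y - x0)) ^ n / fact n)"
        by (rule bound[OF convex_convex_hull x0K K a ball_K[OF that]])
      also have "\<dots> \<le> norm C * ((a * R) ^ n / fact n)"
        using a0 R[OF ball_K[OF that]] by (intro mult_left_mono divide_right_mono power_mono) auto
      finally show ?thesis .
    qed
    let ?T = "\<lambda>N y. \<Sum>n<N. U n y"
    \<comment> \<open>Differentiation lowers the number of terms by one because \<open>U 0\<close>
      is constant.\<close>
    let ?T' = "\<lambda>N y. case N of 0 \<Rightarrow> 0 | Suc m \<Rightarrow> A y ** ?T m y"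
    have ul: "uniform_limit (ball x1 e) ?T Y sequentially"
      unfolding Y_def
      by (rule Weierstrass_m_test[OF U_le summable_mult[OF sums_summable[OF sums_exp_shift]]])
    have dT: "has_matrix_derivative (?T N) (?T' N y) y" if "y \<in> W" for N y
    proof (induction N)
      case 0
      then show ?case by (simp add: hmd_const)
    next
      case (Suc N)
      show ?case
      proof (cases N)
        case 0
        then show ?thesis by (simp add: U_simps hmd_const)
      next
        case (Suc m)
        have "has_matrix_derivative (\<lambda>y. ?T N y + U N y) (A y ** ?T m y + A y ** U m y) y"
          using Suc.IH der[OF that, of m] unfolding Suc by (intro hmd_add) simp_all
        then show ?thesis by (simp add: Suc matrix_add_ldistrib)
      qed
    qed
    show ?thesis
    proof (rule hmd_uniform_limit[where T = ?T and T' = ?T', OF open_ball _ ul])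
      show "has_matrix_derivative (?T n) (?T' n y) y" if "y \<in> ball x1 e" for n y
        by (rule dT) (use that e in auto)
      show "x1 \<in> ball x1 e" using e by simp
      fix y assume "y \<in> ball x1 e"
      have "(\<lambda>N. A y ** ?T N y) \<longlonglongrightarrow> A y ** Y y"
        by (intro tendsto_matrix_mul tendsto_const tendsto_uniform_limitI[OF ul]) fact
      then have "(\<lambda>N. ?T' (Suc N) y) \<longlonglongrightarrow> A y ** Y y" by simp
      then show "(\<lambda>N. ?T' N y) \<longlonglongrightarrow> A y ** Y y" by (rule LIMSEQ_imp_Suc)
    qed
  qed
  moreover have "Y x0 = C"
  proof -
    have "(\<lambda>n. U n x0) sums (\<Sum>n\<in>{0}. U n x0)"
    proof (rule sums_finite)
      show "U n x0 = 0" if "n \<notin> {0}" for n using that U_x0 by (cases n) auto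
    qed simp
    then show ?thesis unfolding Y_def by (simp add: sums_iff U_simps)
  qed
  ultimately show ?thesis by (rule that)
qed

text \<open>The inverse is constructed as the transpose of a solution of the dual equation with
  coefficient \<open>- transpose (A x)\<close>; the product \<open>V x ** Y x\<close> has derivative
  0 and is 1 at \<open>x0\<close>.\<close>

lemma fundamental_matrix:
  fixes A :: "complex \<Rightarrow> complex^'n^'n"
  assumes W: "convex W" "open W" "x0 \<in> W" and A: "matrix_holomorphic_on A W"
  obtains Y V where "\<And>x. x \<in> W \<Longrightarrow> has_matrix_derivative Y (A x ** Y x) x"
    "\<And>x. x \<in> W \<Longrightarrow> has_matrix_derivative V (- (V x ** A x)) x"
    "\<And>x. x \<in> W \<Longrightarrow> V x ** Y x = mat 1"
proof -
  obtain Y where Y: "\<And>x. x \<in> W \<Longrightarrow> has_matrix_derivative Y (A x ** Y x) x" "Y x0 = mat 1"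
    using linear_ode_exists[OF W A, of "mat 1"] by blast
  have "matrix_holomorphic_on (\<lambda>x. - transpose (A x)) W"
    using A by (simp add: matrix_holomorphic_on_def transpose_def holomorphic_on_minus)
  then obtain U where U: "\<And>x. x \<in> W \<Longrightarrow> has_matrix_derivative U (- transpose (A x) ** U x) x" "U x0 = mat 1"
    using linear_ode_exists[OF W, of _ "mat 1"] by blast
  let ?V = "\<lambda>x. transpose (U x)"
  have V: "has_matrix_derivative ?V (- (?V x ** A x)) x" if "x \<in> W" for x
  proof -
    have "transpose (- transpose (A x) ** U x) = - (?V x ** A x)"
      by (simp add: matrix_transpose_mul matrix_mul_minus_left[symmetric])
        (simp add: vec_eq_iff transpose_def matrix_matrix_mult_def sum_negf)
    with hmd_transpose[OF U(1)[OF that]] show ?thesis by simp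
  qed
  have "?V x ** Y x = mat 1" if "x \<in> W" for x
  proof -
    have "?V x ** Y x = ?V x0 ** Y x0"
    proof (rule hmd_zero_const[OF W(1,2) _ that W(3)])
      show "has_matrix_derivative (\<lambda>x. ?V x ** Y x) 0 x" if "x \<in> W" for x
        using hmd_mul[OF V[OF that] Y(1)[OF that]] by (simp add: matrix_ring_simps)
    qed
    then show ?thesis by (simp add: U Y)
  qed
  with Y(1) V show ?thesis by (rule that)
qed

lemma linear_ode_solution_const:
  assumes "\<And>x. x \<in> S \<Longrightarrow> has_matrix_derivative V (- (V x ** A x)) x"
    and "\<And>x. x \<in> S \<Longrightarrow> has_matrix_derivative X (A x ** X x) x" and "connected S" "open S"
  obtains c where "\<And>x. x \<in> S \<Longrightarrow> V x ** X x = c"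
proof -
  have "has_matrix_derivative (\<lambda>x. V x ** X x) 0 x" if "x \<in> S" for x
    using hmd_mul[OF assms(1,2)[OF that]] by (simp add: matrix_ring_simps)
  from hmd_zero_const_connected[OF assms(3,4) this] that show ?thesis by blast
qed

section \<open>Continuation to the whole half-plane\<close>

context diagonalized_element
begin

abbreviation right_half_plane :: "complex set"
  where "right_half_plane \<equiv> {x. 0 < Re x}"

abbreviation coefficient :: "complex^'n^'n \<Rightarrow> complex \<Rightarrow> complex^'n^'n"
  where "coefficient f x \<equiv> - (Z + (1 / x) *\<^sub>C f)"

lemma coefficient_holomorphic: "matrix_holomorphic_on (coefficient f) right_half_plane"
  by (intro matrix_holomorphic_intros holomorphic_intros) auto

lemma right_half_plane: "convex right_half_plane" "open right_half_plane" "1 \<in> right_half_plane"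
  by (auto simp: convex_halfspace_Re_gt open_halfspace_Re_gt)

theorem canonical_solution_exists:
  assumes f: "f \<in> bracket_space Z (lie_algebra G)"
  obtains Y where "\<And>x. x \<in> right_half_plane \<Longrightarrow> Y x \<in> G"
    "\<And>x. x \<in> right_half_plane \<Longrightarrow> has_matrix_derivative Y (coefficient f x ** Y x) x"
    "\<And>e. 0 < e \<Longrightarrow> \<exists>R. \<forall>x\<in>right_half_plane. R < norm x \<longrightarrow> norm (Y x ** mexp (x *\<^sub>C Z) - mat 1) < e"
proof -
  obtain M T K where M: "0 < M" and TG: "\<And>x. x \<in> domain M \<Longrightarrow> T x \<in> G"
    and T: "\<And>x. x \<in> domain M \<Longrightarrow> has_matrix_derivative T (T x ** Z - Z ** T x - (1 / x) *\<^sub>C f ** T x) x"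
    and K: "\<And>x. x \<in> domain M \<Longrightarrow> norm (T x - mat 1) \<le> K / norm x"
    using gauge_exists[OF f] by blast
  obtain \<Phi> V where \<Phi>: "\<And>x. x \<in> right_half_plane \<Longrightarrow> has_matrix_derivative \<Phi> (coefficient f x ** \<Phi> x) x"
    and V: "\<And>x. x \<in> right_half_plane \<Longrightarrow> has_matrix_derivative V (- (V x ** coefficient f x)) x"
    and V\<Phi>: "\<And>x. x \<in> right_half_plane \<Longrightarrow> V x ** \<Phi> x = mat 1"
    using fundamental_matrix[OF right_half_plane coefficient_holomorphic[of f]] by blast
  have sub: "domain M \<subseteq> right_half_plane" by (auto simp: truncated_half_plane_def)
  let ?X = "\<lambda>x. T x ** mexp (x *\<^sub>C (- Z))"
  have X: "has_matrix_derivative ?X (coefficient f x ** ?X x) x" if "x \<in> domain M" for x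
    using hmd_mul[OF T[OF that] hmd_mexp_scaled[of "- Z" x]] by (simp add: matrix_ring_simps algebra_simps)
  have conn: "connected (domain M)"
    using starlike_truncated_half_plane[OF aperture(1) M] by (rule starlike_imp_connected)
  obtain c where c: "\<And>x. x \<in> domain M \<Longrightarrow> V x ** ?X x = c"
    using linear_ode_solution_const[OF _ X conn open_truncated_half_plane, of V] V sub by blast
  \<comment> \<open>Near infinity this equals \<open>?X\<close>, while \<Phi> is defined on the
    whole half-plane; so \<open>?Y\<close> is the continuation.\<close>
  let ?Y = "\<lambda>x. \<Phi> x ** c"
  have Y_eq: "?Y x = ?X x" if "x \<in> domain M" for x
  proof -
    have "\<Phi> x ** V x = mat 1" using V\<Phi> sub that matrix_left_right_inverse by blast
    then show ?thesis unfolding c[OF that, symmetric] by (simp add: matrix_mul_assoc)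
  qed
  have Y: "has_matrix_derivative ?Y (coefficient f x ** ?Y x) x" if "x \<in> right_half_plane" for x
    using hmd_rmul[OF \<Phi>[OF that], of c] by (simp add: matrix_mul_assoc)
  have XG: "?X x \<in> G" if "x \<in> domain M" for x
    by (intro group_mem(2)[OF G] TG that mexp_in_group[OF G] lie_algebra_cscale lie_algebra_minus Z)
  have 1: "complex_of_real (2 * M) \<in> domain M" using M aperture(1) by (simp add: truncated_half_plane_def)
  show ?thesis
  proof (rule that[OF _ Y])
    fix x assume x: "x \<in> right_half_plane"
    have "p (?Y x) = 0" if p: "vanishing G p" for p
    proof -
      have "(\<lambda>x. p (?Y x)) field_differentiable at y" if "y \<in> right_half_plane" for y
        using pdiff_chain[OF _ Y[OF that], of p] p unfolding vanishing_def field_differentiable_def by blast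
      then have hol: "(\<lambda>x. p (?Y x)) holomorphic_on right_half_plane"
        by (simp add: holomorphic_on_def field_differentiable_at_within)
      show ?thesis
      proof (rule analytic_continuation_open[OF open_truncated_half_plane right_half_plane(2) _ _ sub hol holomorphic_on_const _ x])
        show "domain M \<noteq> {}" using 1 by blast
        show "connected right_half_plane" using right_half_plane(1) by (rule convex_connected)
        show "p (?Y y) = 0" if "y \<in> domain M" for y
          using XG[OF that] p unfolding Y_eq[OF that] by (simp add: vanishing_def)
      qed
    qed
    moreover have "invertible (?Y x)"
    proof -
      have "invertible c"
      proof -
        have "invertible (V (of_real (2 * M)))" "invertible (?X (of_real (2 * M)))"
          using invertibleI[OF V\<Phi>] 1 sub group_mem(3)[OF G XG[OF 1]] by auto
        then show ?thesis unfolding c[OF 1, symmetric] by (rule invertible_mult)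
      qed
      moreover have "invertible (\<Phi> x)" using V\<Phi>[OF x] invertible_left_inverse by blast
      ultimately show ?thesis by (intro invertible_mult)
    qed
    ultimately show "?Y x \<in> G" using group_iff[OF G] by blast
  next
    fix e :: real assume e: "0 < e"
    \<comment> \<open>\<open>Re x + aperture * \<bar>Im x\<bar>\<close> is at least
      \<open>\<delta> * norm x\<close> on the half-plane, so \<open>norm x > M / \<delta>\<close>
      puts \<open>x\<close> into \<open>domain M\<close>.\<close>
    define \<delta> where "\<delta> = min 1 aperture"
    have \<delta>: "0 < \<delta>" using aperture(1) by (simp add: \<delta>_def)
    show "\<exists>R. \<forall>x\<in>right_half_plane. R < norm x \<longrightarrow> norm (?Y x ** mexp (x *\<^sub>C Z) - mat 1) < e"
    proof (intro exI[of _ "max (M / \<delta>) (\<bar>K\<bar> / e)"] ballI impI)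
      fix x assume x: "x \<in> right_half_plane" and R: "max (M / \<delta>) (\<bar>K\<bar> / e) < norm x"
      have "M < \<delta> * norm x" using R \<delta> by (simp add: divide_less_eq mult.commute)
      also have "\<dots> \<le> \<delta> * (\<bar>Re x\<bar> + \<bar>Im x\<bar>)" using \<delta> cmod_le by (intro mult_left_mono) auto
      also have "\<dots> \<le> 1 * \<bar>Re x\<bar> + aperture * \<bar>Im x\<bar>"
        unfolding distrib_left by (intro add_mono mult_right_mono) (auto simp: \<delta>_def)
      also have "\<dots> = Re x + aperture * \<bar>Im x\<bar>" using x by simp
      finally have xM: "x \<in> domain M" using x by (simp add: truncated_half_plane_def)
      have "?Y x ** mexp (x *\<^sub>C Z) = T x"
        unfolding Y_eq[OF xM] using matrix_mul_cancel(2)[OF mexp_mul_minus[of "x *\<^sub>C Z"]] by (simp add: cscale_simps)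
      then have "norm (?Y x ** mexp (x *\<^sub>C Z) - mat 1) \<le> K / norm x" using K[OF xM] by simp
      also have "K / norm x < e"
      proof -
        have "K < e * norm x" using R e abs_ge_self[of K] by (simp add: divide_less_eq mult.commute)
        then show ?thesis using domain_nonzero[OF xM] by (simp add: divide_less_eq)
      qed
      finally show "norm (?Y x ** mexp (x *\<^sub>C Z) - mat 1) < e" .
    qed
  qed
qed

end

section \<open>Uniqueness\<close>

lemma mexp_scaled_commute: "A ** mexp (s *\<^sub>C A) = mexp (s *\<^sub>C A) ** A"
  using mexp_commute[of "s *\<^sub>C A"] by (cases "s = 0") (simp_all add: matrix_ring_simps cscale_simps)

context diagonalized_element
begin

lemma conjugate_limit_trivial:
  assumes C: "C \<in> G"
    and lim: "\<And>e. 0 < e \<Longrightarrow> \<exists>R. \<forall>x\<in>right_half_plane. R < norm x \<longrightarrow>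
      norm (mexp (x *\<^sub>C (- Z)) ** C ** mexp (x *\<^sub>C Z) - mat 1) < e"
  shows "C = mat 1"
proof (rule ccontr)
  assume "C \<noteq> mat 1"
  let ?\<mu> = "\<lambda>i j. z i - z j"
  define E where "E x = mexp (x *\<^sub>C (- Z)) ** C ** mexp (x *\<^sub>C Z)" for x
  define N where "N = coord (C - mat 1)"
  have E: "E x \<in> G" for x
    unfolding E_def by (intro group_mem(2)[OF G] C mexp_in_group[OF G] lie_algebra_cscale lie_algebra_minus Z)
  have dE: "has_matrix_derivative E (- (Z ** E x - E x ** Z)) x" for x
    using hmd_mul[OF hmd_rmul[OF hmd_mexp_scaled[of "- Z" x], of C] hmd_mexp_scaled[of Z x]]
    unfolding E_def[abs_def] mexp_scaled_commute[of Z] by (simp add: matrix_ring_simps)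
  have E_coord: "coord (E x) $ i $ j = exp (- ?\<mu> i j * x) * coord C $ i $ j" for x i j
  proof -
    let ?g = "\<lambda>x. exp (?\<mu> i j * x) * coord (E x) $ i $ j"
    have "(?g has_field_derivative 0) (at x within UNIV)" for x
    proof -
      have "has_matrix_derivative (\<lambda>x. coord (E x)) (coord (- (Z ** E x - E x ** Z))) x"
        unfolding coord_def by (intro hmd_rmul hmd_lmul dE)
      then have 1: "((\<lambda>x. coord (E x) $ i $ j) has_field_derivative - (?\<mu> i j * coord (E x) $ i $ j)) (at x)"
        unfolding coord_simps(3) by (drule_tac hmdD[where i = i and j = j])
          (simp only: vector_uminus_component coord_commutator)
      have 2: "((\<lambda>x. exp (?\<mu> i j * x)) has_field_derivative exp (?\<mu> i j * x) * ?\<mu> i j) (at x)"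
        by (auto intro!: derivative_eq_intros)
      from DERIV_mult[OF 2 1] show ?thesis by (simp add: mult_ac)
    qed
    from has_field_derivative_zero_constant[OF convex_UNIV this]
    obtain c where "\<And>x. ?g x = c" by auto
    from this[of x] this[of 0] have "exp (?\<mu> i j * x) * coord (E x) $ i $ j = coord C $ i $ j"
      by (simp add: E_def cscale_simps)
    then have "exp (- ?\<mu> i j * x) * coord C $ i $ j = (exp (- ?\<mu> i j * x) * exp (?\<mu> i j * x)) * coord (E x) $ i $ j"
      by (simp only: mult.assoc)
    also have "exp (- ?\<mu> i j * x) * exp (?\<mu> i j * x) = 1"
      by (simp only: mult_exp_exp mult_minus_left left_minus exp_zero)
    finally show ?thesis by simp
  qed
  have coord_1: "coord (mat 1) = mat 1" by (simp add: coord_def QP)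
  have EN: "coord (E x - mat 1) $ i $ j = exp (- ?\<mu> i j * x) * N $ i $ j" for x i j
    by (cases "i = j") (simp_all only: N_def coord_simps coord_1 vector_minus_component E_coord, simp_all add: mat_def)
  \<comment> \<open>Otherwise there is \<open>w\<close> with \<open>Re w = 1\<close> along which
    \<open>exp (- ?\<mu> i j * x)\<close> has modulus at least 1, and a non-zero entry of
    \<open>N\<close> could not be carried to 0 there.\<close>
  have pos: "positive_real (?\<mu> i j)" if N: "N $ i $ j \<noteq> 0" for i j
  proof (rule ccontr)
    assume np: "\<not> positive_real (?\<mu> i j)"
    define w where "w = Complex 1 (Re (?\<mu> i j) / Im (?\<mu> i j))"
    have w: "Re (?\<mu> i j * w) \<le> 0" unfolding w_def by (rule slope_direction[OF np])
    define b where "b = norm Q * norm P + 1"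
    have b: "0 < b" by (simp add: b_def add_nonneg_pos)
    obtain R where R: "\<And>x. x \<in> right_half_plane \<Longrightarrow> R < norm x \<Longrightarrow> norm (E x - mat 1) < norm (N $ i $ j) / b"
      using lim[of "norm (N $ i $ j) / b"] N b unfolding E_def by auto
    define s where "s = \<bar>R\<bar> + 1"
    define x where "x = of_real s * w"
    have s: "0 < s" by (simp add: s_def)
    have Re_x: "Re x = s" by (simp add: x_def w_def)
    then have "R < norm x" using complex_Re_le_cmod[of x] by (simp add: s_def)
    then have small: "norm (E x - mat 1) < norm (N $ i $ j) / b" using R Re_x s by simp
    have "Re (- ?\<mu> i j * x) = - s * Re (?\<mu> i j * w)" by (simp add: x_def algebra_simps)
    then have "0 \<le> Re (- ?\<mu> i j * x)" using w s by (simp add: mult_nonneg_nonpos)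
    then have "1 \<le> norm (exp (- ?\<mu> i j * x))" by (simp only: norm_exp_eq_Re one_le_exp_iff)
    then have "norm (N $ i $ j) \<le> norm (exp (- ?\<mu> i j * x)) * norm (N $ i $ j)"
      by (simp add: mult_le_cancel_right1)
    also have "\<dots> = norm (coord (E x - mat 1) $ i $ j)" unfolding EN norm_mult ..
    also have "\<dots> \<le> norm Q * norm (E x - mat 1) * norm P"
      unfolding coord_def
      by (intro order_trans[OF norm_entry_le] order_trans[OF norm_matrix_mul_le] mult_right_mono norm_matrix_mul_le) simp
    also have "\<dots> \<le> b * norm (E x - mat 1)"
      by (simp add: b_def algebra_simps)
    also have "\<dots> < norm (N $ i $ j)" using small b by (simp add: pos_less_divide_eq mult.commute)
    finally show False by simp
  qed
  define I where "I = {(i, j). N $ i $ j \<noteq> 0}"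
  have "I \<noteq> {}"
  proof
    assume "I = {}"
    then have "N = 0" by (auto simp: I_def vec_eq_iff)
    then have "C - mat 1 = 0" by (intro coord_eqI) (simp add: N_def coord_simps)
    with \<open>C \<noteq> mat 1\<close> show False by simp
  qed
  have fin: "finite ((\<lambda>(i, j). Re (?\<mu> i j)) ` I)" by simp
  obtain i0 j0 where ij0: "N $ i0 $ j0 \<noteq> 0" and min: "\<And>i j. N $ i $ j \<noteq> 0 \<Longrightarrow> Re (?\<mu> i0 j0) \<le> Re (?\<mu> i j)"
  proof -
    have "Min ((\<lambda>(i, j). Re (?\<mu> i j)) ` I) \<in> (\<lambda>(i, j). Re (?\<mu> i j)) ` I"
      using fin \<open>I \<noteq> {}\<close> by (intro Min_in) auto
    then obtain i0 j0 where 1: "(i0, j0) \<in> I" "Min ((\<lambda>(i, j). Re (?\<mu> i j)) ` I) = Re (?\<mu> i0 j0)" by auto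
    have "Re (?\<mu> i0 j0) \<le> Re (?\<mu> i j)" if "(i, j) \<in> I" for i j
      unfolding 1(2)[symmetric] using that by (intro Min_le fin) (auto intro: rev_image_eqI)
    with 1(1) show ?thesis by (intro that[of i0 j0]) (auto simp: I_def)
  qed
  define \<mu>0 where "\<mu>0 = ?\<mu> i0 j0"
  define X0 where "X0 = proj \<mu>0 (C - mat 1)"
  have \<mu>0: "positive_real \<mu>0" unfolding \<mu>0_def by (rule pos[OF ij0])
  \<comment> \<open>Rescaling by the smallest weight: in the limit its component remains and all
    others decay.\<close>
  define F where "F n = exp (\<mu>0 * of_nat n) *\<^sub>C (E (of_nat n) - mat 1)" for n :: nat
  have F_coord: "coord (F n) $ i $ j = exp ((\<mu>0 - ?\<mu> i j) * of_nat n) * N $ i $ j" for n i j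
    unfolding F_def coord_simps(4) cscale_nth EN
    by (simp add: mult.assoc[symmetric] mult_exp_exp algebra_simps)
  have "(\<lambda>n. coord (F n)) \<longlonglongrightarrow> coord X0"
    unfolding tendsto_matrix_iff
  proof (intro allI)
    fix i j
    have X0_coord: "coord X0 $ i $ j = (if ?\<mu> i j = \<mu>0 then N $ i $ j else 0)"
      by (simp add: X0_def coord_proj N_def)
    show "(\<lambda>n. coord (F n) $ i $ j) \<longlonglongrightarrow> coord X0 $ i $ j"
    proof (cases "N $ i $ j = 0 \<or> ?\<mu> i j = \<mu>0")
      case True
      then show ?thesis unfolding F_coord X0_coord by (auto simp: tendsto_const)
    next
      case False
      then have p: "positive_real (?\<mu> i j)" "Re \<mu>0 \<le> Re (?\<mu> i j)" and ne: "?\<mu> i j \<noteq> \<mu>0"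
        using pos min unfolding \<mu>0_def by auto
      \<comment> \<open>Weights at non-zero entries are real, so distinct ones differ in their real
        parts.\<close>
      have "Re \<mu>0 \<noteq> Re (?\<mu> i j)"
        using p(1) \<mu>0 ne by (auto simp: positive_real_def complex_eq_iff)
      then have lt: "Re (\<mu>0 - ?\<mu> i j) < 0" using p(2) by simp
      have "(\<lambda>n. exp (\<mu>0 - ?\<mu> i j) ^ n * N $ i $ j) \<longlonglongrightarrow> 0 * N $ i $ j"
        using lt by (intro tendsto_mult tendsto_const LIMSEQ_power_zero) (simp only: norm_exp_eq_Re exp_less_one_iff)
      moreover have "exp ((\<mu>0 - ?\<mu> i j) * of_nat n) = exp (\<mu>0 - ?\<mu> i j) ^ n" for n
        by (simp only: exp_of_nat_mult mult.commute[of _ "of_nat n"])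
      ultimately show ?thesis
        unfolding F_coord X0_coord using ne by simp
    qed
  qed
  then have "(\<lambda>n. uncoord (coord (F n))) \<longlonglongrightarrow> uncoord (coord X0)"
    unfolding uncoord_def by (intro tendsto_matrix_mul tendsto_const)
  then have F: "F \<longlonglongrightarrow> X0" by simp
  have E_lim: "\<forall>\<^sub>F n in sequentially. norm (E (of_nat n) - mat 1) < d" if d: "0 < d" for d
  proof -
    obtain R where R: "\<And>x. x \<in> right_half_plane \<Longrightarrow> R < norm x \<Longrightarrow> norm (E x - mat 1) < d"
      using lim[OF d] unfolding E_def by auto
    have "\<forall>\<^sub>F n in sequentially. max R 0 < real n"
      using filterlim_real_sequentially unfolding filterlim_at_top_dense by (rule spec)
    then show ?thesis by (rule eventually_mono) (use R in auto)
  qed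
  have "X0 \<in> lie_algebra G"
    unfolding lie_algebra_iff
  proof (intro allI impI)
    fix p assume p: "vanishing G p"
    then have pol: "matrix_polynomial p" by (simp add: vanishing_def)
    let ?D = "pdiff p (mat 1)"
    \<comment> \<open>\<open>p\<close> vanishes at \<open>E n\<close> and at 1, so its first order
      expansion at 1 bounds \<open>?D (E n - 1)\<close> by \<open>e * norm (E n - 1)\<close> once
      \<open>E n\<close> is close to 1. The inequality is homogeneous, hence holds for
      \<open>F n\<close> and then for the limit \<open>X0\<close>.\<close>
    have le: "norm (?D X0) \<le> e * norm X0" if e: "0 < e" for e
    proof -
      obtain d where d: "0 < d" "\<And>y. norm (y - mat 1) < d \<Longrightarrow>
          norm (p y - p (mat 1) - ?D (y - mat 1)) \<le> e * norm (y - mat 1)"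
        using has_derivative_pdiff[OF pol, of "mat 1"] e unfolding has_derivative_at_alt by blast
      have "norm (?D (F n)) \<le> e * norm (F n)" if n: "norm (E (of_nat n) - mat 1) < d" for n
      proof -
        have "p (E (of_nat n)) = 0" "p (mat 1) = 0" using p E group_mem(1)[OF G] by (auto simp: vanishing_def)
        with d(2)[OF n] have "norm (?D (E (of_nat n) - mat 1)) \<le> e * norm (E (of_nat n) - mat 1)" by simp
        then have "norm (exp (\<mu>0 * of_nat n)) * norm (?D (E (of_nat n) - mat 1)) \<le>
            norm (exp (\<mu>0 * of_nat n)) * (e * norm (E (of_nat n) - mat 1))"
          by (rule mult_left_mono) simp
        then show ?thesis
          unfolding F_def pdiff_props(1)[OF pol] norm_mult norm_cscale by (simp only: mult_ac)
      qed
      then have ev: "\<forall>\<^sub>F n in sequentially. norm (?D (F n)) \<le> e * norm (F n)"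
        by (rule eventually_mono[OF E_lim[OF d(1)]])
      have l1: "(\<lambda>n. norm (?D (F n))) \<longlonglongrightarrow> norm (?D X0)"
        by (intro tendsto_norm bounded_linear.tendsto[OF bounded_linear_pdiff[OF pol]] F)
      have l2: "(\<lambda>n. e * norm (F n)) \<longlonglongrightarrow> e * norm X0" by (intro tendsto_intros F)
      show ?thesis by (rule tendsto_le[OF sequentially_bot l2 l1 ev])
    qed
    show "?D X0 = 0"
    proof (rule ccontr)
      assume "?D X0 \<noteq> 0"
      then have D: "0 < norm (?D X0)" by simp
      have X: "0 < norm X0 + 1" by (simp add: add_nonneg_pos)
      have "norm (?D X0) \<le> norm (?D X0) / (norm X0 + 1) * norm X0"
        using D X by (intro le) simp
      then have "norm (?D X0) * (norm X0 + 1) \<le> norm (?D X0) * norm X0"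
        using X by (simp add: pos_le_divide_eq)
      then show False using D by (simp add: distrib_left)
    qed
  qed
  then have "X0 = 0"
    using admissible commutator_proj \<mu>0 unfolding X0_def by blast
  then have "coord X0 $ i0 $ j0 = 0" by (simp add: coord_simps)
  then show False using ij0 by (simp add: X0_def coord_proj N_def \<mu>0_def)
qed

theorem canonical_solution_unique:
  assumes Y1: "\<And>x. x \<in> right_half_plane \<Longrightarrow> Y1 x \<in> G"
      "\<And>x. x \<in> right_half_plane \<Longrightarrow> has_matrix_derivative Y1 (coefficient f x ** Y1 x) x"
      "\<And>e. 0 < e \<Longrightarrow> \<exists>R. \<forall>x\<in>right_half_plane. R < norm x \<longrightarrow> norm (Y1 x ** mexp (x *\<^sub>C Z) - mat 1) < e"
    and Y2: "\<And>x. x \<in> right_half_plane \<Longrightarrow> Y2 x \<in> G"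
      "\<And>x. x \<in> right_half_plane \<Longrightarrow> has_matrix_derivative Y2 (coefficient f x ** Y2 x) x"
      "\<And>e. 0 < e \<Longrightarrow> \<exists>R. \<forall>x\<in>right_half_plane. R < norm x \<longrightarrow> norm (Y2 x ** mexp (x *\<^sub>C Z) - mat 1) < e"
    and x: "x \<in> right_half_plane"
  shows "Y1 x = Y2 x"
proof -
  obtain \<Phi> V where "\<And>x. x \<in> right_half_plane \<Longrightarrow> has_matrix_derivative \<Phi> (coefficient f x ** \<Phi> x) x"
    and V: "\<And>x. x \<in> right_half_plane \<Longrightarrow> has_matrix_derivative V (- (V x ** coefficient f x)) x"
    and V\<Phi>: "\<And>x. x \<in> right_half_plane \<Longrightarrow> V x ** \<Phi> x = mat 1"
    using fundamental_matrix[OF right_half_plane coefficient_holomorphic[of f]] by blast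
  have conn: "connected right_half_plane" using right_half_plane(1) by (rule convex_connected)
  obtain c1 where c1: "\<And>x. x \<in> right_half_plane \<Longrightarrow> V x ** Y1 x = c1"
    using linear_ode_solution_const[OF V Y1(2) conn right_half_plane(2)] by blast
  obtain c2 where c2: "\<And>x. x \<in> right_half_plane \<Longrightarrow> V x ** Y2 x = c2"
    using linear_ode_solution_const[OF V Y2(2) conn right_half_plane(2)] by blast
  have \<Phi>V: "\<Phi> x ** V x = mat 1" if "x \<in> right_half_plane" for x
    using V\<Phi>[OF that] matrix_left_right_inverse by blast
  have "invertible c1"
    unfolding c1[OF right_half_plane(3), symmetric]
    by (intro invertible_mult invertibleI[OF V\<Phi>] group_mem(3)[OF G] Y1 right_half_plane)
  then obtain d where d: "c1 ** d = mat 1" using invertible_right_inverse by blast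
  define C where "C = d ** c2"
  have Y12: "Y1 x ** C = Y2 x" if "x \<in> right_half_plane" for x
  proof -
    have "V x ** (Y1 x ** C) = V x ** Y2 x"
      unfolding C_def matrix_mul_assoc c1[OF that] c2[OF that] d by simp
    then have "\<Phi> x ** V x ** (Y1 x ** C) = \<Phi> x ** V x ** Y2 x"
      by (simp only: matrix_mul_assoc[symmetric])
    then show ?thesis by (simp add: \<Phi>V[OF that])
  qed
  have "C \<in> G"
  proof -
    obtain U where U: "Y1 1 ** U = mat 1"
      using group_mem(3)[OF G Y1(1)[OF right_half_plane(3)]] invertible_right_inverse by blast
    have "U ** Y1 1 = mat 1" using U matrix_left_right_inverse by blast
    then have "U ** Y2 1 = C"
      unfolding Y12[OF right_half_plane(3), symmetric] by (simp add: matrix_mul_assoc)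
    moreover have "U ** Y2 1 \<in> G"
      by (intro group_mem(2)[OF G] group_mem(4)[OF G _ U] Y1 Y2 right_half_plane)
    ultimately show ?thesis by simp
  qed
  moreover have "\<exists>R. \<forall>x\<in>right_half_plane. R < norm x \<longrightarrow>
      norm (mexp (x *\<^sub>C (- Z)) ** C ** mexp (x *\<^sub>C Z) - mat 1) < e" if e: "0 < e" for e
  proof -
    obtain R1 where R1: "\<And>x. x \<in> right_half_plane \<Longrightarrow> R1 < norm x \<Longrightarrow>
        norm (Y1 x ** mexp (x *\<^sub>C Z) - mat 1) < min (1 / 2) (e / 4)"
      using Y1(3)[of "min (1 / 2) (e / 4)"] e by auto
    obtain R2 where R2: "\<And>x. x \<in> right_half_plane \<Longrightarrow> R2 < norm x \<Longrightarrow>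
        norm (Y2 x ** mexp (x *\<^sub>C Z) - mat 1) < e / 4"
      using Y2(3)[of "e / 4"] e by auto
    show ?thesis
    proof (intro exI[of _ "max R1 R2"] ballI impI)
      fix x assume x: "x \<in> right_half_plane" and R: "max R1 R2 < norm x"
      let ?H1 = "Y1 x ** mexp (x *\<^sub>C Z)" and ?H2 = "Y2 x ** mexp (x *\<^sub>C Z)"
      let ?E = "mexp (x *\<^sub>C (- Z)) ** C ** mexp (x *\<^sub>C Z)"
      have "?H1 ** ?E = ?H2"
        unfolding Y12[OF x, symmetric] using matrix_mul_cancel(1)[OF mexp_mul_minus[of "x *\<^sub>C Z"], of "Y1 x"]
        by (simp add: matrix_mul_assoc cscale_simps)
      \<comment> \<open>With \<open>norm (?H1 - mat 1) < 1 / 2\<close> the last product is absorbed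
        into the left side, so \<open>?E - mat 1\<close> is controlled by
        \<open>?H2 - ?H1\<close>.\<close>
      then have "?E - mat 1 = (?H2 - ?H1) - (?H1 - mat 1) ** (?E - mat 1)"
        by (simp add: matrix_ring_simps)
      then have "norm (?E - mat 1) \<le> norm (?H2 - ?H1) + norm ((?H1 - mat 1) ** (?E - mat 1))"
        by (metis norm_triangle_ineq4)
      also have "\<dots> \<le> norm (?H2 - ?H1) + 1 / 2 * norm (?E - mat 1)"
        using R1[OF x] R by (intro add_left_mono order_trans[OF norm_matrix_mul_le] mult_right_mono) auto
      finally have "norm (?E - mat 1) \<le> 2 * norm (?H2 - ?H1)" by simp
      also have "norm (?H2 - ?H1) \<le> norm (?H2 - mat 1) + norm (?H1 - mat 1)"
        using norm_triangle_ineq4[of "?H2 - mat 1" "?H1 - mat 1"] by simp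
      also have "\<dots> < e / 4 + e / 4" using R1[OF x] R2[OF x] R by (intro add_strict_mono) auto
      finally show "norm (?E - mat 1) < e" by simp
    qed
  qed
  ultimately have "C = mat 1" by (rule conjugate_limit_trivial)
  then show ?thesis using Y12[OF x] by simp
qed

end

section \<open>The half-plane of an admissible ray\<close>

lemma Re_inverse_pos:
  assumes "0 < Re w"
  shows "0 < Re (inverse w)"
  unfolding inverse_complex.sel
  by (rule divide_pos_pos[OF assms]) (use assms in \<open>simp add: sum_power2_gt_zero_iff\<close>)

lemma ray_through_scaled:
  assumes "0 < c"
  shows "ray_through (of_real c * u) = ray_through u"
proof -
  have "of_real s * (of_real c * u) = of_real (s * c) * u" "of_real s * u = of_real (s / c) * (of_real c * u)"
    for s :: real
    using assms by simp_all
  moreover have "0 < s * c" "0 < s / c" if "0 < s" for s using that assms by simp_all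
  ultimately show ?thesis unfolding ray_through_def by blast
qed

text \<open>For \<open>t = s * u * v\<close> the quotient \<open>u / t\<close> is
  \<open>inverse (s * v)\<close>, and inversion preserves the right half-plane. The origin is
  excluded on the right because \<open>u / 0 = 0\<close>.\<close>

lemma half_plane_iff:
  assumes "u \<noteq> 0"
  shows "t \<in> half_plane (ray_through u) \<longleftrightarrow> 0 < Re (u / t)"
proof
  assume "t \<in> half_plane (ray_through u)"
  then obtain s v where s: "0 < s" "t = of_real s * u * v" "0 < Re v"
    by (auto simp: half_plane_def ray_through_def)
  have "0 < Re (of_real s * v)" using s by simp
  then have "0 < Re (inverse (of_real s * v))" by (rule Re_inverse_pos)
  moreover have "u / t = inverse (of_real s * v)" using assms by (simp add: s(2) divide_inverse)
  ultimately show "0 < Re (u / t)" by simp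
next
  assume t: "0 < Re (u / t)"
  then have "t \<noteq> 0" by auto
  have "0 < Re (inverse (u / t))" using t by (rule Re_inverse_pos)
  moreover have "t = u * inverse (u / t)" using assms by simp
  moreover have "u \<in> ray_through u" by (auto simp: ray_through_def intro!: exI[of _ 1])
  ultimately show "t \<in> half_plane (ray_through u)" unfolding half_plane_def by blast
qed

lemma open_half_plane:
  assumes "u \<noteq> 0"
  shows "open (half_plane (ray_through u))"
proof -
  have "half_plane (ray_through u) = {t. 0 < Re (cnj u * t)}"
  proof (rule set_eqI)
    fix t
    have "Re (u / t) = Re (cnj u * t) / (norm t)\<^sup>2"
      by (simp add: Re_divide cmod_power2 algebra_simps)
    then show "t \<in> half_plane (ray_through u) \<longleftrightarrow> t \<in> {t. 0 < Re (cnj u * t)}"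
      unfolding half_plane_iff[OF assms] by (cases "t = 0") (auto simp: zero_less_divide_iff)
  qed
  then show ?thesis by (simp only:) (intro open_Collect_less continuous_intros)
qed

lemma bracket_space_scaled:
  assumes "u \<noteq> 0"
  shows "bracket_space Z V \<subseteq> bracket_space ((1 / u) *\<^sub>C Z) V"
  unfolding bracket_space_def
proof (rule cmat.span_mono, rule UN_least)
  fix \<zeta> :: complex assume \<zeta>: "\<zeta> \<in> - {0}"
  have "ad_eigenspace Z V \<zeta> \<subseteq> ad_eigenspace ((1 / u) *\<^sub>C Z) V (\<zeta> / u)"
  proof
    fix X assume "X \<in> ad_eigenspace Z V \<zeta>"
    then have X: "X \<in> V" "Z ** X - X ** Z = \<zeta> *\<^sub>C X" by (auto simp: ad_eigenspace_def commutator_def)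
    have "((1 / u) *\<^sub>C Z) ** X - X ** ((1 / u) *\<^sub>C Z) = (1 / u) *\<^sub>C (Z ** X - X ** Z)"
      by (simp add: matrix_ring_simps cscale_simps)
    then show "X \<in> ad_eigenspace ((1 / u) *\<^sub>C Z) V (\<zeta> / u)"
      using X by (simp add: ad_eigenspace_def commutator_def cscale_simps)
  qed
  moreover have "\<zeta> / u \<in> - {0}" using \<zeta> assms by simp
  ultimately show "ad_eigenspace Z V \<zeta> \<subseteq> (\<Union>\<zeta>\<in>- {0}. ad_eigenspace ((1 / u) *\<^sub>C Z) V \<zeta>)" by blast
qed

text \<open>An eigenvalue \<mu> of \<open>ad (Z / u)\<close> corresponds to the eigenvalue
  \<open>u * \<mu>\<close> of \<open>ad Z\<close>; if \<mu> is positive, this lies on the ray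
  through \<open>u\<close>, which would then be a Stokes ray.\<close>

lemma diagonalized_element_of_admissible_ray:
  fixes Z :: "complex^'n^'n"
  assumes G: "algebraic_group G" "Z \<in> lie_algebra G" "semisimple Z"
    and r: "\<not> stokes_ray Z (lie_algebra G) (ray_through u)" "u \<noteq> 0"
  obtains P Q z where "diagonalized_element G ((1 / u) *\<^sub>C Z) P Q z"
proof -
  obtain P D :: "complex^'n^'n" where PD: "invertible P" "\<And>i j. i \<noteq> j \<Longrightarrow> D $ i $ j = 0"
    "Z = P ** D ** matrix_inv P"
    using G(3) unfolding semisimple_def by blast
  show ?thesis
  proof (rule that, unfold_locales)
    show "algebraic_group G" by (rule G)
    show "(1 / u) *\<^sub>C Z \<in> lie_algebra G" by (intro lie_algebra_cscale G)
    show "P ** matrix_inv P = mat 1" using PD(1) by (rule matrix_inv_simps)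
    have "(1 / u) *\<^sub>C D = (\<chi> i j. if i = j then D $ i $ i / u else 0)"
      using PD(2) by (simp add: vec_eq_iff)
    then show "(1 / u) *\<^sub>C Z = P ** (\<chi> i j. if i = j then D $ i $ i / u else 0) ** matrix_inv P"
      unfolding PD(3) by (metis matrix_mul_cscale_left matrix_mul_cscale_right)
    fix X \<mu>
    assume X: "X \<in> lie_algebra G" and eigen: "((1 / u) *\<^sub>C Z) ** X - X ** ((1 / u) *\<^sub>C Z) = \<mu> *\<^sub>C X"
      and \<mu>: "positive_real \<mu>"
    show "X = 0"
    proof (rule ccontr)
      assume "X \<noteq> 0"
      have "(1 / u) *\<^sub>C (Z ** X - X ** Z) = \<mu> *\<^sub>C X"
        using eigen by (simp add: matrix_ring_simps cscale_simps)
      then have "u *\<^sub>C (1 / u) *\<^sub>C (Z ** X - X ** Z) = u *\<^sub>C \<mu> *\<^sub>C X" by simp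
      then have "Z ** X - X ** Z = (u * \<mu>) *\<^sub>C X" using r(2) by (simp add: cscale_simps(7,8))
      then have "X \<in> ad_eigenspace Z (lie_algebra G) (u * \<mu>)"
        using X by (simp add: ad_eigenspace_def commutator_def)
      moreover have "ray_through u = ray_through (u * \<mu>)"
      proof -
        have "\<mu> = of_real (Re \<mu>)" "0 < Re \<mu>" using \<mu> by (auto simp: positive_real_def complex_eq_iff)
        then show ?thesis using ray_through_scaled[of "Re \<mu>" u] by (simp add: mult.commute)
      qed
      moreover have "u * \<mu> \<noteq> 0" using r(2) \<mu> by (auto simp: positive_real_def)
      ultimately show False
        using r(1) \<open>X \<noteq> 0\<close> unfolding stokes_ray_def by blast
    qed
  qed
qed

text \<open>The substitution \<open>t = u / x\<close> transports existence and uniqueness from the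
  right half-plane, and the condition at \<open>t = 0\<close> becomes one at infinity. The
  extensional function space fixes the values outside the half-plane, so that uniqueness is an
  equality of functions.\<close>

theorem theorem2p5:
  fixes G :: "(complex^'n^'n) set" and Z f :: "complex^'n^'n" and r :: "complex set"
  assumes "algebraic_group G"
    and "Z \<in> lie_algebra G" and "semisimple Z"
    and "f \<in> bracket_space Z (lie_algebra G)"
    and "admissible_ray Z (lie_algebra G) r"
  shows "\<exists>!Y. Y \<in> half_plane r \<rightarrow>\<^sub>E G \<and>
    matrix_holomorphic_on Y (half_plane r) \<and>
    (\<forall>t\<in>half_plane r.
       has_matrix_derivative Y (((1 / t\<^sup>2) *\<^sub>C Z + (1 / t) *\<^sub>C f) ** Y t) t) \<and>
    ((\<lambda>t. Y t ** mexp ((1 / t) *\<^sub>C Z)) \<longlongrightarrow> mat 1) (at 0 within half_plane r)"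
proof -
  obtain \<phi> :: real where \<phi>: "r = ray_through (exp (\<i> * of_real (pi * \<phi>)))"
    using assms(5) unfolding admissible_ray_def is_ray_def by blast
  define u where "u = exp (\<i> * of_real (pi * \<phi>))"
  have r: "r = ray_through u" using \<phi> by (simp only: u_def)
  have u: "u \<noteq> 0" "norm u = 1"
    unfolding u_def norm_exp_i_times by (rule exp_not_eq_zero, rule refl)
  have "\<not> stokes_ray Z (lie_algebra G) (ray_through u)"
    using assms(5) r by (simp add: admissible_ray_def)
  from diagonalized_element_of_admissible_ray[OF assms(1-3) this u(1)]
  obtain P Q z where "diagonalized_element G ((1 / u) *\<^sub>C Z) P Q z" by blast
  then interpret diagonalized_element G "(1 / u) *\<^sub>C Z" P Q z .
  let ?H = "half_plane r"
  have H: "t \<in> ?H \<longleftrightarrow> 0 < Re (u / t)" for t unfolding r by (rule half_plane_iff[OF u(1)])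
  have openH: "open ?H" unfolding r by (rule open_half_plane[OF u(1)])
  have H_nonzero: "t \<noteq> 0" if "t \<in> ?H" for t using that by (auto simp: H)
  have W: "u / x \<in> ?H" "u / (u / x) = x" if "0 < Re x" for x
    using that u(1) by (auto simp: H)
  have f: "f \<in> bracket_space ((1 / u) *\<^sub>C Z) (lie_algebra G)"
    using bracket_space_scaled[OF u(1)] assms(4) by blast
  have d_inv: "((\<lambda>s. u / s) has_field_derivative - u / s\<^sup>2) (at s)" if "s \<noteq> 0" for s
    using that by (auto intro!: derivative_eq_intros simp: power2_eq_square)
  have Zx: "(u / t) *\<^sub>C (1 / u) *\<^sub>C Z = (1 / t) *\<^sub>C Z" for t
    using u(1) by (simp add: cscale_simps)
  obtain Y0 where Y0: "\<And>x. x \<in> right_half_plane \<Longrightarrow> Y0 x \<in> G"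
    "\<And>x. x \<in> right_half_plane \<Longrightarrow> has_matrix_derivative Y0 (coefficient f x ** Y0 x) x"
    "\<And>e. 0 < e \<Longrightarrow> \<exists>R. \<forall>x\<in>right_half_plane. R < norm x \<longrightarrow>
      norm (Y0 x ** mexp (x *\<^sub>C (1 / u) *\<^sub>C Z) - mat 1) < e"
    using canonical_solution_exists[OF f] by blast
  define Y where "Y = restrict (\<lambda>t. Y0 (u / t)) ?H"
  have Y_eq: "Y t = Y0 (u / t)" if "t \<in> ?H" for t using that by (simp add: Y_def)
  have dY: "has_matrix_derivative Y (((1 / t\<^sup>2) *\<^sub>C Z + (1 / t) *\<^sub>C f) ** Y t) t" if t: "t \<in> ?H" for t
  proof (rule hmd_transform[OF _ openH t])
    show "Y0 (u / s) = Y s" if "s \<in> ?H" for s using Y_eq[OF that] by simp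
    have "has_matrix_derivative (\<lambda>t. Y0 (u / t)) ((- u / t\<^sup>2) *\<^sub>C (coefficient f (u / t) ** Y0 (u / t))) t"
      by (rule hmd_chain[OF Y0(2) d_inv[OF H_nonzero[OF t]]]) (use t H in simp)
    moreover have "(- u / t\<^sup>2) *\<^sub>C (coefficient f (u / t) ** Y0 (u / t)) =
        ((1 / t\<^sup>2) *\<^sub>C Z + (1 / t) *\<^sub>C f) ** Y t"
    proof -
      have "- u / t\<^sup>2 * (1 / u) = - (1 / t\<^sup>2)" "- u / t\<^sup>2 * (1 / (u / t)) = - (1 / t)"
        using u(1) H_nonzero[OF t] by (simp_all add: power2_eq_square)
      then have "(- u / t\<^sup>2) *\<^sub>C coefficient f (u / t) = (1 / t\<^sup>2) *\<^sub>C Z + (1 / t) *\<^sub>C f"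
        by (simp only: cscale_simps minus_add_distrib minus_minus)
      then show ?thesis unfolding Y_eq[OF t] by (simp only: matrix_mul_cscale_left[symmetric])
    qed
    ultimately show "has_matrix_derivative (\<lambda>t. Y0 (u / t)) (((1 / t\<^sup>2) *\<^sub>C Z + (1 / t) *\<^sub>C f) ** Y t) t"
      by simp
  qed
  have limY: "((\<lambda>t. Y t ** mexp ((1 / t) *\<^sub>C Z)) \<longlongrightarrow> mat 1) (at 0 within ?H)"
    unfolding tendsto_iff eventually_at dist_norm
  proof (intro allI impI)
    fix e :: real assume "0 < e"
    then obtain R where R: "\<And>x. 0 < Re x \<Longrightarrow> R < norm x \<Longrightarrow>
        norm (Y0 x ** mexp (x *\<^sub>C (1 / u) *\<^sub>C Z) - mat 1) < e"
      using Y0(3)[of e] by auto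
    show "\<exists>d>0. \<forall>t\<in>?H. t \<noteq> 0 \<and> norm (t - 0) < d \<longrightarrow> norm (Y t ** mexp ((1 / t) *\<^sub>C Z) - mat 1) < e"
    proof (intro exI[of _ "1 / (\<bar>R\<bar> + 1)"] conjI ballI impI)
      fix t assume t: "t \<in> ?H" and d: "t \<noteq> 0 \<and> norm (t - 0) < 1 / (\<bar>R\<bar> + 1)"
      then have "\<bar>R\<bar> + 1 < 1 / norm t" by (simp add: field_simps)
      then have "R < norm (u / t)" using u(2) by (simp add: norm_divide)
      with R[of "u / t"] t show "norm (Y t ** mexp ((1 / t) *\<^sub>C Z) - mat 1) < e"
        by (simp only: H Y_eq[OF t] Zx)
    qed simp
  qed
  show ?thesis
  proof (rule ex1I[of _ Y])
    have "Y \<in> ?H \<rightarrow>\<^sub>E G" unfolding Y_def by (intro restrict_PiE_iff[THEN iffD2] ballI Y0(1)) (simp add: H)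
    moreover have "matrix_holomorphic_on Y ?H" using dY by (rule hmd_imp_holomorphic[OF openH])
    ultimately show "Y \<in> ?H \<rightarrow>\<^sub>E G \<and> matrix_holomorphic_on Y ?H \<and>
        (\<forall>t\<in>?H. has_matrix_derivative Y (((1 / t\<^sup>2) *\<^sub>C Z + (1 / t) *\<^sub>C f) ** Y t) t) \<and>
        ((\<lambda>t. Y t ** mexp ((1 / t) *\<^sub>C Z)) \<longlongrightarrow> mat 1) (at 0 within ?H)"
      using dY limY by blast
  next
    fix Y' assume Y': "Y' \<in> ?H \<rightarrow>\<^sub>E G \<and> matrix_holomorphic_on Y' ?H \<and>
        (\<forall>t\<in>?H. has_matrix_derivative Y' (((1 / t\<^sup>2) *\<^sub>C Z + (1 / t) *\<^sub>C f) ** Y' t) t) \<and>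
        ((\<lambda>t. Y' t ** mexp ((1 / t) *\<^sub>C Z)) \<longlongrightarrow> mat 1) (at 0 within ?H)"
    let ?Y1 = "\<lambda>x. Y' (u / x)"
    have G1: "?Y1 x \<in> G" if "x \<in> right_half_plane" for x
      using W(1)[of x] that Y' by (auto simp: PiE_iff)
    have d1: "has_matrix_derivative ?Y1 (coefficient f x ** ?Y1 x) x" if "x \<in> right_half_plane" for x
    proof -
      have x: "0 < Re x" "x \<noteq> 0" using that by auto
      let ?t = "u / x"
      have "has_matrix_derivative Y' (((1 / ?t\<^sup>2) *\<^sub>C Z + (1 / ?t) *\<^sub>C f) ** Y' ?t) ?t"
        using Y' W(1)[OF x(1)] by blast
      from hmd_chain[OF this d_inv[OF x(2)]]
      have "has_matrix_derivative ?Y1 ((- u / x\<^sup>2) *\<^sub>C (((1 / ?t\<^sup>2) *\<^sub>C Z + (1 / ?t) *\<^sub>C f) ** ?Y1 x)) x" .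
      moreover have "- u / x\<^sup>2 * (1 / ?t\<^sup>2) = - (1 / u)" "- u / x\<^sup>2 * (1 / ?t) = - (1 / x)"
        using u(1) x(2) by (simp_all add: power2_eq_square)
      then have "(- u / x\<^sup>2) *\<^sub>C ((1 / ?t\<^sup>2) *\<^sub>C Z + (1 / ?t) *\<^sub>C f) = coefficient f x"
        by (simp only: cscale_simps minus_add_distrib)
      ultimately show ?thesis by (simp only: matrix_mul_cscale_left[symmetric])
    qed
    have lim1: "\<exists>R. \<forall>x\<in>right_half_plane. R < norm x \<longrightarrow>
        norm (?Y1 x ** mexp (x *\<^sub>C (1 / u) *\<^sub>C Z) - mat 1) < e" if e: "0 < e" for e
    proof -
      have "\<forall>\<^sub>F t in at 0 within ?H. dist (Y' t ** mexp ((1 / t) *\<^sub>C Z)) (mat 1) < e"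
        using Y' e by (intro tendstoD) auto
      then obtain d where d: "0 < d" "\<And>t. t \<in> ?H \<Longrightarrow> t \<noteq> 0 \<Longrightarrow> norm t < d \<Longrightarrow>
          norm (Y' t ** mexp ((1 / t) *\<^sub>C Z) - mat 1) < e"
        unfolding eventually_at by (auto simp: dist_norm)
      show ?thesis
      proof (intro exI[of _ "1 / d"] ballI impI)
        fix x assume x: "x \<in> right_half_plane" "1 / d < norm x"
        then have "x \<noteq> 0" by auto
        then have "norm (u / x) < d" using x(2) d(1) u(2) by (simp add: norm_divide field_simps)
        with d(2)[OF W(1), of x] x \<open>x \<noteq> 0\<close> u(1)
        show "norm (?Y1 x ** mexp (x *\<^sub>C (1 / u) *\<^sub>C Z) - mat 1) < e"
          by (simp add: cscale_simps)
      qed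
    qed
    show "Y' = Y"
    proof (rule PiE_ext)
      show "Y' \<in> ?H \<rightarrow>\<^sub>E G" using Y' by blast
      show "Y \<in> ?H \<rightarrow>\<^sub>E G" unfolding Y_def by (intro restrict_PiE_iff[THEN iffD2] ballI Y0(1)) (simp add: H)
      fix t assume t: "t \<in> ?H"
      have "?Y1 (u / t) = Y0 (u / t)"
        by (rule canonical_solution_unique[OF G1 d1 lim1 Y0]) (use t H in auto)
      then show "Y' t = Y t" using t u(1) by (simp add: Y_eq)
    qed
  qed
qed

end
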